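(* Let $F=\mathfrak{f}(\eta)$ be a real-valued $\sigma(\eta)$-measurable random variable (so that $\mathbb{P}(|F|<\infty)=1$; no integrability is assumed). Then, for all $p\in[1,2]$, $$\mathbb{E}\,|F-F'|^p\ \leq\ 2^{3-p}\int_{\mathcal{Z}}\mathbb{E}\bigl[|D_z^+F|^p\bigr]\,\mu(dz),$$ where $F'$ is an independent copy of $F$. In particular, if the right-hand side is finite for some $p\in[1,2]$, then $F\in L^p(\mathbb{P})$.
   Context: $(\mathcal{Z},\mathscr{Z})$ is a measurable space, $\mu$ a $\sigma$-finite measure on it, and $\eta$ a Poisson random measure on $(\mathcal{Z},\mathscr{Z})$ with intensity $\mu$, viewed as a random element of the space $\mathbf{N}_\sigma$ of $\sigma$-finite $\mathbb{N}_0\cup\{+\infty\}$-valued measures on $\mathcal{Z}$ with its usual $\sigma$-field. Every real $\sigma(\eta)$-measurable random variable can be written $F=\mathfrak{f}(\eta)$ for a measurable $\mathfrak{f}:\mathbf{N}_\sigma\to\mathbb{R}$. The add-one cost operator is $D_z^+F:=\mathfrak{f}(\eta+\delta_z)-\mathfrak{f}(\eta)$, $z\in\mathcal{Z}$ (its definition is $\mathbb{P}\otimes\mu$-a.e. independent of the choice of $\mathfrak{f}$). The independent copy $F'$ may be defined on an enlarged probability space. *)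

theory Defs
  imports "HOL-Probability.Probability"
begin

text \<open>The measurable space of \<open>\<sigma>\<close>-finite measures on \<open>Z\<close> with values in the extended natural
  numbers, equipped with the \<open>\<sigma>\<close>-field generated by the evaluations \<open>\<nu> \<mapsto> \<nu> A\<close> for measurable \<open>A\<close>.
  Only the underlying measurable space of the argument \<open>Z\<close> matters.\<close>

definition N_sigma :: "'z measure \<Rightarrow> 'z measure measure" where
  "N_sigma Z =
    (SUP A \<in> sets Z. vimage_algebra
       {\<nu>. sets \<nu> = sets Z \<and> sigma_finite_measure \<nu> \<and>
            (\<forall>B\<in>sets Z. emeasure \<nu> B \<in> insert \<infinity> (range of_nat))}
       (\<lambda>\<nu>. emeasure \<nu> A) borel)"

text \<open>In the finite case the formula also covers \<open>\<mu> A = 0\<close>, where it gives \<open>\<eta> A = 0\<close> almost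
  surely since \<open>0 ^ 0 = 1\<close>.\<close>

definition poisson_random_measure ::
    "'w measure \<Rightarrow> 'z measure \<Rightarrow> ('w \<Rightarrow> 'z measure) \<Rightarrow> bool" where
  "poisson_random_measure M \<mu> \<eta> \<longleftrightarrow>
     \<eta> \<in> measurable M (N_sigma \<mu>) \<and>
     (\<forall>A\<in>sets \<mu>. emeasure \<mu> A < \<infinity> \<longrightarrow>
        (\<forall>k::nat. measure M {\<omega> \<in> space M. emeasure (\<eta> \<omega>) A = of_nat k} =
           measure \<mu> A ^ k / fact k * exp (- measure \<mu> A))) \<and>
     (\<forall>A\<in>sets \<mu>. emeasure \<mu> A = \<infinity> \<longrightarrow> (AE \<omega> in M. emeasure (\<eta> \<omega>) A = \<infinity>)) \<and>
     (\<forall>(n::nat) A. (\<forall>i<n. A i \<in> sets \<mu>) \<longrightarrow> disjoint_family_on A {..<n} \<longrightarrow>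
        prob_space.indep_vars M (\<lambda>_. borel) (\<lambda>i \<omega>. emeasure (\<eta> \<omega>) (A i)) {..<n})"

text \<open>The measure \<open>\<nu> + \<delta>\<^sub>z\<close>.\<close>

definition add_dirac :: "'z measure \<Rightarrow> 'z \<Rightarrow> 'z measure" where
  "add_dirac \<nu> z =
     measure_of (space \<nu>) (sets \<nu>) (\<lambda>A. emeasure \<nu> A + emeasure (return \<nu> z) A)"

definition add_one_cost ::
    "('z measure \<Rightarrow> real) \<Rightarrow> ('w \<Rightarrow> 'z measure) \<Rightarrow> 'z \<Rightarrow> 'w \<Rightarrow> real" where
  "add_one_cost f \<eta> z \<omega> = f (add_dirac (\<eta> \<omega>) z) - f (\<eta> \<omega>)"

text \<open>\<open>F'\<close> is an independent copy of \<open>F\<close> living on an enlargement \<open>M'\<close> of the probability space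
  \<open>M\<close>. The enlargement is given by a measure-preserving map \<open>\<pi>\<close> from \<open>M'\<close> to \<open>M\<close>, and \<open>F\<close> is
  identified with \<open>F \<circ> \<pi>\<close>. The case \<open>M' = M\<close>, \<open>\<pi> = id\<close> is allowed.\<close>

definition independent_copy ::
    "'w measure \<Rightarrow> ('w \<Rightarrow> real) \<Rightarrow> 'v measure \<Rightarrow> ('v \<Rightarrow> 'w) \<Rightarrow> ('v \<Rightarrow> real) \<Rightarrow> bool" where
  "independent_copy M F M' \<pi> F' \<longleftrightarrow>
     prob_space M' \<and> \<pi> \<in> measurable M' M \<and> distr M' M \<pi> = M \<and>
     F' \<in> borel_measurable M' \<and>
     prob_space.indep_var M' borel (F \<circ> \<pi>) borel F' \<and>
     distr M' borel F' = distr M borel F"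

lemma space_N_sigma:
  "space (N_sigma Z) =
     {\<nu>. sets \<nu> = sets Z \<and> sigma_finite_measure \<nu> \<and>
          (\<forall>B\<in>sets Z. emeasure \<nu> B \<in> insert \<infinity> (range of_nat))}"
  by (auto simp: N_sigma_def space_Sup_eq_UN)

lemma measurable_emeasure_N_sigma:
  "A \<in> sets Z \<Longrightarrow> (\<lambda>\<nu>. emeasure \<nu> A) \<in> borel_measurable (N_sigma Z)"
  unfolding N_sigma_def
  by (rule measurable_Sup1) (auto intro: measurable_vimage_algebra1)

lemma sets_add_dirac [simp]: "sets (add_dirac \<nu> z) = sets \<nu>"
  by (simp add: add_dirac_def)

lemma space_add_dirac [simp]: "space (add_dirac \<nu> z) = space \<nu>"
  by (simp add: add_dirac_def)

lemma emeasure_add_dirac: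
  assumes "A \<in> sets \<nu>"
  shows "emeasure (add_dirac \<nu> z) A = emeasure \<nu> A + indicator A z"
proof -
  have "countably_additive (sets \<nu>) (\<lambda>A. emeasure \<nu> A + emeasure (return \<nu> z) A)"
  proof (rule countably_additiveI)
    fix A :: "nat \<Rightarrow> 'a set"
    assume A: "range A \<subseteq> sets \<nu>" "disjoint_family A" "\<Union> (range A) \<in> sets \<nu>"
    have "(\<Sum>i. emeasure \<nu> (A i) + emeasure (return \<nu> z) (A i)) =
        (\<Sum>i. emeasure \<nu> (A i)) + (\<Sum>i. emeasure (return \<nu> z) (A i))"
      by (intro suminf_add [symmetric]) auto
    also have "\<dots> = emeasure \<nu> (\<Union> (range A)) + emeasure (return \<nu> z) (\<Union> (range A))"
      using A suminf_emeasure [of A \<nu>] suminf_emeasure [of A "return \<nu> z"]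
      by (simp del: emeasure_return)
    finally show "(\<Sum>i. emeasure \<nu> (A i) + emeasure (return \<nu> z) (A i)) =
        emeasure \<nu> (\<Union> (range A)) + emeasure (return \<nu> z) (\<Union> (range A))" .
  qed
  then have "emeasure (add_dirac \<nu> z) A = emeasure \<nu> A + emeasure (return \<nu> z) A"
    using assms unfolding add_dirac_def
    by (intro emeasure_measure_of_sigma) (auto simp: positive_def sets.sigma_algebra_axioms)
  with assms show ?thesis
    by simp
qed

lemma add_dirac_in_N_sigma:
  assumes "\<nu> \<in> space (N_sigma Z)"
  shows "add_dirac \<nu> z \<in> space (N_sigma Z)"
proof -
  from assms have sets_eq: "sets \<nu> = sets Z" and "sigma_finite_measure \<nu>"
    and val: "\<And>B. B \<in> sets Z \<Longrightarrow> emeasure \<nu> B \<in> insert \<infinity> (range of_nat)"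
    by (auto simp: space_N_sigma)
  then interpret sigma_finite_measure \<nu> by simp
  obtain C where C: "countable C" "C \<subseteq> sets \<nu>" "\<Union>C = space \<nu>" "\<forall>a\<in>C. emeasure \<nu> a \<noteq> \<infinity>"
    using sigma_finite_countable by auto
  have "sigma_finite_measure (add_dirac \<nu> z)"
  proof (unfold_locales, intro exI conjI ballI)
    fix a assume "a \<in> C"
    with C show "emeasure (add_dirac \<nu> z) a \<noteq> \<infinity>"
      by (auto simp: emeasure_add_dirac subset_eq indicator_def)
  qed (use C in auto)
  moreover have "emeasure (add_dirac \<nu> z) B \<in> insert \<infinity> (range of_nat)"
    if B: "B \<in> sets Z" for B
  proof -
    have "emeasure \<nu> B = \<infinity> \<or> (\<exists>k. emeasure \<nu> B = of_nat k)"
      using val [OF B] by auto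
    moreover have "emeasure (add_dirac \<nu> z) B = emeasure \<nu> B + of_nat (if z \<in> B then 1 else 0)"
      using B by (simp add: emeasure_add_dirac sets_eq)
    ultimately show ?thesis
    proof (elim disjE exE)
      fix k assume "emeasure \<nu> B = of_nat k"
        and "emeasure (add_dirac \<nu> z) B = emeasure \<nu> B + of_nat (if z \<in> B then 1 else 0)"
      then have "emeasure (add_dirac \<nu> z) B = of_nat (k + (if z \<in> B then 1 else 0))"
        by simp
      then show ?thesis
        by blast
    qed simp
  qed
  ultimately show ?thesis
    by (simp add: space_N_sigma sets_eq)
qed

end

theory Submission
  imports Defs
begin

text \<open>
  The proof is an Efron--Stein argument for the function \<open>|x|^p\<close>. For \<open>1 \<le> p \<le> 2\<close> and every real
  \<open>a\<close>, this function lies above its tangent at \<open>a\<close> and below the tangent plus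
  \<open>2^(2-p) |x - a|^p\<close> (\<open>abs_powr_expansion\<close>). Taking expectations, a random variable \<open>G\<close>
  satisfies \<open>E|G|^p \<le> |E G|^p + 2^(2-p) E|G - a|^p\<close> for every constant \<open>a\<close>. The constant need not
  be the mean, so it can be the value that a functional had before a point was added.

  Suppose first that the intensity is finite, say \<open>l\<close> times a probability measure \<open>b\<close>. The Poisson
  process arises from the zero measure by adding a Poisson number of independent points with law
  \<open>b\<close>. Adding such a point is a random move, two moves commute, and a Poisson number of moves is
  the limit of \<open>n\<close> lazy moves, each carried out with probability \<open>l/n\<close>. For one lazy move, the
  estimate above with \<open>a\<close> the value before the move bounds the gap between \<open>E|g|^p\<close> and
  \<open>|E g|^p\<close> by \<open>2^(2-p) (l/n)\<close> times the mean \<open>p\<close>-th power of the increment of \<open>g\<close>. Since moves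
  commute, Jensen's inequality carries this bound through the other moves (\<open>lazy_move_iterate\<close>).
  In the limit, \<open>E|g|^p - |E g|^p \<le> 2^(2-p) l \<integral> E|D_z g|^p b(dz)\<close> for bounded \<open>g\<close>. Used for
  \<open>g - g(\<xi>')\<close> with an independent copy \<open>\<xi>'\<close>, and once more for \<open>g - E g\<close>, this gives the
  constant \<open>2 * 2^(2-p) = 2^(3-p)\<close> (\<open>poisson_moved_difference_le\<close>).

  For a \<open>\<sigma>\<close>-finite intensity, fix a set \<open>B\<close> of finite intensity and resample the process inside
  \<open>B\<close> only. Given the configuration outside \<open>B\<close>, the finite case applies and bounds the effect
  of resampling by the integral over \<open>B\<close> (\<open>resampling_inequality\<close>). That the process splits
  independently into its parts inside and outside \<open>B\<close>, and that the inner part is the process built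
  above, follows by comparing Laplace functionals, which determine a law on \<open>N_sigma\<close>
  (\<open>laplace_unique\<close>). When \<open>B\<close> increases to the whole space, the resampled configuration
  approaches the independent copy (\<open>glue_tendsto_L1\<close>), and Fatou's lemma gives the inequality for
  bounded \<open>f\<close>. Truncating \<open>f\<close> at levels \<open>\<plusminus>K\<close> can only decrease \<open>|D_z f|\<close>, so a second use of
  Fatou's lemma removes the boundedness.
\<close>

section \<open>The function \<open>|x|^p\<close> for exponents between 1 and 2\<close>

text \<open>Subadditivity of \<open>t powr \<alpha>\<close>: since \<open>\<alpha> \<le> 1\<close>, the fractions \<open>x/y\<close> and \<open>(y-x)/y\<close>, which add
  up to 1, do not decrease when raised to the power \<open>\<alpha>\<close>.\<close>

lemma powr_diff_le:
  fixes x y \<alpha> :: real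
  assumes "0 \<le> x" "x \<le> y" "0 < \<alpha>" "\<alpha> \<le> 1"
  shows "y powr \<alpha> - x powr \<alpha> \<le> (y - x) powr \<alpha>"
proof (cases "y = 0")
  case False
  then have y: "y > 0" using assms by simp
  have *: "t \<le> t powr \<alpha>" if "0 \<le> t" "t \<le> 1" for t :: real
    using that assms by (cases "t = 0") (auto simp: powr_mono' [of \<alpha> 1 t, simplified])
  have "1 \<le> (x / y) powr \<alpha> + ((y - x) / y) powr \<alpha>"
    using *[of "x / y"] *[of "(y - x) / y"] y assms by (simp add: diff_divide_distrib)
  then have "y powr \<alpha> * 1 \<le> y powr \<alpha> * ((x / y) powr \<alpha> + ((y - x) / y) powr \<alpha>)"
    by (intro mult_left_mono) auto
  also have "\<dots> = x powr \<alpha> + (y - x) powr \<alpha>"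
    using y assms by (simp add: distrib_left powr_divide)
  finally show ?thesis by simp
qed (use assms in auto)

text \<open>Concavity of \<open>t powr \<alpha>\<close> at the midpoint \<open>m\<close> of \<open>x\<close> and \<open>y\<close>: Young's inequality is the
  tangent bound there, and the factor \<open>2 powr (1 - \<alpha>)\<close> comes from \<open>2 * m powr \<alpha>\<close>.\<close>

lemma powr_add_le_mean:
  fixes x y \<alpha> :: real
  assumes "0 \<le> x" "0 \<le> y" "0 < \<alpha>" "\<alpha> \<le> 1"
  shows "x powr \<alpha> + y powr \<alpha> \<le> 2 powr (1 - \<alpha>) * (x + y) powr \<alpha>"
proof (cases "x + y = 0")
  case False
  define m where "m = (x + y) / 2"
  have m: "m > 0" using False assms by (simp add: m_def)
  have *: "t powr \<alpha> \<le> m powr \<alpha> * (\<alpha> * (t / m) + (1 - \<alpha>))" if "0 \<le> t" for t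
  proof -
    have "(t / m) powr \<alpha> \<le> \<alpha> * (t / m) + (1 - \<alpha>)"
      using Youngs_inequality_0 [of \<alpha> "1 - \<alpha>" "t / m" 1] that m assms
      by (cases "t = 0") auto
    then have "m powr \<alpha> * (t / m) powr \<alpha> \<le> m powr \<alpha> * (\<alpha> * (t / m) + (1 - \<alpha>))"
      by (intro mult_left_mono) auto
    then show ?thesis using that m by (simp add: powr_divide)
  qed
  have "x powr \<alpha> + y powr \<alpha> \<le> m powr \<alpha> * (\<alpha> * ((x + y) / m) + 2 * (1 - \<alpha>))"
    using *[of x] *[of y] assms by (simp add: algebra_simps add_divide_distrib)
  also have "(x + y) / m = 2" using m by (simp add: m_def nonzero_divide_eq_eq)
  also have "m powr \<alpha> * (\<alpha> * 2 + 2 * (1 - \<alpha>)) = 2 powr (1 - \<alpha>) * (x + y) powr \<alpha>"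
    using assms by (simp add: m_def powr_divide powr_diff field_simps)
  finally show ?thesis .
next
  case True
  then have "x = 0" "y = 0" using assms by auto
  then show ?thesis by simp
qed

text \<open>Hoelder continuity of the derivative of \<open>|x| powr (\<alpha> + 1)\<close>, up to a constant factor. The worst
  case is \<open>x = -y\<close>, which is where the constant \<open>2 powr (1 - \<alpha>)\<close> arises; it becomes \<open>2^(2-p)\<close>
  for \<open>\<alpha> = p - 1\<close>.\<close>

lemma signed_powr_diff_le:
  fixes x y \<alpha> :: real
  assumes "x \<le> y" "0 < \<alpha>" "\<alpha> \<le> 1"
  shows "sgn y * \<bar>y\<bar> powr \<alpha> - sgn x * \<bar>x\<bar> powr \<alpha> \<le> 2 powr (1 - \<alpha>) * (y - x) powr \<alpha>"
proof -
  have one: "(y - x) powr \<alpha> \<le> 2 powr (1 - \<alpha>) * (y - x) powr \<alpha>"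
    using assms ge_one_powr_ge_zero[of 2 "1 - \<alpha>"] by (simp add: mult_le_cancel_right1)
  \<comment> \<open>Only when the interval contains 0 is the factor in front needed.\<close>
  consider "0 \<le> x" | "y \<le> 0" | "x < 0" "0 < y" by linarith
  then show ?thesis
  proof cases
    case 1
    then have "sgn y * \<bar>y\<bar> powr \<alpha> = y powr \<alpha>" "sgn x * \<bar>x\<bar> powr \<alpha> = x powr \<alpha>"
      using assms by (auto simp: sgn_if)
    then show ?thesis using powr_diff_le[of x y \<alpha>] 1 assms one by linarith
  next
    case 2
    then have "sgn y * \<bar>y\<bar> powr \<alpha> = - ((-y) powr \<alpha>)" "sgn x * \<bar>x\<bar> powr \<alpha> = - ((-x) powr \<alpha>)"
      using assms by (auto simp: sgn_if)
    then show ?thesis using powr_diff_le[of "-y" "-x" \<alpha>] 2 assms one by simp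
  next
    case 3
    then show ?thesis using powr_add_le_mean[of "-x" y \<alpha>] assms by (simp add: add.commute)
  qed
qed

lemma signed_powr_mono:
  fixes x y \<alpha> :: real
  assumes "x \<le> y" "0 < \<alpha>"
  shows "sgn x * \<bar>x\<bar> powr \<alpha> \<le> sgn y * \<bar>y\<bar> powr \<alpha>"
proof -
  have "- ((-x) powr \<alpha>) \<le> y powr \<alpha>"
    by (rule order_trans[of _ 0]) auto
  moreover have "x powr \<alpha> \<le> y powr \<alpha>" if "0 \<le> x"
    using that assms by (intro powr_mono2) auto
  moreover have "(-y) powr \<alpha> \<le> (-x) powr \<alpha>" if "y \<le> 0"
    using that assms by (intro powr_mono2) auto
  ultimately show ?thesis using assms by (auto simp: sgn_if abs_if)
qed

lemma DERIV_abs_powr: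
  fixes x p :: real
  assumes "1 < p"
  shows "((\<lambda>x. \<bar>x\<bar> powr p) has_real_derivative p * (sgn x * \<bar>x\<bar> powr (p - 1))) (at x)"
proof -
  consider "x > 0" | "x < 0" | "x = 0" by linarith
  then show ?thesis
  proof cases
    case 1
    have "((\<lambda>x. x powr p) has_real_derivative p * x powr (p - 1)) (at x)"
      using 1 by (auto intro!: derivative_eq_intros)
    then have "((\<lambda>x. \<bar>x\<bar> powr p) has_real_derivative p * x powr (p - 1)) (at x)"
      by (rule has_field_derivative_transform_within_open[of _ _ _ "{0<..}"]) (use 1 in auto)
    with 1 show ?thesis by simp
  next
    case 2
    have "((\<lambda>x. (-x) powr p) has_real_derivative - (p * (-x) powr (p - 1))) (at x)"
      using 2 by (auto intro!: derivative_eq_intros)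
    then have "((\<lambda>x. \<bar>x\<bar> powr p) has_real_derivative - (p * (-x) powr (p - 1))) (at x)"
      by (rule has_field_derivative_transform_within_open[of _ _ _ "{..<0}"]) (use 2 in auto)
    with 2 show ?thesis by simp
  next
    case 3
    have "((\<lambda>h. \<bar>h\<bar> powr (p - 1)) \<longlongrightarrow> 0 powr (p - 1)) (at (0::real))"
      using assms by (intro tendsto_powr2 tendsto_eq_intros) (auto intro!: always_eventually)
    then have "((\<lambda>h. \<bar>h\<bar> powr (p - 1)) \<longlongrightarrow> 0) (at (0::real))"
      using assms by simp
    then have "((\<lambda>h. (\<bar>h\<bar> powr p) / h) \<longlongrightarrow> 0) (at (0::real))"
    proof (rule Lim_null_comparison[rotated])
      have "norm (\<bar>h\<bar> powr p / h) \<le> \<bar>h\<bar> powr (p - 1)" if "h \<noteq> 0" for h :: real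
        using that by (simp add: powr_diff)
      then show "\<forall>\<^sub>F h in at (0::real). norm (\<bar>h\<bar> powr p / h) \<le> \<bar>h\<bar> powr (p - 1)"
        by (auto simp: eventually_at_filter)
    qed
    with 3 assms show ?thesis by (simp add: DERIV_def)
  qed
qed

text \<open>Both bounds hold with equality at \<open>d = 0\<close>, so it suffices to compare derivatives in \<open>d\<close>. For the
  lower bound this is monotonicity of the derivative of \<open>|x|^p\<close>, for the upper bound its Hoelder
  continuity with exponent \<open>p - 1\<close>.\<close>

lemma abs_powr_expansion_right:
  fixes a d p :: real
  assumes p: "1 < p" "p \<le> 2" and d: "0 \<le> d"
  defines "v \<equiv> p * (sgn a * \<bar>a\<bar> powr (p - 1))"
  shows "\<bar>a\<bar> powr p + v * d \<le> \<bar>a + d\<bar> powr p"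
    and "\<bar>a + d\<bar> powr p \<le> \<bar>a\<bar> powr p + v * d + 2 powr (2 - p) * d powr p"
proof -
  let ?s = "\<lambda>x::real. p * (sgn x * \<bar>x\<bar> powr (p - 1))"
  have D: "((\<lambda>t. \<bar>a + t\<bar> powr p) has_real_derivative ?s (a + t)) (at t)" for t
    using DERIV_chain2[OF DERIV_abs_powr[OF p(1)], of "\<lambda>t. a + t" 1 t UNIV]
      DERIV_add[OF DERIV_const DERIV_ident, of a t UNIV] by simp
  have cont: "continuous_on {0..d} (\<lambda>t. \<bar>a + t\<bar> powr p)"
    by (rule continuous_at_imp_continuous_on) (use D DERIV_isCont in blast)
  let ?h = "\<lambda>t. \<bar>a + t\<bar> powr p - (\<bar>a\<bar> powr p + v * t)"
  have "?h 0 \<le> ?h d"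
  proof (rule DERIV_nonneg_imp_increasing_open[OF d])
    fix t assume t: "0 < t" "t < d"
    have "(?h has_real_derivative ?s (a + t) - v) (at t)"
      by (rule derivative_eq_intros D refl | simp)+
    moreover have "?s (a + t) - v \<ge> 0"
      using signed_powr_mono[of a "a + t" "p - 1"] p t by (simp add: v_def)
    ultimately show "\<exists>y. (?h has_real_derivative y) (at t) \<and> 0 \<le> y" by blast
  qed (intro continuous_intros cont)
  then show "\<bar>a\<bar> powr p + v * d \<le> \<bar>a + d\<bar> powr p" by simp
  let ?k = "\<lambda>t. \<bar>a\<bar> powr p + v * t + 2 powr (2 - p) * t powr p - \<bar>a + t\<bar> powr p"
  have "?k 0 \<le> ?k d"
  proof (rule DERIV_nonneg_imp_increasing_open[OF d])
    fix t assume t: "0 < t" "t < d"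
    have "((\<lambda>t. \<bar>a\<bar> powr p + v * t + 2 powr (2 - p) * t powr p) has_real_derivative
        v + 2 powr (2 - p) * (p * t powr (p - 1))) (at t)"
      using DERIV_add[OF DERIV_add[OF DERIV_const DERIV_cmult_Id]
          DERIV_cmult[OF has_real_derivative_powr[OF t(1)]]]
      by simp
    then have k: "(?k has_real_derivative v + 2 powr (2 - p) * (p * t powr (p - 1)) - ?s (a + t)) (at t)"
      by (rule DERIV_diff[OF _ D])
    have "v + 2 powr (2 - p) * (p * t powr (p - 1)) - ?s (a + t) =
        p * (2 powr (1 - (p - 1)) * (a + t - a) powr (p - 1) -
          (sgn (a + t) * \<bar>a + t\<bar> powr (p - 1) - sgn a * \<bar>a\<bar> powr (p - 1)))"
      by (simp add: v_def algebra_simps)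
    moreover have "\<dots> \<ge> 0"
      using signed_powr_diff_le[of a "a + t" "p - 1"] p t by (intro mult_nonneg_nonneg) auto
    ultimately have "0 \<le> v + 2 powr (2 - p) * (p * t powr (p - 1)) - ?s (a + t)"
      by simp
    with k show "\<exists>y. (?k has_real_derivative y) (at t) \<and> 0 \<le> y" by blast
  next
    have "continuous_on {0..d} (\<lambda>t. t powr p)"
      using p by (intro continuous_on_powr' continuous_intros) auto
    then show "continuous_on {0..d} ?k"
      by (intro continuous_on_diff[OF _ cont] continuous_on_add continuous_on_mult continuous_on_const
        continuous_on_id)
  qed
  then show "\<bar>a + d\<bar> powr p \<le> \<bar>a\<bar> powr p + v * d + 2 powr (2 - p) * d powr p"
    using p by simp
qed

text \<open>Increments to the left of \<open>a\<close> reduce to increments to the right by the symmetry \<open>x \<mapsto> -x\<close>.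
  For \<open>p = 1\<close> there is no derivative at \<open>0\<close>, but the slope \<open>sgn a\<close> works for every \<open>a\<close>.\<close>

lemma abs_powr_expansion:
  fixes a p :: real
  assumes "1 \<le> p" "p \<le> 2"
  obtains v where "\<And>x. \<bar>a\<bar> powr p + v * (x - a) \<le> \<bar>x\<bar> powr p"
    and "\<And>x. \<bar>x\<bar> powr p \<le> \<bar>a\<bar> powr p + v * (x - a) + 2 powr (2 - p) * \<bar>x - a\<bar> powr p"
proof (cases "p = 1")
  case True
  show ?thesis
    by (rule that[of "sgn a"]) (auto simp: True sgn_if abs_if)
next
  case False
  with assms have p: "1 < p" "p \<le> 2" by auto
  define v where "v = p * (sgn a * \<bar>a\<bar> powr (p - 1))"
  have "\<bar>a\<bar> powr p + v * (x - a) \<le> \<bar>x\<bar> powr p \<and>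
      \<bar>x\<bar> powr p \<le> \<bar>a\<bar> powr p + v * (x - a) + 2 powr (2 - p) * \<bar>x - a\<bar> powr p" for x
  proof (cases "a \<le> x")
    case True
    then show ?thesis
      using abs_powr_expansion_right[OF p, of "x - a" a] by (simp add: v_def)
  next
    case False
    then show ?thesis
      using abs_powr_expansion_right[OF p, of "a - x" "-a"]
      by (simp add: v_def algebra_simps abs_minus_commute)
  qed
  then show ?thesis by (intro that) auto
qed

section \<open>Bounded measurable functions\<close>

definition bounded_measurable :: "'a measure \<Rightarrow> ('a \<Rightarrow> real) \<Rightarrow> bool" where
  "bounded_measurable N h \<longleftrightarrow>
     h \<in> borel_measurable N \<and> (\<exists>K. \<forall>s\<in>space N. \<bar>h s\<bar> \<le> K)"

lemma bounded_measurableI: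
  "h \<in> borel_measurable N \<Longrightarrow> (\<And>s. s \<in> space N \<Longrightarrow> \<bar>h s\<bar> \<le> K) \<Longrightarrow> bounded_measurable N h"
  by (auto simp: bounded_measurable_def)

lemma bounded_measurableD [dest]: "bounded_measurable N h \<Longrightarrow> h \<in> borel_measurable N"
  by (simp add: bounded_measurable_def)

lemma bounded_measurableE:
  assumes "bounded_measurable N h"
  obtains K where "0 \<le> K" "\<And>s. s \<in> space N \<Longrightarrow> \<bar>h s\<bar> \<le> K"
proof -
  obtain K where "\<And>s. s \<in> space N \<Longrightarrow> \<bar>h s\<bar> \<le> K"
    using assms by (auto simp: bounded_measurable_def)
  then show ?thesis
    by (intro that[of "max 0 K"]) (auto simp: le_max_iff_disj)
qed

lemma bounded_measurable_const [simp]: "bounded_measurable N (\<lambda>_. c)"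
  by (rule bounded_measurableI[of _ _ "\<bar>c\<bar>"]) auto

lemma bounded_measurable_add:
  assumes "bounded_measurable N g" "bounded_measurable N h"
  shows "bounded_measurable N (\<lambda>s. g s + h s)"
proof -
  obtain K where K: "\<And>s. s \<in> space N \<Longrightarrow> \<bar>g s\<bar> \<le> K"
    using bounded_measurableE[OF assms(1)] by blast
  obtain L where L: "\<And>s. s \<in> space N \<Longrightarrow> \<bar>h s\<bar> \<le> L"
    using bounded_measurableE[OF assms(2)] by blast
  have "\<bar>g s + h s\<bar> \<le> K + L" if "s \<in> space N" for s
    using K[OF that] L[OF that] by linarith
  moreover have "(\<lambda>s. g s + h s) \<in> borel_measurable N"
    by (intro borel_measurable_add bounded_measurableD assms)
  ultimately show ?thesis
    unfolding bounded_measurable_def by blast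
qed

lemma bounded_measurable_cmult:
  assumes "bounded_measurable N h"
  shows "bounded_measurable N (\<lambda>s. c * h s)"
proof -
  obtain K where "\<And>s. s \<in> space N \<Longrightarrow> \<bar>h s\<bar> \<le> K"
    using bounded_measurableE[OF assms(1)] by blast
  then show ?thesis
    using assms by (intro bounded_measurableI[of _ _ "\<bar>c\<bar> * K"])
      (auto simp: abs_mult intro!: mult_left_mono)
qed

lemma bounded_measurable_diff:
  assumes "bounded_measurable N g" "bounded_measurable N h"
  shows "bounded_measurable N (\<lambda>s. g s - h s)"
  using bounded_measurable_add[OF assms(1) bounded_measurable_cmult[OF assms(2), of "-1"]] by simp

lemma bounded_measurable_abs_powr:
  assumes "bounded_measurable N h" "0 \<le> p"
  shows "bounded_measurable N (\<lambda>s. \<bar>h s\<bar> powr p)"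
proof -
  have [measurable]: "h \<in> borel_measurable N"
    using assms by auto
  obtain K where "\<And>s. s \<in> space N \<Longrightarrow> \<bar>h s\<bar> \<le> K"
    using bounded_measurableE[OF assms(1)] by blast
  then show ?thesis
    using assms by (intro bounded_measurableI[of _ _ "K powr p"]) (auto intro!: powr_mono2)
qed

lemma bounded_measurable_compose:
  assumes "bounded_measurable N h" "f \<in> measurable L N"
  shows "bounded_measurable L (\<lambda>x. h (f x))"
proof -
  obtain K where K: "\<And>s. s \<in> space N \<Longrightarrow> \<bar>h s\<bar> \<le> K"
    using bounded_measurableE[OF assms(1)] by blast
  show ?thesis
    by (rule bounded_measurableI[OF measurable_compose[OF assms(2) bounded_measurableD[OF assms(1)]]])
      (rule K, rule measurable_space[OF assms(2)])
qed

lemma (in finite_measure) integrable_bounded_measurable: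
  assumes "bounded_measurable M h"
  shows "integrable M h"
proof -
  obtain K where "\<And>s. s \<in> space M \<Longrightarrow> \<bar>h s\<bar> \<le> K"
    using bounded_measurableE[OF assms(1)] by blast
  then show ?thesis
    using assms by (intro integrable_const_bound[of _ K]) auto
qed

lemma (in prob_space) bounded_integral:
  assumes "bounded_measurable M h" "\<And>s. s \<in> space M \<Longrightarrow> \<bar>h s\<bar> \<le> K"
  shows "\<bar>\<integral>s. h s \<partial>M\<bar> \<le> K"
proof -
  have "\<bar>\<integral>s. h s \<partial>M\<bar> \<le> (\<integral>s. \<bar>h s\<bar> \<partial>M)"
    by (rule integral_abs_bound)
  also have "\<dots> \<le> K"
    using integrable_bounded_measurable[OF assms(1)] assms(2)
    by (intro integral_le_const) auto
  finally show ?thesis .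
qed

text \<open>Jensen's inequality for the mixture that takes the value \<open>u\<close> with weight \<open>1 - q\<close> and an
  independent copy of \<open>X\<close> with weight \<open>q\<close>. This is the form needed for a lazy move.\<close>

lemma (in prob_space) jensen_abs_powr:
  assumes X: "bounded_measurable M X" and p: "1 \<le> p" "p \<le> 2" and q: "0 \<le> q" "q \<le> 1"
  shows "\<bar>(1 - q) * u + q * (\<integral>x. X x \<partial>M)\<bar> powr p \<le>
    (1 - q) * \<bar>u\<bar> powr p + q * (\<integral>x. \<bar>X x\<bar> powr p \<partial>M)"
proof -
  define a where "a = (1 - q) * u + q * (\<integral>x. X x \<partial>M)"
  obtain v where v: "\<And>x. \<bar>a\<bar> powr p + v * (x - a) \<le> \<bar>x\<bar> powr p"
    using abs_powr_expansion[OF p, of a] by metis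
  have [simp]: "integrable M X" "integrable M (\<lambda>x. \<bar>X x\<bar> powr p)"
    using X p by (auto intro!: integrable_bounded_measurable bounded_measurable_abs_powr)
  have "\<bar>a\<bar> powr p + v * ((\<integral>x. X x \<partial>M) - a) = (\<integral>x. \<bar>a\<bar> powr p + v * (X x - a) \<partial>M)"
    by (simp add: prob_space)
  also have "\<dots> \<le> (\<integral>x. \<bar>X x\<bar> powr p \<partial>M)"
    by (intro integral_mono v) auto
  finally have "q * (\<bar>a\<bar> powr p + v * ((\<integral>x. X x \<partial>M) - a)) \<le> q * (\<integral>x. \<bar>X x\<bar> powr p \<partial>M)"
    using q by (intro mult_left_mono)
  moreover have "(1 - q) * (\<bar>a\<bar> powr p + v * (u - a)) \<le> (1 - q) * \<bar>u\<bar> powr p"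
    using q by (intro mult_left_mono v) auto
  moreover have "(1 - q) * (\<bar>a\<bar> powr p + v * (u - a)) + q * (\<bar>a\<bar> powr p + v * ((\<integral>x. X x \<partial>M) - a)) =
      \<bar>a\<bar> powr p + v * ((1 - q) * u + q * (\<integral>x. X x \<partial>M) - a)"
    by (simp add: algebra_simps)
  ultimately show ?thesis
    unfolding a_def[symmetric] by simp
qed

section \<open>From binomial to Poisson weights\<close>

text \<open>Pascal's rule, read as: the \<open>(n+1)\<close>-st of \<open>n + 1\<close> lazy moves either stays or shifts the number
  of actual moves by one.\<close>

lemma binomial_sum_Suc:
  fixes q :: real and x :: "nat \<Rightarrow> real"
  shows "(\<Sum>k\<le>Suc n. real (Suc n choose k) * q ^ k * (1 - q) ^ (Suc n - k) * x k) =
    (\<Sum>k\<le>n. real (n choose k) * q ^ k * (1 - q) ^ (n - k) * ((1 - q) * x k + q * x (Suc k)))"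
proof -
  have "(\<Sum>k\<le>Suc n. real (Suc n choose k) * q ^ k * (1 - q) ^ (Suc n - k) * x k) =
      (1 - q) ^ Suc n * x 0 +
      (\<Sum>k\<le>n. real (n choose Suc k) * q ^ Suc k * (1 - q) ^ (n - k) * x (Suc k)) +
      (\<Sum>k\<le>n. real (n choose k) * q ^ Suc k * (1 - q) ^ (n - k) * x (Suc k))"
    by (subst sum.atMost_Suc_shift) (simp add: sum.distrib algebra_simps del: power_Suc)
  also have "(1 - q) ^ Suc n * x 0 +
      (\<Sum>k\<le>n. real (n choose Suc k) * q ^ Suc k * (1 - q) ^ (n - k) * x (Suc k)) =
      (\<Sum>k\<le>Suc n. real (n choose k) * q ^ k * (1 - q) ^ (Suc n - k) * x k)"
    by (subst sum.atMost_Suc_shift) simp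
  also have "\<dots> = (\<Sum>k\<le>n. real (n choose k) * q ^ k * (1 - q) ^ (Suc n - k) * x k)"
    by simp
  also have "\<dots> = (\<Sum>k\<le>n. real (n choose k) * q ^ k * (1 - q) ^ (n - k) * ((1 - q) * x k))"
    by (intro sum.cong) (auto simp: Suc_diff_le)
  finally have "(\<Sum>k\<le>Suc n. real (Suc n choose k) * q ^ k * (1 - q) ^ (Suc n - k) * x k) =
      (\<Sum>k\<le>n. real (n choose k) * q ^ k * (1 - q) ^ (n - k) * ((1 - q) * x k)) +
      (\<Sum>k\<le>n. real (n choose k) * q ^ Suc k * (1 - q) ^ (n - k) * x (Suc k))" .
  also have "(\<Sum>k\<le>n. real (n choose k) * q ^ Suc k * (1 - q) ^ (n - k) * x (Suc k)) =
      (\<Sum>k\<le>n. real (n choose k) * q ^ k * (1 - q) ^ (n - k) * (q * x (Suc k)))"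
    by (simp add: mult_ac)
  finally show ?thesis
    by (simp only: distrib_left sum.distrib)
qed

lemma binomial_over_power_tendsto:
  "(\<lambda>n. real (n choose k) / real n ^ k) \<longlonglongrightarrow> 1 / fact k"
proof (induction k)
  case (Suc k)
  have "(\<lambda>n. 1 - real k / real n) \<longlonglongrightarrow> 1 - 0"
    by (intro tendsto_intros lim_const_over_n)
  then have "(\<lambda>n. real (n choose k) / real n ^ k * ((1 - real k / real n) / real (Suc k)))
      \<longlonglongrightarrow> 1 / fact k * ((1 - 0) / real (Suc k))"
    by (intro tendsto_intros Suc) auto
  then have lim: "(\<lambda>n. real (n choose k) / real n ^ k * ((1 - real k / real n) / real (Suc k)))
      \<longlonglongrightarrow> 1 / fact (Suc k)"
    by (simp add: field_simps)
  have "real (n choose k) / real n ^ k * ((1 - real k / real n) / real (Suc k)) =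
      real (n choose Suc k) / real n ^ Suc k" if "n > k" for n
  proof -
    have "Suc k * (n choose Suc k) = (n - k) * (n choose k)"
      by (simp only: binomial_absorption binomial_absorb_comp)
    then have "real (Suc k) * real (n choose Suc k) = real (n - k) * real (n choose k)"
      by (simp only: of_nat_mult [symmetric])
    then have "real (n choose Suc k) = (real n - real k) * real (n choose k) / real (Suc k)"
      using that by (simp add: of_nat_diff field_simps)
    then show ?thesis
      using that by (simp only:) (simp add: divide_simps)
  qed
  then show ?case
    by (intro Lim_transform_eventually[OF lim] eventually_mono[OF eventually_gt_at_top[of k]])
qed simp

text \<open>The Poisson limit of binomial expectations. Tannery's theorem applies because the \<open>k\<close>-th binomial
  weight is at most \<open>l^k / k!\<close>, uniformly in \<open>n > l\<close>.\<close>

lemma binomial_sum_tendsto_poisson: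
  fixes a :: "nat \<Rightarrow> real" and l :: real
  assumes l: "0 \<le> l" and a: "\<And>k. \<bar>a k\<bar> \<le> K"
  shows "(\<lambda>n. \<Sum>k\<le>n. real (n choose k) * (l / real n) ^ k * (1 - l / real n) ^ (n - k) * a k)
    \<longlonglongrightarrow> (\<Sum>k. l ^ k / fact k * exp (- l) * a k)"
proof -
  define c where "c k n = real (n choose k) * (l / real n) ^ k * (1 - l / real n) ^ (n - k) * a k" for k n
  have "(\<lambda>n. \<Sum>k. c k n) \<longlonglongrightarrow> (\<Sum>k. l ^ k / fact k * exp (- l) * a k)"
  proof (rule tannerys_theorem[THEN conjunct2, THEN conjunct2])
    fix k
    have "(\<lambda>n. (1 + (- l) / real n) ^ n) \<longlonglongrightarrow> exp (- l)"
      by (rule tendsto_exp_limit_sequentially)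
    moreover have "(\<lambda>n. (1 + (- l) / real n) ^ k) \<longlonglongrightarrow> (1 + 0) ^ k"
      by (intro tendsto_intros lim_const_over_n)
    ultimately have exp_lim: "(\<lambda>n. (1 + (- l) / real n) ^ n / (1 + (- l) / real n) ^ k) \<longlonglongrightarrow> exp (- l) / (1 + 0) ^ k"
      by (intro tendsto_intros) auto
    have "(\<lambda>n. real (n choose k) / real n ^ k * l ^ k *
        ((1 + (- l) / real n) ^ n / (1 + (- l) / real n) ^ k) * a k) \<longlonglongrightarrow>
        1 / fact k * l ^ k * (exp (- l) / (1 + 0) ^ k) * a k"
      by (intro tendsto_mult tendsto_const binomial_over_power_tendsto exp_lim)
    moreover have "eventually (\<lambda>n. real (n choose k) / real n ^ k * l ^ k *
        ((1 + (- l) / real n) ^ n / (1 + (- l) / real n) ^ k) * a k = c k n) sequentially"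
    proof -
      have "eventually (\<lambda>n. n > max k (nat \<lceil>l\<rceil>)) sequentially"
        by (rule eventually_gt_at_top)
      then show ?thesis
      proof eventually_elim
        case (elim n)
        then have n: "k \<le> n" "l < real n" by linarith+
        then have "1 - l / real n \<noteq> 0" using l by auto
        with n show ?case
          by (simp add: c_def power_diff power_divide)
      qed
    qed
    ultimately show "(\<lambda>n. c k n) \<longlonglongrightarrow> l ^ k / fact k * exp (- l) * a k"
      by (auto intro: Lim_transform_eventually)
  next
    have "norm (c k n) \<le> l ^ k / fact k * K" if n: "n > max 0 (nat \<lceil>l\<rceil>)" for k n
    proof (cases "k \<le> n")
      case True
      have n: "l < real n" "n > 0" using that by linarith+
      have K: "0 \<le> K" using a[of 0] by linarith
      have "real (n choose k) * (l / real n) ^ k \<le> l ^ k / fact k"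
      proof -
        have "real (n choose k) * fact k \<le> real n ^ k"
          using binomial_fact_pow[of n k, folded of_nat_le_iff[where 'a = real]] by simp
        then have "l ^ k * (real (n choose k) * fact k) \<le> l ^ k * real n ^ k"
          using l by (intro mult_left_mono) auto
        then show ?thesis using n by (simp add: power_divide field_simps)
      qed
      moreover have "(1 - l / real n) ^ (n - k) \<le> 1" "0 \<le> (1 - l / real n) ^ (n - k)"
        using n l by (auto intro!: power_le_one)
      ultimately have "real (n choose k) * (l / real n) ^ k * (1 - l / real n) ^ (n - k) \<le> l ^ k / fact k * 1"
        using l by (intro mult_mono) auto
      then have "real (n choose k) * (l / real n) ^ k * (1 - l / real n) ^ (n - k) * \<bar>a k\<bar> \<le> l ^ k / fact k * K"
        using l a[of k] K by (intro mult_mono) auto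
      moreover have "norm (c k n) = real (n choose k) * (l / real n) ^ k * (1 - l / real n) ^ (n - k) * \<bar>a k\<bar>"
        using l n by (simp add: c_def abs_mult)
      ultimately show ?thesis by simp
    next
      case False
      have "0 \<le> K" using a[of 0] by linarith
      with False l show ?thesis by (simp add: c_def binomial_eq_0)
    qed
    then show "eventually (\<lambda>(k, n). norm (c k n) \<le> l ^ k / fact k * K) (at_top \<times>\<^sub>F sequentially)"
      by (intro eventually_mono[OF eventually_prodI[OF eventually_True
        eventually_gt_at_top[of "max 0 (nat \<lceil>l\<rceil>)"]]]) auto
  next
    show "summable (\<lambda>k. l ^ k / fact k * K)"
      using summable_exp[of l] by (intro summable_mult2) (simp add: field_simps)
  qed simp
  moreover have "(\<Sum>k. c k n) = (\<Sum>k\<le>n. c k n)" for n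
    by (rule suminf_finite) (auto simp: c_def)
  ultimately show ?thesis by (simp add: c_def)
qed

lemma integral_poisson_pmf:
  fixes a :: "nat \<Rightarrow> real"
  assumes l: "0 < l" and a: "\<And>k. \<bar>a k\<bar> \<le> K"
  shows "(\<integral>k. a k \<partial>measure_pmf (poisson_pmf l)) = (\<Sum>k. l ^ k / fact k * exp (- l) * a k)"
proof -
  have "integrable (measure_pmf (poisson_pmf l)) a"
    using a by (intro measure_pmf.integrable_const_bound[of _ K]) auto
  then have "integrable (count_space UNIV) (\<lambda>k. pmf (poisson_pmf l) k *\<^sub>R a k)"
    unfolding measure_pmf_eq_density by (subst (asm) integrable_density) auto
  then show ?thesis
    unfolding measure_pmf_eq_density using l
    by (subst integral_density) (auto simp: integral_count_space_nat)
qed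

section \<open>Random numbers of commuting random moves\<close>

text \<open>A state in \<open>N\<close> is changed by a random element of \<open>b\<close>, and the order of two changes does not matter.
  The states are kept abstract since nothing else about point configurations enters in this part; in
  the application \<open>act\<close> is \<open>add_dirac\<close>.\<close>

locale commuting_moves = prob_space b for b :: "'z measure" +
  fixes N :: "'s measure" and act :: "'s \<Rightarrow> 'z \<Rightarrow> 's"
  assumes measurable_act [measurable]: "(\<lambda>(s, z). act s z) \<in> N \<Otimes>\<^sub>M b \<rightarrow>\<^sub>M N"
    and act_commute: "\<And>s y z. s \<in> space N \<Longrightarrow> y \<in> space b \<Longrightarrow> z \<in> space b \<Longrightarrow>
      act (act s y) z = act (act s z) y"
begin

definition move :: "('s \<Rightarrow> real) \<Rightarrow> 's \<Rightarrow> real" where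
  "move h s = (\<integral>z. h (act s z) \<partial>b)"

definition lazy_move :: "real \<Rightarrow> ('s \<Rightarrow> real) \<Rightarrow> 's \<Rightarrow> real" where
  "lazy_move q h s = (1 - q) * h s + q * move h s"

definition increment :: "real \<Rightarrow> ('s \<Rightarrow> real) \<Rightarrow> 's \<Rightarrow> real" where
  "increment p h s = (\<integral>z. \<bar>h (act s z) - h s\<bar> powr p \<partial>b)"

lemma act_space: "s \<in> space N \<Longrightarrow> z \<in> space b \<Longrightarrow> act s z \<in> space N"
  using measurable_space[OF measurable_act, of "(s, z)"] by (simp add: space_pair_measure)

lemma measurable_act_from: "s \<in> space N \<Longrightarrow> act s \<in> b \<rightarrow>\<^sub>M N"
  using measurable_compose[OF measurable_Pair1' measurable_act, of s] by simp

lemma bounded_act: "bounded_measurable N h \<Longrightarrow> s \<in> space N \<Longrightarrow> bounded_measurable b (\<lambda>z. h (act s z))"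
  by (rule bounded_measurable_compose[OF _ measurable_act_from])

lemma integrable_act: "bounded_measurable N h \<Longrightarrow> s \<in> space N \<Longrightarrow> integrable b (\<lambda>z. h (act s z))"
  by (intro integrable_bounded_measurable bounded_act)

lemma bounded_measurable_integral_snd:
  assumes "bounded_measurable (N \<Otimes>\<^sub>M b) (\<lambda>(s, z). f s z)"
  shows "bounded_measurable N (\<lambda>s. \<integral>z. f s z \<partial>b)"
proof -
  obtain K where K: "\<And>x. x \<in> space (N \<Otimes>\<^sub>M b) \<Longrightarrow> \<bar>case x of (s, z) \<Rightarrow> f s z\<bar> \<le> K"
    using bounded_measurableE[OF assms] by blast
  show ?thesis
  proof (rule bounded_measurableI[of _ _ K])
    show "(\<lambda>s. \<integral>z. f s z \<partial>b) \<in> borel_measurable N"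
      by (intro borel_measurable_lebesgue_integral bounded_measurableD assms)
    fix s assume s: "s \<in> space N"
    have "bounded_measurable b (\<lambda>z. f s z)"
      using bounded_measurable_compose[OF assms measurable_Pair1'[OF s]] by simp
    then show "\<bar>\<integral>z. f s z \<partial>b\<bar> \<le> K"
      using K s by (intro bounded_integral) (auto simp: space_pair_measure)
  qed
qed

lemma bounded_act_pair:
  "bounded_measurable N h \<Longrightarrow> bounded_measurable (N \<Otimes>\<^sub>M b) (\<lambda>(s, z). h (act s z))"
  using bounded_measurable_compose[OF _ measurable_act, of h] by (simp add: case_prod_beta')

lemma bounded_move: "bounded_measurable N h \<Longrightarrow> bounded_measurable N (move h)"
  unfolding move_def by (intro bounded_measurable_integral_snd bounded_act_pair)

lemma bounded_lazy_move: "bounded_measurable N h \<Longrightarrow> bounded_measurable N (lazy_move q h)"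
  unfolding lazy_move_def
  by (intro bounded_measurable_add bounded_measurable_cmult bounded_move)

lemma bounded_increment_pair:
  assumes "bounded_measurable N h" "0 \<le> p"
  shows "bounded_measurable (N \<Otimes>\<^sub>M b) (\<lambda>(s, z). \<bar>h (act s z) - h s\<bar> powr p)"
proof -
  have "bounded_measurable (N \<Otimes>\<^sub>M b) (\<lambda>x. h (act (fst x) (snd x)))"
    using bounded_act_pair[OF assms(1)] by (simp add: case_prod_beta')
  moreover have "bounded_measurable (N \<Otimes>\<^sub>M b) (\<lambda>x. h (fst x))"
    by (rule bounded_measurable_compose[OF assms(1) measurable_fst])
  ultimately show ?thesis
    using assms(2) by (auto simp: case_prod_beta' intro!: bounded_measurable_abs_powr bounded_measurable_diff)
qed

lemma bounded_increment:
  "bounded_measurable N h \<Longrightarrow> 0 \<le> p \<Longrightarrow> bounded_measurable N (increment p h)"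
  unfolding increment_def by (intro bounded_measurable_integral_snd bounded_increment_pair)

lemma bounded_increment_at:
  "bounded_measurable N h \<Longrightarrow> 0 \<le> p \<Longrightarrow> s \<in> space N \<Longrightarrow>
    bounded_measurable b (\<lambda>z. \<bar>h (act s z) - h s\<bar> powr p)"
  by (intro bounded_measurable_abs_powr bounded_measurable_diff bounded_act bounded_measurable_const)

lemma increment_nonneg: "0 \<le> increment p h s"
  by (simp add: increment_def)

lemma bounded_lazy_move_pow:
  "bounded_measurable N h \<Longrightarrow> bounded_measurable N ((lazy_move q ^^ n) h)"
  by (induction n) (auto intro: bounded_lazy_move)

lemma bounded_move_pow:
  "bounded_measurable N h \<Longrightarrow> bounded_measurable N ((move ^^ n) h)"
  by (induction n) (auto intro: bounded_move)

lemma move_pow_Suc: "(move ^^ Suc k) h s = (\<integral>z. (move ^^ k) h (act s z) \<partial>b)"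
  by (simp add: move_def[of "(move ^^ k) h" s])

lemma move_pow_bound:
  assumes "bounded_measurable N h" and K: "\<And>s. s \<in> space N \<Longrightarrow> \<bar>h s\<bar> \<le> K" and s: "s \<in> space N"
  shows "\<bar>(move ^^ n) h s\<bar> \<le> K"
  using s
proof (induction n arbitrary: s)
  case (Suc n)
  then show ?case
    using bounded_integral[OF bounded_act[OF bounded_move_pow[OF assms(1), of n] Suc.prems], of K]
    by (simp add: move_pow_Suc act_space del: funpow.simps)
qed (use K in auto)

lemma lazy_move_mono:
  assumes "bounded_measurable N g" "bounded_measurable N h" and le: "\<And>s. s \<in> space N \<Longrightarrow> g s \<le> h s"
    and q: "0 \<le> q" "q \<le> 1" and s: "s \<in> space N"
  shows "lazy_move q g s \<le> lazy_move q h s"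
  unfolding lazy_move_def move_def
  using q s by (intro add_mono mult_left_mono integral_mono integrable_act le act_space assms) auto

lemma lazy_move_pow_mono:
  assumes "bounded_measurable N g" "bounded_measurable N h" and le: "\<And>s. s \<in> space N \<Longrightarrow> g s \<le> h s"
    and q: "0 \<le> q" "q \<le> 1" and s: "s \<in> space N"
  shows "(lazy_move q ^^ n) g s \<le> (lazy_move q ^^ n) h s"
  using s
  by (induction n arbitrary: s) (auto intro!: lazy_move_mono bounded_lazy_move_pow assms)

lemma move_linear:
  assumes "bounded_measurable N g" "bounded_measurable N h" "s \<in> space N"
  shows "move (\<lambda>s. d * g s + c * h s) s = d * move g s + c * move h s"
  using assms by (simp add: move_def integrable_act)

lemma lazy_move_linear:
  assumes "bounded_measurable N g" "bounded_measurable N h" "s \<in> space N"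
  shows "lazy_move q (\<lambda>s. g s + c * h s) s = lazy_move q g s + c * lazy_move q h s"
  using assms using move_linear[of g h s 1 c] by (simp add: lazy_move_def algebra_simps)

lemma move_cong: "(\<And>s. s \<in> space N \<Longrightarrow> g s = h s) \<Longrightarrow> s \<in> space N \<Longrightarrow> move g s = move h s"
  by (auto simp: move_def act_space intro!: Bochner_Integration.integral_cong)

lemma lazy_move_cong: "(\<And>s. s \<in> space N \<Longrightarrow> g s = h s) \<Longrightarrow> s \<in> space N \<Longrightarrow> lazy_move q g s = lazy_move q h s"
  using move_cong[of g h s] by (simp add: lazy_move_def)

lemma lazy_move_pow_linear:
  assumes "bounded_measurable N g" "bounded_measurable N h" "s \<in> space N"
  shows "(lazy_move q ^^ n) (\<lambda>s. g s + c * h s) s = (lazy_move q ^^ n) g s + c * (lazy_move q ^^ n) h s"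
  using assms(3)
proof (induction n arbitrary: s)
  case (Suc n)
  have "(lazy_move q ^^ Suc n) (\<lambda>s. g s + c * h s) s =
      lazy_move q (\<lambda>s. (lazy_move q ^^ n) g s + c * (lazy_move q ^^ n) h s) s"
    using Suc by (auto intro: lazy_move_cong)
  then show ?case
    using Suc.prems assms by (simp add: lazy_move_linear bounded_lazy_move_pow)
qed simp

text \<open>The expansion of \<open>|x|^p\<close> is used at \<open>a = g s\<close>, the value before the move. The linear terms are the
  same in the upper bound for \<open>|g|^p\<close> after the move and in the lower bound for
  \<open>|lazy_move q g s|^p\<close>, so they cancel. The remaining term vanishes when the move is not carried
  out, which produces the factor \<open>q\<close>.\<close>

lemma lazy_move_one_step:
  assumes g: "bounded_measurable N g" and p: "1 \<le> p" "p \<le> 2" and q: "0 \<le> q" and s: "s \<in> space N"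
  shows "lazy_move q (\<lambda>s. \<bar>g s\<bar> powr p) s \<le>
    \<bar>lazy_move q g s\<bar> powr p + 2 powr (2 - p) * q * increment p g s"
proof -
  define a where "a = g s"
  obtain v where v: "\<And>x. \<bar>a\<bar> powr p + v * (x - a) \<le> \<bar>x\<bar> powr p"
    "\<And>x. \<bar>x\<bar> powr p \<le> \<bar>a\<bar> powr p + v * (x - a) + 2 powr (2 - p) * \<bar>x - a\<bar> powr p"
    using abs_powr_expansion[OF p, of a] by metis
  have int [simp]: "integrable b (\<lambda>z. g (act s z))" "integrable b (\<lambda>z. \<bar>g (act s z)\<bar> powr p)"
    "integrable b (\<lambda>z. \<bar>g (act s z) - a\<bar> powr p)"
    using g s p integrable_bounded_measurable[OF bounded_increment_at[OF g _ s, of p]] unfolding a_def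
    by (auto intro!: integrable_bounded_measurable bounded_measurable_abs_powr bounded_act)
  have "move (\<lambda>s. \<bar>g s\<bar> powr p) s \<le>
      (\<integral>z. \<bar>a\<bar> powr p + v * (g (act s z) - a) + 2 powr (2 - p) * \<bar>g (act s z) - a\<bar> powr p \<partial>b)"
    unfolding move_def by (intro integral_mono v) auto
  also have "\<dots> = \<bar>a\<bar> powr p + v * (move g s - a) + 2 powr (2 - p) * increment p g s"
    unfolding move_def increment_def a_def[symmetric] by (simp add: prob_space)
  finally have "q * move (\<lambda>s. \<bar>g s\<bar> powr p) s \<le>
      q * (\<bar>a\<bar> powr p + v * (move g s - a) + 2 powr (2 - p) * increment p g s)"
    using q by (intro mult_left_mono)
  moreover have "\<bar>a\<bar> powr p + v * (lazy_move q g s - a) \<le> \<bar>lazy_move q g s\<bar> powr p"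
    by (rule v)
  moreover have "lazy_move q g s - a = q * (move g s - a)"
    by (simp add: lazy_move_def a_def algebra_simps)
  ultimately show ?thesis
    by (simp add: lazy_move_def[of q "\<lambda>s. \<bar>g s\<bar> powr p"] a_def[symmetric] algebra_simps)
qed

text \<open>The increments of \<open>lazy_move q g\<close> are averages of increments of \<open>g\<close> at moved states: this is
  where commutativity enters, as it allows the extra point \<open>z\<close> to be added after the random point
  \<open>y\<close> instead of before it. Jensen's inequality and Fubini's theorem finish the argument.\<close>

lemma increment_lazy_move:
  assumes g: "bounded_measurable N g" and p: "1 \<le> p" "p \<le> 2" and q: "0 \<le> q" "q \<le> 1"
    and s: "s \<in> space N"
  shows "increment p (lazy_move q g) s \<le> lazy_move q (increment p g) s"
proof -
  interpret bb: pair_prob_space b b ..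
  define D where "D z y = \<bar>g (act (act s y) z) - g (act s y)\<bar> powr p" for z y
  have p0: "0 \<le> p" using p by simp
  have meas_sy: "(\<lambda>x. act s (snd x)) \<in> b \<Otimes>\<^sub>M b \<rightarrow>\<^sub>M N"
    by (rule measurable_compose[OF measurable_snd measurable_act_from[OF s]])
  have meas_syz: "(\<lambda>x. act (act s (snd x)) (fst x)) \<in> b \<Otimes>\<^sub>M b \<rightarrow>\<^sub>M N"
    using measurable_compose[OF measurable_Pair[OF meas_sy measurable_fst] measurable_act] by simp
  have D: "bounded_measurable (b \<Otimes>\<^sub>M b) (\<lambda>x. D (fst x) (snd x))"
    unfolding D_def
    by (intro bounded_measurable_abs_powr bounded_measurable_diff p0
      bounded_measurable_compose[OF g meas_sy] bounded_measurable_compose[OF g meas_syz])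
  then have D_int: "integrable (b \<Otimes>\<^sub>M b) (case_prod D)"
    using bb.integrable_bounded_measurable[OF D] by (simp add: case_prod_beta')
  then have intD: "integrable b (\<lambda>z. \<integral>y. D z y \<partial>b)"
    by (rule bb.integrable_fst)
  have intI: "integrable b (\<lambda>z. \<bar>g (act s z) - g s\<bar> powr p)"
    by (intro integrable_bounded_measurable bounded_increment_at g p0 s)
  have point: "\<bar>lazy_move q g (act s z) - lazy_move q g s\<bar> powr p \<le>
      (1 - q) * \<bar>g (act s z) - g s\<bar> powr p + q * (\<integral>y. D z y \<partial>b)" if z: "z \<in> space b" for z
  proof -
    have X: "bounded_measurable b (\<lambda>y. g (act (act s z) y) - g (act s y))"
      by (intro bounded_measurable_diff bounded_act g act_space s z)
    have "lazy_move q g (act s z) - lazy_move q g s =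
        (1 - q) * (g (act s z) - g s) + q * (\<integral>y. g (act (act s z) y) - g (act s y) \<partial>b)"
      using s z by (simp add: lazy_move_def move_def g integrable_act act_space algebra_simps)
    also have "\<bar>\<dots>\<bar> powr p \<le> (1 - q) * \<bar>g (act s z) - g s\<bar> powr p +
        q * (\<integral>y. \<bar>g (act (act s z) y) - g (act s y)\<bar> powr p \<partial>b)"
      by (rule jensen_abs_powr[OF X p q])
    also have "(\<integral>y. \<bar>g (act (act s z) y) - g (act s y)\<bar> powr p \<partial>b) = (\<integral>y. D z y \<partial>b)"
      unfolding D_def using s z
      by (intro Bochner_Integration.integral_cong refl) (simp add: act_commute[of s z])
    finally show ?thesis .
  qed
  have "increment p (lazy_move q g) s \<le>
      (\<integral>z. (1 - q) * \<bar>g (act s z) - g s\<bar> powr p + q * (\<integral>y. D z y \<partial>b) \<partial>b)"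
    unfolding increment_def
    using intD intI
    by (intro integral_mono point integrable_bounded_measurable[OF bounded_increment_at]
      bounded_lazy_move g p0 s) auto
  also have "\<dots> = (1 - q) * increment p g s + q * (\<integral>z. (\<integral>y. D z y \<partial>b) \<partial>b)"
    using intD intI by (simp add: increment_def)
  also have "(\<integral>z. (\<integral>y. D z y \<partial>b) \<partial>b) = (\<integral>y. (\<integral>z. D z y \<partial>b) \<partial>b)"
    by (rule bb.Fubini_integral[OF D_int, symmetric])
  also have "\<dots> = move (increment p g) s"
    by (simp add: move_def increment_def D_def)
  finally show ?thesis
    unfolding lazy_move_def[of q "increment p g"] .
qed

text \<open>One lazy move costs the mean increment before the move, but the induction needs a bound in terms of
  the state after all moves. Since a lazy move leaves the state unchanged with probability \<open>1 - q\<close>,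
  the increment before the move is at most \<open>1 / (1 - q)\<close> times its expectation after the move. The
  total factor \<open>n q / (1 - q)\<close> tends to \<open>l\<close> for \<open>q = l/n\<close>.\<close>

lemma lazy_move_iterate:
  assumes g: "bounded_measurable N g" and p: "1 \<le> p" "p \<le> 2" and q: "0 \<le> q" "q < 1"
    and s: "s \<in> space N"
  shows "(lazy_move q ^^ n) (\<lambda>s. \<bar>g s\<bar> powr p) s \<le> \<bar>(lazy_move q ^^ n) g s\<bar> powr p +
    2 powr (2 - p) * (q / (1 - q)) * real n * (lazy_move q ^^ n) (increment p g) s"
  using g s
proof (induction n arbitrary: g s)
  case (Suc n)
  have p0: "0 \<le> p" using p by simp
  define c where "c = 2 powr (2 - p) * (q / (1 - q))"
  have c: "0 \<le> c" using q by (simp add: c_def)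
  note bdd = bounded_lazy_move bounded_increment bounded_measurable_abs_powr bounded_lazy_move_pow
    Suc.prems(1) p0
  have "lazy_move q (\<lambda>s. \<bar>g s\<bar> powr p) t \<le>
      \<bar>lazy_move q g t\<bar> powr p + c * lazy_move q (increment p g) t" if t: "t \<in> space N" for t
  proof -
    have "0 \<le> move (increment p g) t"
      by (simp add: move_def increment_nonneg)
    then have "(1 - q) * increment p g t \<le> lazy_move q (increment p g) t"
      using q by (simp add: lazy_move_def)
    then have "c * ((1 - q) * increment p g t) \<le> c * lazy_move q (increment p g) t"
      using c by (rule mult_left_mono)
    moreover have "c * ((1 - q) * increment p g t) = 2 powr (2 - p) * q * increment p g t"
      using q by (simp add: c_def)
    ultimately show ?thesis
      using lazy_move_one_step[OF Suc.prems(1) p q(1) t] by linarith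
  qed
  then have "(lazy_move q ^^ n) (lazy_move q (\<lambda>s. \<bar>g s\<bar> powr p)) s \<le>
      (lazy_move q ^^ n) (\<lambda>t. \<bar>lazy_move q g t\<bar> powr p + c * lazy_move q (increment p g) t) s"
    using q Suc.prems(2)
    by (intro lazy_move_pow_mono bounded_measurable_add bounded_measurable_cmult bdd) auto
  also have "\<dots> = (lazy_move q ^^ n) (\<lambda>t. \<bar>lazy_move q g t\<bar> powr p) s +
      c * (lazy_move q ^^ n) (lazy_move q (increment p g)) s"
    by (intro lazy_move_pow_linear bdd Suc.prems)
  also have "(lazy_move q ^^ n) (\<lambda>t. \<bar>lazy_move q g t\<bar> powr p) s \<le>
      \<bar>(lazy_move q ^^ n) (lazy_move q g) s\<bar> powr p +
      c * real n * (lazy_move q ^^ n) (increment p (lazy_move q g)) s"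
    unfolding c_def by (intro Suc.IH bdd Suc.prems)
  also have "(lazy_move q ^^ n) (increment p (lazy_move q g)) s \<le>
      (lazy_move q ^^ n) (lazy_move q (increment p g)) s"
    using q Suc.prems p by (intro lazy_move_pow_mono increment_lazy_move bdd) auto
  finally have "(lazy_move q ^^ Suc n) (\<lambda>s. \<bar>g s\<bar> powr p) s \<le> \<bar>(lazy_move q ^^ Suc n) g s\<bar> powr p +
      c * real n * (lazy_move q ^^ Suc n) (increment p g) s + c * (lazy_move q ^^ Suc n) (increment p g) s"
    using c by (simp add: funpow_Suc_right mult_left_mono del: funpow.simps)
  then show ?case
    unfolding c_def[symmetric] by (simp add: algebra_simps del: funpow.simps)
qed simp

lemma move_pow_lazy_move:
  assumes "bounded_measurable N h" "s \<in> space N"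
  shows "(move ^^ k) (lazy_move q h) s = (1 - q) * (move ^^ k) h s + q * (move ^^ Suc k) h s"
  using assms(2)
proof (induction k arbitrary: s)
  case 0
  then show ?case by (simp add: lazy_move_def)
next
  case (Suc k)
  have "(move ^^ Suc k) (lazy_move q h) s =
      move (\<lambda>s. (1 - q) * (move ^^ k) h s + q * (move ^^ Suc k) h s) s"
    using move_cong[OF Suc.IH Suc.prems] by simp
  also have "\<dots> = (1 - q) * move ((move ^^ k) h) s + q * move ((move ^^ Suc k) h) s"
    by (rule move_linear[OF bounded_move_pow bounded_move_pow]) (use assms(1) Suc.prems in auto)
  finally show ?case by simp
qed

lemma lazy_move_pow_eq_binomial:
  assumes "bounded_measurable N h" "s \<in> space N"
  shows "(lazy_move q ^^ n) h s =
    (\<Sum>k\<le>n. real (n choose k) * q ^ k * (1 - q) ^ (n - k) * (move ^^ k) h s)"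
  using assms
proof (induction n arbitrary: h)
  case (Suc n)
  have "(lazy_move q ^^ Suc n) h s = (lazy_move q ^^ n) (lazy_move q h) s"
    by (simp add: funpow_Suc_right del: funpow.simps)
  also have "\<dots> = (\<Sum>k\<le>n. real (n choose k) * q ^ k * (1 - q) ^ (n - k) * (move ^^ k) (lazy_move q h) s)"
    by (intro Suc bounded_lazy_move)
  also have "\<dots> = (\<Sum>k\<le>n. real (n choose k) * q ^ k * (1 - q) ^ (n - k) *
      ((1 - q) * (move ^^ k) h s + q * (move ^^ Suc k) h s))"
    using Suc.prems by (simp only: move_pow_lazy_move)
  finally show ?case
    by (simp only: binomial_sum_Suc)
qed simp

primrec moved :: "'s \<Rightarrow> nat \<Rightarrow> 's measure" where
  "moved s 0 = return N s"
| "moved s (Suc k) = distr (moved s k \<Otimes>\<^sub>M b) N (\<lambda>(s, z). act s z)"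

lemma sets_moved [simp, measurable_cong]: "sets (moved s k) = sets N"
  by (cases k) auto

lemma measurable_act_moved: "(\<lambda>(s, z). act s z) \<in> moved s' k \<Otimes>\<^sub>M b \<rightarrow>\<^sub>M N"
  using measurable_act by (simp cong: measurable_cong_sets sets_pair_measure_cong)

lemma prob_space_moved: "s \<in> space N \<Longrightarrow> prob_space (moved s k)"
proof (induction k)
  case (Suc k)
  then interpret pair_prob_space "moved s k" b
    by (intro pair_prob_space.intro pair_sigma_finite.intro prob_space_imp_sigma_finite)
       (auto intro: prob_space_axioms)
  show ?case
    by (simp add: prob_space_distr measurable_act_moved)
qed (simp add: prob_space_return)

lemma integral_moved:
  assumes "bounded_measurable N h" "s \<in> space N"
  shows "(\<integral>t. h t \<partial>moved s k) = (move ^^ k) h s"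
  using assms
proof (induction k arbitrary: h)
  case 0
  then show ?case by (simp add: integral_return bounded_measurableD)
next
  case (Suc k)
  interpret mk: prob_space "moved s k"
    by (rule prob_space_moved[OF Suc.prems(2)])
  interpret pair_prob_space "moved s k" b ..
  have "bounded_measurable (moved s k \<Otimes>\<^sub>M b) (\<lambda>(s, z). h (act s z))"
    using bounded_measurable_compose[OF Suc.prems(1) measurable_act_moved] by (simp add: case_prod_beta')
  then have "integrable (moved s k \<Otimes>\<^sub>M b) (\<lambda>(s, z). h (act s z))"
    by (rule integrable_bounded_measurable)
  then have "(\<integral>t. move h t \<partial>moved s k) = (\<integral>(s, z). h (act s z) \<partial>(moved s k \<Otimes>\<^sub>M b))"
    unfolding move_def by (rule integral_fst)
  also have "\<dots> = (\<integral>t. h t \<partial>moved s (Suc k))"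
    using integral_distr[OF measurable_act_moved bounded_measurableD[OF Suc.prems(1)], of s k]
    by (simp add: case_prod_beta')
  finally have "(\<integral>t. h t \<partial>moved s (Suc k)) = (\<integral>t. move h t \<partial>moved s k)" ..
  also have "\<dots> = (move ^^ k) (move h) s"
    by (intro Suc bounded_move)
  finally show ?case
    by (simp add: funpow_Suc_right del: funpow.simps)
qed

definition poisson_moved :: "real \<Rightarrow> 's \<Rightarrow> 's measure" where
  "poisson_moved l s = measure_pmf (poisson_pmf l) \<bind> moved s"

lemma measurable_moved:
  "s \<in> space N \<Longrightarrow> moved s \<in> measure_pmf (poisson_pmf l) \<rightarrow>\<^sub>M subprob_algebra N"
  by (simp add: space_subprob_algebra prob_space_imp_subprob_space prob_space_moved)

lemma sets_poisson_moved [simp, measurable_cong]: "sets (poisson_moved l s) = sets N"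
  unfolding poisson_moved_def by (rule sets_bind) auto

lemma prob_space_poisson_moved: "s \<in> space N \<Longrightarrow> prob_space (poisson_moved l s)"
  unfolding poisson_moved_def
  by (rule measure_pmf.prob_space_bind[OF _ measurable_moved]) (auto simp: prob_space_moved)

lemma integral_poisson_moved:
  assumes h: "bounded_measurable N h" and s: "s \<in> space N" and l: "0 < l"
  shows "(\<integral>t. h t \<partial>poisson_moved l s) = (\<Sum>k. l ^ k / fact k * exp (- l) * (move ^^ k) h s)"
proof -
  obtain K where K: "\<And>s. s \<in> space N \<Longrightarrow> \<bar>h s\<bar> \<le> K"
    using bounded_measurableE[OF h] by blast
  have "(\<integral>t. h t \<partial>poisson_moved l s) = (\<integral>k. (\<integral>t. h t \<partial>moved s k) \<partial>measure_pmf (poisson_pmf l))"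
    unfolding poisson_moved_def
    by (rule integral_bind[OF bounded_measurableD[OF h] K measurable_moved[OF s], where B' = 1])
      (auto simp: prob_space.emeasure_space_1 prob_space_moved s measure_pmf.finite_measure)
  also have "\<dots> = (\<integral>k. (move ^^ k) h s \<partial>measure_pmf (poisson_pmf l))"
    by (simp add: integral_moved h s)
  also have "\<dots> = (\<Sum>k. l ^ k / fact k * exp (- l) * (move ^^ k) h s)"
    by (rule integral_poisson_pmf[OF l move_pow_bound[OF h K s]])
  finally show ?thesis .
qed

text \<open>After \<open>n\<close> lazy moves the number of actual moves is binomial with parameters \<open>n\<close> and \<open>l/n\<close>.\<close>

lemma lazy_move_pow_tendsto:
  assumes h: "bounded_measurable N h" and s: "s \<in> space N" and l: "0 < l"
  shows "(\<lambda>n. (lazy_move (l / real n) ^^ n) h s) \<longlonglongrightarrow> (\<integral>t. h t \<partial>poisson_moved l s)"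
proof -
  obtain K where K: "\<And>s. s \<in> space N \<Longrightarrow> \<bar>h s\<bar> \<le> K"
    using bounded_measurableE[OF h] by blast
  show ?thesis
    unfolding integral_poisson_moved[OF assms] lazy_move_pow_eq_binomial[OF h s]
    by (rule binomial_sum_tendsto_poisson[OF _ move_pow_bound[OF h K s]]) (use l in auto)
qed

lemma poisson_moved_powr_le:
  assumes g: "bounded_measurable N g" and p: "1 \<le> p" "p \<le> 2" and l: "0 < l" and s: "s \<in> space N"
  shows "(\<integral>t. \<bar>g t\<bar> powr p \<partial>poisson_moved l s) \<le> \<bar>\<integral>t. g t \<partial>poisson_moved l s\<bar> powr p +
    2 powr (2 - p) * l * (\<integral>t. increment p g t \<partial>poisson_moved l s)"
proof (rule tendsto_le[OF sequentially_bot])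
  have p0: "0 \<le> p" "0 < p" using p by auto
  show "(\<lambda>n. (lazy_move (l / real n) ^^ n) (\<lambda>s. \<bar>g s\<bar> powr p) s) \<longlonglongrightarrow>
      (\<integral>t. \<bar>g t\<bar> powr p \<partial>poisson_moved l s)"
    by (intro lazy_move_pow_tendsto bounded_measurable_abs_powr g s l p0)
  have "(\<lambda>n. l / (1 - l / real n)) \<longlonglongrightarrow> l / (1 - 0)"
    by (intro tendsto_divide tendsto_diff tendsto_const lim_const_over_n) simp
  then have lim: "(\<lambda>n. l / (1 - l / real n)) \<longlonglongrightarrow> l" by simp
  have "(\<lambda>n. \<bar>(lazy_move (l / real n) ^^ n) g s\<bar> powr p) \<longlonglongrightarrow> \<bar>\<integral>t. g t \<partial>poisson_moved l s\<bar> powr p"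
    by (rule tendsto_powr2[OF tendsto_rabs[OF lazy_move_pow_tendsto[OF g s l]] tendsto_const])
      (use p0 in auto)
  then show "(\<lambda>n. \<bar>(lazy_move (l / real n) ^^ n) g s\<bar> powr p +
      2 powr (2 - p) * (l / (1 - l / real n)) * (lazy_move (l / real n) ^^ n) (increment p g) s) \<longlonglongrightarrow>
      \<bar>\<integral>t. g t \<partial>poisson_moved l s\<bar> powr p +
      2 powr (2 - p) * l * (\<integral>t. increment p g t \<partial>poisson_moved l s)"
    by (intro tendsto_add tendsto_mult tendsto_const lim lazy_move_pow_tendsto bounded_increment g s l p0)
  have "eventually (\<lambda>n. n > nat \<lceil>l\<rceil>) sequentially"
    by (rule eventually_gt_at_top)
  then show "eventually (\<lambda>n. (lazy_move (l / real n) ^^ n) (\<lambda>s. \<bar>g s\<bar> powr p) s \<le>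
      \<bar>(lazy_move (l / real n) ^^ n) g s\<bar> powr p +
      2 powr (2 - p) * (l / (1 - l / real n)) * (lazy_move (l / real n) ^^ n) (increment p g) s) sequentially"
  proof eventually_elim
    case (elim n)
    then have n: "l < real n" "0 < real n" by linarith+
    have "(l / real n) / (1 - l / real n) * real n = l / (1 - l / real n)"
      using n by simp
    then show ?case
      using lazy_move_iterate[OF g p, of "l / real n" s n] n l s by (simp add: mult.assoc)
  qed
qed

text \<open>For fixed \<open>t'\<close>, \<open>poisson_moved_powr_le\<close> for \<open>g - g t'\<close> replaces \<open>g t\<close> by its mean at the cost
  \<open>2^(2-p) l E(increment)\<close>, because constants do not change increments. Integrating over \<open>t'\<close> leaves
  \<open>E|g - E g|^p\<close>, to which the same lemma applies, at the same cost.\<close>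

lemma poisson_moved_difference_le:
  assumes g: "bounded_measurable N g" and p: "1 \<le> p" "p \<le> 2" and l: "0 < l" and s: "s \<in> space N"
  shows "(\<integral>t'. (\<integral>t. \<bar>g t - g t'\<bar> powr p \<partial>poisson_moved l s) \<partial>poisson_moved l s) \<le>
    2 powr (3 - p) * l * (\<integral>t. increment p g t \<partial>poisson_moved l s)"
proof -
  interpret P: prob_space "poisson_moved l s"
    by (rule prob_space_poisson_moved[OF s])
  have p0: "0 \<le> p" using p by simp
  let ?R = "2 powr (2 - p) * l * (\<integral>t. increment p g t \<partial>poisson_moved l s)"
  have bdd [simp]: "bounded_measurable (poisson_moved l s) h \<longleftrightarrow> bounded_measurable N h" for h
    by (simp add: bounded_measurable_def sets_eq_imp_space_eq[OF sets_poisson_moved] cong: measurable_cong_sets)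
  have step: "(\<integral>t. \<bar>g t - c\<bar> powr p \<partial>poisson_moved l s) \<le> \<bar>(\<integral>t. g t \<partial>poisson_moved l s) - c\<bar> powr p + ?R"
    for c
  proof -
    have "integrable (poisson_moved l s) g"
      using g by (intro P.integrable_bounded_measurable) simp
    moreover have "increment p (\<lambda>t. g t - c) = increment p g"
      by (simp add: increment_def fun_eq_iff)
    ultimately show ?thesis
      using poisson_moved_powr_le[OF bounded_measurable_diff[OF g bounded_measurable_const] p l s, of c]
      by (simp add: P.prob_space)
  qed
  let ?m = "\<integral>t. g t \<partial>poisson_moved l s"
  have int_m: "integrable (poisson_moved l s) (\<lambda>t. \<bar>?m - g t\<bar> powr p)"
    by (intro P.integrable_bounded_measurable)
      (simp add: bounded_measurable_abs_powr bounded_measurable_diff g p0)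
  have "(\<integral>t'. (\<integral>t. \<bar>g t - g t'\<bar> powr p \<partial>poisson_moved l s) \<partial>poisson_moved l s) \<le>
      (\<integral>t'. \<bar>?m - g t'\<bar> powr p + ?R \<partial>poisson_moved l s)"
  proof (rule integral_mono')
    show "integrable (poisson_moved l s) (\<lambda>t'. \<bar>?m - g t'\<bar> powr p + ?R)"
      using int_m by simp
    show "0 \<le> \<bar>?m - g t'\<bar> powr p + ?R" for t'
      using l by (intro add_nonneg_nonneg mult_nonneg_nonneg) (auto simp: increment_nonneg)
  qed (rule step)
  also have "\<dots> = (\<integral>t. \<bar>g t - ?m\<bar> powr p \<partial>poisson_moved l s) + ?R"
    using int_m by (simp add: P.prob_space abs_minus_commute)
  also have "\<dots> \<le> 2 * ?R"
    using step[of ?m] p by (simp add: mult_ac)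
  also have "\<dots> = 2 powr (3 - p) * l * (\<integral>t. increment p g t \<partial>poisson_moved l s)"
    using powr_add[of 2 1 "2 - p"] by simp
  finally show ?thesis .
qed

end

lemma (in commuting_moves) poisson_moved_difference_nn_le:
  assumes g: "bounded_measurable N g" and p: "1 \<le> p" "p \<le> 2" and l: "0 < l" and s: "s \<in> space N"
  shows "(\<integral>\<^sup>+t'. (\<integral>\<^sup>+t. ennreal (\<bar>g t - g t'\<bar> powr p) \<partial>poisson_moved l s) \<partial>poisson_moved l s) \<le>
    ennreal (2 powr (3 - p)) * (ennreal l *
      (\<integral>\<^sup>+t. (\<integral>\<^sup>+z. ennreal (\<bar>g (act t z) - g t\<bar> powr p) \<partial>b) \<partial>poisson_moved l s))"
proof -
  let ?P = "poisson_moved l s"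
  interpret P: prob_space ?P by (rule prob_space_poisson_moved[OF s])
  interpret PP: pair_prob_space ?P ?P ..
  have p0: "0 \<le> p" using p by simp
  have spP: "space ?P = space N" by (rule sets_eq_imp_space_eq) simp
  have gP: "bounded_measurable ?P g"
    using g by (simp add: bounded_measurable_def spP cong: measurable_cong_sets)
  have D: "bounded_measurable (?P \<Otimes>\<^sub>M ?P) (\<lambda>x. \<bar>g (snd x) - g (fst x)\<bar> powr p)"
    by (intro bounded_measurable_abs_powr bounded_measurable_diff bounded_measurable_compose[OF gP] p0) simp_all
  have Dint: "integrable (?P \<Otimes>\<^sub>M ?P) (\<lambda>(t', t). \<bar>g t - g t'\<bar> powr p)"
    using PP.integrable_bounded_measurable[OF D] by (simp add: case_prod_beta')
  have "(\<integral>\<^sup>+t'. (\<integral>\<^sup>+t. ennreal (\<bar>g t - g t'\<bar> powr p) \<partial>?P) \<partial>?P) =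
      (\<integral>\<^sup>+t'. ennreal (\<integral>t. \<bar>g t - g t'\<bar> powr p \<partial>?P) \<partial>?P)"
    by (intro nn_integral_cong nn_integral_eq_integral P.integrable_bounded_measurable
      bounded_measurable_abs_powr bounded_measurable_diff gP bounded_measurable_const p0) auto
  also have "\<dots> = ennreal (\<integral>t'. (\<integral>t. \<bar>g t - g t'\<bar> powr p \<partial>?P) \<partial>?P)"
    by (intro nn_integral_eq_integral PP.integrable_fst Dint) (auto intro!: integral_nonneg)
  also have "\<dots> \<le> ennreal (2 powr (3 - p) * l * (\<integral>t. increment p g t \<partial>?P))"
    by (intro ennreal_leI poisson_moved_difference_le assms)
  also have "\<dots> = ennreal (2 powr (3 - p)) * (ennreal l * ennreal (\<integral>t. increment p g t \<partial>?P))"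
    using l by (simp add: ennreal_mult'' mult.assoc integral_nonneg increment_nonneg ennreal_mult)
  also have "ennreal (\<integral>t. increment p g t \<partial>?P) = (\<integral>\<^sup>+t. ennreal (increment p g t) \<partial>?P)"
  proof (rule nn_integral_eq_integral[symmetric])
    have "bounded_measurable ?P (increment p g)"
      using bounded_increment[OF g p0] by (simp add: bounded_measurable_def spP cong: measurable_cong_sets)
    then show "integrable ?P (increment p g)" by (rule P.integrable_bounded_measurable)
  qed (simp add: increment_nonneg)
  also have "\<dots> = (\<integral>\<^sup>+t. (\<integral>\<^sup>+z. ennreal (\<bar>g (act t z) - g t\<bar> powr p) \<partial>b) \<partial>?P)"
    unfolding increment_def
    by (intro nn_integral_cong nn_integral_eq_integral[symmetric] integrable_bounded_measurable
      bounded_increment_at g p0) (auto simp: spP)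
  finally show ?thesis .
qed

section \<open>Adding a point and gluing two configurations\<close>

lemma space_N_sigmaI:
  assumes "sets \<nu> = sets Z" "sigma_finite_measure \<nu>"
    "\<And>B. B \<in> sets Z \<Longrightarrow> emeasure \<nu> B \<in> insert \<infinity> (range of_nat)"
  shows "\<nu> \<in> space (N_sigma Z)"
  using assms by (auto simp: space_N_sigma)

lemma space_N_sigmaD:
  assumes "\<nu> \<in> space (N_sigma Z)"
  shows "sets \<nu> = sets Z" "space \<nu> = space Z" "sigma_finite_measure \<nu>"
    "\<And>B. B \<in> sets Z \<Longrightarrow> emeasure \<nu> B \<in> insert \<infinity> (range of_nat)"
  using assms sets_eq_imp_space_eq[of \<nu> Z] by (auto simp: space_N_sigma)

text \<open>The \<open>\<sigma>\<close>-field of \<open>N_sigma Z\<close> is initial for the evaluations, so these decide measurability.\<close>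

lemma measurable_into_N_sigma:
  assumes "\<And>x. x \<in> space X \<Longrightarrow> h x \<in> space (N_sigma Z)"
    and "\<And>A. A \<in> sets Z \<Longrightarrow> (\<lambda>x. emeasure (h x) A) \<in> borel_measurable X"
  shows "h \<in> X \<rightarrow>\<^sub>M N_sigma Z"
  unfolding N_sigma_def
proof (intro measurable_SUP2 measurable_vimage_algebra2)
  show "h \<in> space X \<rightarrow> {\<nu>. sets \<nu> = sets Z \<and> sigma_finite_measure \<nu> \<and>
      (\<forall>B\<in>sets Z. emeasure \<nu> B \<in> insert \<infinity> (range of_nat))}"
    using assms(1) unfolding space_N_sigma by blast
qed (use assms(2) in auto)

lemma measurable_add_dirac:
  assumes b: "sets b = sets Z"
  shows "(\<lambda>(\<nu>, z). add_dirac \<nu> z) \<in> N_sigma Z \<Otimes>\<^sub>M b \<rightarrow>\<^sub>M N_sigma Z"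
proof (rule measurable_into_N_sigma)
  show "(case x of (\<nu>, z) \<Rightarrow> add_dirac \<nu> z) \<in> space (N_sigma Z)" if "x \<in> space (N_sigma Z \<Otimes>\<^sub>M b)" for x
    using that by (auto simp: space_pair_measure add_dirac_in_N_sigma)
  fix A assume A [measurable]: "A \<in> sets Z"
  have [measurable]: "A \<in> sets b" using b by simp
  note measurable_emeasure_N_sigma[OF A, measurable]
  have "(\<lambda>x. emeasure (fst x) A + indicator A (snd x)) \<in> borel_measurable (N_sigma Z \<Otimes>\<^sub>M b)"
    by measurable
  then show "(\<lambda>x. emeasure (case x of (\<nu>, z) \<Rightarrow> add_dirac \<nu> z) A) \<in> borel_measurable (N_sigma Z \<Otimes>\<^sub>M b)"
    by (rule measurable_cong[THEN iffD1, rotated])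
      (use A in \<open>auto simp: space_pair_measure emeasure_add_dirac space_N_sigmaD\<close>)
qed

lemma add_dirac_commute: "add_dirac (add_dirac \<nu> y) z = add_dirac (add_dirac \<nu> z) y"
  by (rule measure_eqI) (auto simp: emeasure_add_dirac ac_simps)

text \<open>The configuration that agrees with \<open>\<xi>\<close> inside \<open>B\<close> and with \<open>\<zeta>\<close> outside. Restricting both
  arguments makes identities such as \<open>glue_glue\<close> exact; for a plain sum of configurations that are
  carried by \<open>B\<close> and by its complement they would hold almost surely only.\<close>

definition glue :: "'z set \<Rightarrow> 'z measure \<Rightarrow> 'z measure \<Rightarrow> 'z measure" where
  "glue B \<xi> \<zeta> = measure_of (space \<zeta>) (sets \<zeta>) (\<lambda>A. emeasure \<xi> (A \<inter> B) + emeasure \<zeta> (A - B))"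

lemma sets_glue [simp]: "sets (glue B \<xi> \<zeta>) = sets \<zeta>"
  and space_glue [simp]: "space (glue B \<xi> \<zeta>) = space \<zeta>"
  by (simp_all add: glue_def)

lemma emeasure_glue:
  assumes "sets \<xi> = sets \<zeta>" "B \<in> sets \<zeta>" "A \<in> sets \<zeta>"
  shows "emeasure (glue B \<xi> \<zeta>) A = emeasure \<xi> (A \<inter> B) + emeasure \<zeta> (A - B)"
  unfolding glue_def
proof (rule emeasure_measure_of_sigma)
  show "sigma_algebra (space \<zeta>) (sets \<zeta>)" ..
  show "positive (sets \<zeta>) (\<lambda>A. emeasure \<xi> (A \<inter> B) + emeasure \<zeta> (A - B))"
    by (simp add: positive_def)
  show "countably_additive (sets \<zeta>) (\<lambda>A. emeasure \<xi> (A \<inter> B) + emeasure \<zeta> (A - B))"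
  proof (rule countably_additiveI)
    fix A :: "nat \<Rightarrow> 'a set"
    assume A: "range A \<subseteq> sets \<zeta>" "disjoint_family A" "\<Union> (range A) \<in> sets \<zeta>"
    have "(\<Sum>i. emeasure \<xi> (A i \<inter> B) + emeasure \<zeta> (A i - B)) =
        (\<Sum>i. emeasure \<xi> (A i \<inter> B)) + (\<Sum>i. emeasure \<zeta> (A i - B))"
      by (intro suminf_add [symmetric]) auto
    also have "(\<Sum>i. emeasure \<xi> (A i \<inter> B)) = emeasure \<xi> (\<Union>i. A i \<inter> B)"
      using A assms by (intro suminf_emeasure) (auto simp: disjoint_family_on_def)
    also have "(\<Sum>i. emeasure \<zeta> (A i - B)) = emeasure \<zeta> (\<Union>i. A i - B)"
      using A assms by (intro suminf_emeasure) (auto simp: disjoint_family_on_def)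
    finally show "(\<Sum>i. emeasure \<xi> (A i \<inter> B) + emeasure \<zeta> (A i - B)) =
        emeasure \<xi> (\<Union> (range A) \<inter> B) + emeasure \<zeta> (\<Union> (range A) - B)"
      by (simp only: UN_extend_simps)
  qed
qed (use assms in simp)

lemma ennreal_nat_or_top_add:
  fixes a b :: ennreal
  assumes "a \<in> insert \<infinity> (range of_nat)" "b \<in> insert \<infinity> (range of_nat)"
  shows "a + b \<in> insert \<infinity> (range of_nat)"
proof -
  have "of_nat m + of_nat n \<in> range (of_nat :: nat \<Rightarrow> ennreal)" for m n
    by (metis of_nat_add rangeI)
  with assms show ?thesis by auto
qed

lemma glue_in_N_sigma:
  assumes "\<xi> \<in> space (N_sigma Z)" "\<zeta> \<in> space (N_sigma Z)" and B: "B \<in> sets Z"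
  shows "glue B \<xi> \<zeta> \<in> space (N_sigma Z)"
proof (rule space_N_sigmaI)
  note x = space_N_sigmaD[OF assms(1)] and z = space_N_sigmaD[OF assms(2)]
  have eg: "emeasure (glue B \<xi> \<zeta>) A = emeasure \<xi> (A \<inter> B) + emeasure \<zeta> (A - B)" if "A \<in> sets Z" for A
    using that x z B by (intro emeasure_glue) auto
  show "sets (glue B \<xi> \<zeta>) = sets Z" by (simp add: z)
  show "emeasure (glue B \<xi> \<zeta>) A \<in> insert \<infinity> (range of_nat)" if "A \<in> sets Z" for A
    unfolding eg[OF that] using that B by (intro ennreal_nat_or_top_add x z) auto
  obtain C where C: "countable C" "C \<subseteq> sets \<xi>" "\<Union>C = space \<xi>" "\<forall>a\<in>C. emeasure \<xi> a \<noteq> \<infinity>"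
    using sigma_finite_measure.sigma_finite_countable[OF x(3)] by auto
  obtain D where D: "countable D" "D \<subseteq> sets \<zeta>" "\<Union>D = space \<zeta>" "\<forall>a\<in>D. emeasure \<zeta> a \<noteq> \<infinity>"
    using sigma_finite_measure.sigma_finite_countable[OF z(3)] by auto
  let ?E = "(\<lambda>c. c \<inter> B) ` C \<union> (\<lambda>d. d - B) ` D"
  show "sigma_finite_measure (glue B \<xi> \<zeta>)"
  proof (unfold_locales, intro exI conjI ballI)
    show "countable ?E" using C D by simp
    show "?E \<subseteq> sets (glue B \<xi> \<zeta>)" using C D x z B by auto
    show "\<Union>?E = space (glue B \<xi> \<zeta>)"
      using C(3) D(3) x(2) z(2) sets.sets_into_space[OF B] by auto
    fix e assume "e \<in> ?E"
    then consider c where "c \<in> C" "e = c \<inter> B" | d where "d \<in> D" "e = d - B" by auto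
    then show "emeasure (glue B \<xi> \<zeta>) e \<noteq> \<infinity>"
    proof cases
      case 1
      have "emeasure (glue B \<xi> \<zeta>) e = emeasure \<xi> (c \<inter> B)"
        using 1 C x B by (subst eg) (auto simp: Int_Diff)
      also have "\<dots> \<le> emeasure \<xi> c"
        using 1 C by (intro emeasure_mono) auto
      finally show ?thesis using C 1 by (auto simp: top_unique)
    next
      case 2
      then have "(d - B) \<inter> B = {}" "d - B - B = d - B" by auto
      then have "emeasure (glue B \<xi> \<zeta>) e = emeasure \<zeta> (d - B)"
        using 2 D z B by (subst eg) auto
      also have "\<dots> \<le> emeasure \<zeta> d"
        using 2 D by (intro emeasure_mono) auto
      finally show ?thesis using D 2 by (auto simp: top_unique)
    qed
  qed
qed

lemma measurable_glue:
  assumes B: "B \<in> sets Z"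
  shows "(\<lambda>(\<xi>, \<zeta>). glue B \<xi> \<zeta>) \<in> N_sigma Z \<Otimes>\<^sub>M N_sigma Z \<rightarrow>\<^sub>M N_sigma Z"
proof (rule measurable_into_N_sigma)
  show "(case x of (\<xi>, \<zeta>) \<Rightarrow> glue B \<xi> \<zeta>) \<in> space (N_sigma Z)"
    if "x \<in> space (N_sigma Z \<Otimes>\<^sub>M N_sigma Z)" for x
    using that B by (auto simp: space_pair_measure glue_in_N_sigma)
  fix A assume A: "A \<in> sets Z"
  have [measurable]: "(\<lambda>\<nu>. emeasure \<nu> (A \<inter> B)) \<in> borel_measurable (N_sigma Z)"
    "(\<lambda>\<nu>. emeasure \<nu> (A - B)) \<in> borel_measurable (N_sigma Z)"
    using A B by (auto intro!: measurable_emeasure_N_sigma)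
  have "(\<lambda>x. emeasure (fst x) (A \<inter> B) + emeasure (snd x) (A - B)) \<in>
      borel_measurable (N_sigma Z \<Otimes>\<^sub>M N_sigma Z)"
    by measurable
  then show "(\<lambda>x. emeasure (case x of (\<xi>, \<zeta>) \<Rightarrow> glue B \<xi> \<zeta>) A) \<in>
      borel_measurable (N_sigma Z \<Otimes>\<^sub>M N_sigma Z)"
    by (rule measurable_cong[THEN iffD1, rotated])
      (use A B in \<open>auto simp: space_pair_measure emeasure_glue space_N_sigmaD\<close>)
qed

lemma measurable_glue_compose [measurable (raw)]:
  assumes "B \<in> sets Z" "h \<in> X \<rightarrow>\<^sub>M N_sigma Z" "k \<in> X \<rightarrow>\<^sub>M N_sigma Z"
  shows "(\<lambda>x. glue B (h x) (k x)) \<in> X \<rightarrow>\<^sub>M N_sigma Z"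
  using measurable_compose[OF measurable_Pair[OF assms(2,3)] measurable_glue[OF assms(1)]] by simp

lemma measurable_add_dirac_compose [measurable (raw)]:
  assumes "h \<in> X \<rightarrow>\<^sub>M N_sigma Z" "k \<in> X \<rightarrow>\<^sub>M Z"
  shows "(\<lambda>x. add_dirac (h x) (k x)) \<in> X \<rightarrow>\<^sub>M N_sigma Z"
  using measurable_compose[OF measurable_Pair[OF assms] measurable_add_dirac[OF refl]] by simp

text \<open>Of two glued configurations, gluing again uses only the inner part of the first and the outer part
  of the second. Hence resampling inside \<open>B\<close> acts on \<open>\<xi>\<close> alone when \<open>\<zeta>\<close> is held fixed.\<close>

lemma glue_glue:
  assumes "sets \<xi> = sets Z" "sets \<zeta> = sets Z" "sets \<xi>' = sets Z" "sets \<zeta>' = sets Z" "B \<in> sets Z"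
  shows "glue B (glue B \<xi>' \<zeta>') (glue B \<xi> \<zeta>) = glue B \<xi>' \<zeta>"
proof (rule measure_eqI)
  fix A assume "A \<in> sets (glue B (glue B \<xi>' \<zeta>') (glue B \<xi> \<zeta>))"
  then have A: "A \<in> sets Z" using assms by simp
  have e: "A \<inter> B - B = {}" "(A - B) \<inter> B = {}" "A - B - B = A - B" by auto
  show "emeasure (glue B (glue B \<xi>' \<zeta>') (glue B \<xi> \<zeta>)) A = emeasure (glue B \<xi>' \<zeta>) A"
    using A assms by (simp add: emeasure_glue e Int_assoc)
qed (use assms in simp)

lemma glue_add_dirac:
  assumes "sets \<xi> = sets Z" "sets \<zeta> = sets Z" "B \<in> sets Z" "z \<in> B"
  shows "glue B (add_dirac \<xi> z) \<zeta> = add_dirac (glue B \<xi> \<zeta>) z"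
proof (rule measure_eqI)
  fix A assume "A \<in> sets (glue B (add_dirac \<xi> z) \<zeta>)"
  then have A: "A \<in> sets Z" using assms by simp
  show "emeasure (glue B (add_dirac \<xi> z) \<zeta>) A = emeasure (add_dirac (glue B \<xi> \<zeta>) z) A"
    using A assms by (simp add: emeasure_glue emeasure_add_dirac indicator_def ac_simps)
qed (use assms in simp)

lemma glue_eq_right:
  assumes "sets \<xi> = sets \<zeta>" "B \<in> sets \<zeta>" "emeasure \<xi> B = 0" "emeasure \<zeta> B = 0"
  shows "glue B \<xi> \<zeta> = \<zeta>"
proof (rule measure_eqI)
  fix A assume "A \<in> sets (glue B \<xi> \<zeta>)"
  then have A: "A \<in> sets \<zeta>" by simp
  have "emeasure \<xi> (A \<inter> B) = 0"
    using assms A by (intro emeasure_eq_0[OF _ assms(3)]) auto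
  moreover have "emeasure \<zeta> A = emeasure \<zeta> (A \<inter> B) + emeasure \<zeta> (A - B)"
    using A assms by (subst plus_emeasure) (auto intro!: arg_cong2[where f = emeasure])
  moreover have "emeasure \<zeta> (A \<inter> B) = 0"
    using assms A by (intro emeasure_eq_0[OF _ assms(4)]) auto
  ultimately show "emeasure (glue B \<xi> \<zeta>) A = emeasure \<zeta> A"
    using A assms by (simp add: emeasure_glue)
qed simp

text \<open>Simple functions suffice below, and for them the integral is a finite sum of measures of level
  sets.\<close>

lemma nn_integral_emeasure_add:
  assumes "sets \<alpha> = sets \<rho>" "sets \<beta> = sets \<rho>"
    and "\<And>A. A \<in> sets \<rho> \<Longrightarrow> emeasure \<rho> A = emeasure \<alpha> A + emeasure \<beta> A"
    and g: "simple_function \<rho> g"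
  shows "(\<integral>\<^sup>+z. g z \<partial>\<rho>) = (\<integral>\<^sup>+z. g z \<partial>\<alpha>) + (\<integral>\<^sup>+z. g z \<partial>\<beta>)"
proof -
  have sp: "space \<alpha> = space \<rho>" "space \<beta> = space \<rho>"
    by (intro sets_eq_imp_space_eq assms)+
  have "simple_function \<alpha> g" "simple_function \<beta> g"
    using g assms(1,2) sp by (simp_all add: simple_function_def)
  then show ?thesis
    using g by (simp add: nn_integral_eq_simple_integral simple_integral_def sp assms(3)
      simple_functionD(2) distrib_left sum.distrib)
qed

lemma nn_integral_add_dirac:
  assumes g: "simple_function \<nu> g" and z: "z \<in> space \<nu>"
  shows "(\<integral>\<^sup>+y. g y \<partial>add_dirac \<nu> z) = (\<integral>\<^sup>+y. g y \<partial>\<nu>) + g z"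
proof -
  have "simple_function (add_dirac \<nu> z) g"
    using g by (simp add: simple_function_def)
  then have "(\<integral>\<^sup>+y. g y \<partial>add_dirac \<nu> z) = (\<integral>\<^sup>+y. g y \<partial>\<nu>) + (\<integral>\<^sup>+y. g y \<partial>return \<nu> z)"
    by (intro nn_integral_emeasure_add) (auto simp: emeasure_add_dirac)
  also have "(\<integral>\<^sup>+y. g y \<partial>return \<nu> z) = g z"
    using g z by (intro nn_integral_return borel_measurable_simple_function)
  finally show ?thesis .
qed

lemma nn_integral_glue:
  assumes x: "sets \<xi> = sets \<zeta>" and B: "B \<in> sets \<zeta>" and g: "simple_function \<zeta> g"
  shows "(\<integral>\<^sup>+y. g y \<partial>glue B \<xi> \<zeta>) =
    (\<integral>\<^sup>+y. g y * indicator B y \<partial>\<xi>) + (\<integral>\<^sup>+y. g y * indicator (space \<zeta> - B) y \<partial>\<zeta>)"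
proof -
  have sp: "space \<xi> = space \<zeta>" using x by (rule sets_eq_imp_space_eq)
  have meas: "g \<in> borel_measurable \<zeta>" "g \<in> borel_measurable \<xi>"
    using borel_measurable_simple_function[OF g] x by (auto cong: measurable_cong_sets)
  have "simple_function (glue B \<xi> \<zeta>) g"
    using g by (simp add: simple_function_def)
  then have "(\<integral>\<^sup>+y. g y \<partial>glue B \<xi> \<zeta>) = (\<integral>\<^sup>+y. g y \<partial>density \<xi> (indicator B)) +
      (\<integral>\<^sup>+y. g y \<partial>density \<zeta> (indicator (space \<zeta> - B)))"
  proof (intro nn_integral_emeasure_add)
    fix A assume "A \<in> sets (glue B \<xi> \<zeta>)"
    then have A: "A \<in> sets \<zeta>" by simp
    have "(\<integral>\<^sup>+y. indicator B y * indicator A y \<partial>\<xi>) = (\<integral>\<^sup>+y. indicator (A \<inter> B) y \<partial>\<xi>)"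
      "(\<integral>\<^sup>+y. indicator (space \<zeta> - B) y * indicator A y \<partial>\<zeta>) = (\<integral>\<^sup>+y. indicator (A - B) y \<partial>\<zeta>)"
      using sets.sets_into_space[OF A] by (auto intro!: nn_integral_cong split: split_indicator)
    then show "emeasure (glue B \<xi> \<zeta>) A =
        emeasure (density \<xi> (indicator B)) A + emeasure (density \<zeta> (indicator (space \<zeta> - B))) A"
      using A B x by (simp add: emeasure_glue emeasure_density)
  qed (use x in auto)
  then show ?thesis
    using meas B x by (simp add: nn_integral_density mult.commute)
qed

section \<open>Laplace functionals determine the law\<close>

text \<open>The function \<open>exp (- x)\<close> on \<open>[0, \<infinity>]\<close>, real-valued so that expectations are Bochner integrals.\<close>

definition exp_neg :: "ennreal \<Rightarrow> real" where
  "exp_neg x = (if x = \<infinity> then 0 else exp (- enn2real x))"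

lemma exp_neg_0 [simp]: "exp_neg 0 = 1"
  by (simp add: exp_neg_def)

lemma exp_neg_nonneg [simp]: "0 \<le> exp_neg x"
  by (simp add: exp_neg_def)

lemma exp_neg_le_1 [simp]: "exp_neg x \<le> 1"
  by (simp add: exp_neg_def)

lemma exp_neg_add: "exp_neg (x + y) = exp_neg x * exp_neg y"
  by (auto simp: exp_neg_def enn2real_plus top.not_eq_extremum exp_diff exp_minus field_simps)

lemma exp_neg_sum: "finite I \<Longrightarrow> exp_neg (\<Sum>i\<in>I. x i) = (\<Prod>i\<in>I. exp_neg (x i))"
  by (induction I rule: finite_induct) (auto simp: exp_neg_add)

lemma exp_neg_mult_of_nat: "0 \<le> t \<Longrightarrow> exp_neg (ennreal t * of_nat k) = exp (- t) ^ k"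
  by (simp add: exp_neg_def ennreal_of_nat_eq_real_of_nat ennreal_mult[symmetric] exp_of_nat_mult[symmetric]
    ac_simps)

lemma borel_measurable_exp_neg [measurable]: "exp_neg \<in> borel_measurable borel"
  unfolding exp_neg_def by measurable

text \<open>The sums agree only to the right of \<open>0\<close>, so the coefficients are compared one by one through the
  limit at \<open>0\<close> from the right of what remains after dividing by a power of \<open>x\<close>.\<close>

lemma powser_unique:
  fixes a b :: "nat \<Rightarrow> real"
  assumes a: "\<And>k. \<bar>a k\<bar> \<le> K" and b: "\<And>k. \<bar>b k\<bar> \<le> K"
    and eq: "\<And>x. 0 < x \<Longrightarrow> x < 1 \<Longrightarrow> (\<Sum>k. a k * x ^ k) = (\<Sum>k. b k * x ^ k)"
  shows "a m = b m"
proof (induction m rule: less_induct)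
  case (less m)
  define d where "d k = a (k + m) - b (k + m)" for k
  have sm: "summable (\<lambda>k. c k * x ^ k)" if "norm x < 1" "\<And>k. \<bar>c k\<bar> \<le> L" for c :: "nat \<Rightarrow> real" and x L
  proof (rule summable_comparison_test')
    show "summable (\<lambda>k. L * norm x ^ k)"
      using that by (intro summable_mult summable_geometric) auto
    show "norm (c k * x ^ k) \<le> L * norm x ^ k" for k
      using that by (auto simp: abs_mult power_abs intro!: mult_right_mono)
  qed
  have dK: "\<bar>d k\<bar> \<le> 2 * K" for k
    unfolding d_def using a[of "k + m"] b[of "k + m"] by linarith
  have "((\<lambda>x. \<Sum>k. d k * x ^ k) \<longlongrightarrow> d 0) (at 0)"
    by (rule powser_limit_0[of 1]) (auto intro!: summable_sums sm[OF _ dK])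
  then have lim: "((\<lambda>x. \<Sum>k. d k * x ^ k) \<longlongrightarrow> d 0) (at_right 0)"
    by (rule tendsto_within_subset) auto
  have zero: "(\<Sum>k. d k * x ^ k) = 0" if x: "0 < x" "x < 1" for x
  proof -
    have x1: "norm x < 1" using x by simp
    have sa: "summable (\<lambda>k. a k * x ^ k)" and sb: "summable (\<lambda>k. b k * x ^ k)"
      by (rule sm[OF x1 a], rule sm[OF x1 b])
    have "(\<Sum>k. a (k + m) * x ^ (k + m)) + (\<Sum>k<m. a k * x ^ k) =
        (\<Sum>k. b (k + m) * x ^ (k + m)) + (\<Sum>k<m. b k * x ^ k)"
      using eq[OF x] suminf_split_initial_segment[OF sa, of m]
        suminf_split_initial_segment[OF sb, of m] by simp
    then have "(\<Sum>k. a (k + m) * x ^ (k + m)) = (\<Sum>k. b (k + m) * x ^ (k + m))"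
      using less by simp
    moreover have "summable (\<lambda>k. a (k + m) * x ^ (k + m))" "summable (\<lambda>k. b (k + m) * x ^ (k + m))"
      using summable_ignore_initial_segment[OF sa, of m] summable_ignore_initial_segment[OF sb, of m]
      by simp_all
    ultimately have "(\<Sum>k. a (k + m) * x ^ (k + m) - b (k + m) * x ^ (k + m)) = 0"
      by (simp add: suminf_diff[symmetric])
    moreover have "a (k + m) * x ^ (k + m) - b (k + m) * x ^ (k + m) = x ^ m * (d k * x ^ k)" for k
      by (simp add: d_def power_add algebra_simps)
    ultimately have "x ^ m * (\<Sum>k. d k * x ^ k) = 0"
      using suminf_mult[OF sm[OF x1 dK], of "x ^ m"] by simp
    then show ?thesis using x by simp
  qed
  have "eventually (\<lambda>x. (\<Sum>k. d k * x ^ k) = 0) (at_right (0::real))"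
    by (rule eventually_mono[OF eventually_at_right_real[of 0 1]]) (auto intro: zero)
  then have "((\<lambda>x. \<Sum>k. d k * x ^ k) \<longlongrightarrow> 0) (at_right (0::real))"
    by (rule tendsto_eventually)
  from tendsto_unique[OF _ lim this] show ?case
    by (simp add: d_def)
qed

text \<open>As a function of \<open>x = exp (- t)\<close>, the Laplace transform of a count is a power series whose
  coefficients are the (weighted) probabilities of its values. An infinite count contributes nothing
  because \<open>exp_neg \<infinity> = 0\<close>.\<close>

lemma (in prob_space) integral_exp_neg_count:
  assumes X [measurable]: "X \<in> borel_measurable M"
    and val: "\<And>\<omega>. \<omega> \<in> space M \<Longrightarrow> X \<omega> \<in> insert \<infinity> (range of_nat)"
    and W [measurable]: "W \<in> borel_measurable M" and W01: "\<And>\<omega>. 0 \<le> W \<omega>" "\<And>\<omega>. W \<omega> \<le> 1"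
    and t: "0 < t"
  shows "(\<integral>\<omega>. W \<omega> * exp_neg (ennreal t * X \<omega>) \<partial>M) =
    (\<Sum>k. (\<integral>\<omega>. W \<omega> * indicator {x. x = of_nat k} (X \<omega>) \<partial>M) * exp (- t) ^ k)"
proof -
  let ?f = "\<lambda>k \<omega>. W \<omega> * indicator {x. x = of_nat k} (X \<omega>) * exp (- t) ^ k"
  have bound: "\<bar>?f k \<omega>\<bar> \<le> exp (- t) ^ k" for k \<omega>
    using W01[of \<omega>] by (auto simp: indicator_def)
  have geo: "summable (\<lambda>k. exp (- t) ^ k)"
    using t by (intro summable_geometric) auto
  have int: "integrable M (?f k)" for k
    by (rule integrable_const_bound[where B = "exp (- t) ^ k"]) (use bound in auto)
  have "W \<omega> * exp_neg (ennreal t * X \<omega>) = (\<Sum>k. ?f k \<omega>)" if \<omega>: "\<omega> \<in> space M" for \<omega>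
  proof (cases "X \<omega> = \<infinity>")
    case True
    then have "(\<lambda>k. ?f k \<omega>) = (\<lambda>_. 0)" by (auto simp: indicator_def fun_eq_iff)
    then have "(\<Sum>k. ?f k \<omega>) = 0" by (simp only: suminf_zero)
    moreover have "exp_neg (ennreal t * X \<omega>) = 0"
      using True t by (simp add: exp_neg_def ennreal_mult_top)
    ultimately show ?thesis by simp
  next
    case False
    then obtain n where n: "X \<omega> = of_nat n" using val[OF \<omega>] by auto
    have "(\<Sum>k. ?f k \<omega>) = (\<Sum>k\<in>{n}. ?f k \<omega>)"
      by (rule suminf_finite) (auto simp: n)
    then show ?thesis using t by (simp add: n exp_neg_mult_of_nat)
  qed
  then have "(\<integral>\<omega>. W \<omega> * exp_neg (ennreal t * X \<omega>) \<partial>M) = (\<integral>\<omega>. (\<Sum>k. ?f k \<omega>) \<partial>M)"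
    by (intro Bochner_Integration.integral_cong) auto
  also have "\<dots> = (\<Sum>k. integral\<^sup>L M (?f k))"
  proof (rule integral_suminf[OF int])
    show "AE \<omega> in M. summable (\<lambda>k. norm (?f k \<omega>))"
      using bound by (intro AE_I2 summable_comparison_test'[OF geo]) auto
    show "summable (\<lambda>k. \<integral>\<omega>. norm (?f k \<omega>) \<partial>M)"
    proof (rule summable_comparison_test'[OF geo])
      fix k
      have "(\<integral>\<omega>. norm (?f k \<omega>) \<partial>M) \<le> exp (- t) ^ k"
        using int[of k] bound by (intro integral_le_const integrable_norm) auto
      then show "norm (\<integral>\<omega>. norm (?f k \<omega>) \<partial>M) \<le> exp (- t) ^ k"
        by simp
    qed
  qed
  finally show ?thesis by simp
qed

definition laplace :: "('z \<Rightarrow> ennreal) \<Rightarrow> 'z measure \<Rightarrow> real" where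
  "laplace g \<nu> = exp_neg (\<integral>\<^sup>+z. g z \<partial>\<nu>)"

text \<open>Supports of finite intensity make the exponent of the Laplace functional finite, and simple functions
  turn integrals against a configuration into finite combinations of counts.\<close>

definition test_function :: "'z measure \<Rightarrow> ('z \<Rightarrow> ennreal) \<Rightarrow> bool" where
  "test_function \<mu> g \<longleftrightarrow> simple_function \<mu> g \<and> (\<forall>z\<in>space \<mu>. g z < \<infinity>) \<and>
     emeasure \<mu> {z \<in> space \<mu>. g z \<noteq> 0} < \<infinity>"

definition laplace_exponent :: "'z measure \<Rightarrow> ('z \<Rightarrow> ennreal) \<Rightarrow> real" where
  "laplace_exponent \<mu> g = (\<integral>z. 1 - exp_neg (g z) \<partial>\<mu>)"

text \<open>By \<open>laplace_unique\<close>, for \<open>\<sigma>\<close>-finite \<open>\<mu>\<close> there is at most one such \<open>Q\<close>: the law of a Poisson process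
  with intensity \<open>\<mu>\<close>. Describing it by its Laplace functional avoids counts of sets of infinite
  intensity.\<close>

definition poisson_law :: "'z measure \<Rightarrow> 'z measure measure \<Rightarrow> bool" where
  "poisson_law \<mu> Q \<longleftrightarrow> prob_space Q \<and> sets Q = sets (N_sigma \<mu>) \<and>
     (\<forall>g. test_function \<mu> g \<longrightarrow> (\<integral>\<nu>. laplace g \<nu> \<partial>Q) = exp (- laplace_exponent \<mu> g))"

lemma laplace_bounds [simp]: "0 \<le> laplace g \<nu>" "laplace g \<nu> \<le> 1"
  by (simp_all add: laplace_def)

lemma simple_function_N_sigma:
  "simple_function Z g \<Longrightarrow> \<nu> \<in> space (N_sigma Z) \<Longrightarrow> simple_function \<nu> g"
  using space_N_sigmaD(1,2)[of \<nu> Z] by (simp add: simple_function_def)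

lemma measurable_laplace:
  assumes g: "simple_function Z g"
  shows "laplace g \<in> borel_measurable (N_sigma Z)"
proof -
  have [measurable]: "(\<lambda>\<nu>. emeasure \<nu> (g -` {y} \<inter> space Z)) \<in> borel_measurable (N_sigma Z)" for y
    using g by (intro measurable_emeasure_N_sigma) (auto dest: simple_functionD)
  have "(\<lambda>\<nu>. exp_neg (\<Sum>y\<in>g ` space Z. y * emeasure \<nu> (g -` {y} \<inter> space Z))) \<in> borel_measurable (N_sigma Z)"
    by measurable
  then show ?thesis
    by (rule measurable_cong[THEN iffD1, rotated])
      (simp add: laplace_def nn_integral_eq_simple_integral[OF simple_function_N_sigma[OF g]]
        simple_integral_def space_N_sigmaD)
qed

lemma bounded_laplace: "simple_function Z g \<Longrightarrow> bounded_measurable (N_sigma Z) (laplace g)"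
  by (rule bounded_measurableI[OF measurable_laplace, of _ _ 1]) auto

lemma laplace_add_indicator:
  assumes "simple_function Z g" "A \<in> sets Z" "\<nu> \<in> space (N_sigma Z)"
  shows "laplace (\<lambda>z. g z + t * indicator A z) \<nu> = laplace g \<nu> * exp_neg (t * emeasure \<nu> A)"
proof -
  have [measurable]: "g \<in> borel_measurable \<nu>" "A \<in> sets \<nu>"
    using borel_measurable_simple_function[OF simple_function_N_sigma[OF assms(1,3)]]
      assms space_N_sigmaD(1)[OF assms(3)] by auto
  show ?thesis
    unfolding laplace_def by (subst nn_integral_add) (auto simp: exp_neg_add nn_integral_cmult)
qed

lemma test_function_add_indicator:
  assumes "test_function \<mu> g" "A \<in> sets \<mu>" "emeasure \<mu> A < \<infinity>"
  shows "test_function \<mu> (\<lambda>z. g z + ennreal t * indicator A z)"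
  unfolding test_function_def
proof (intro conjI ballI)
  have g: "simple_function \<mu> g" using assms by (simp add: test_function_def)
  have [measurable]: "g \<in> borel_measurable \<mu>" by (rule borel_measurable_simple_function[OF g])
  show "simple_function \<mu> (\<lambda>z. g z + ennreal t * indicator A z)"
    using g assms(2) by (intro simple_function_add simple_function_mult simple_function_const simple_function_indicator)
  show "g z + ennreal t * indicator A z < \<infinity>" if "z \<in> space \<mu>" for z
    using assms(1) that by (auto simp: test_function_def indicator_def)
  have "emeasure \<mu> {z \<in> space \<mu>. g z + ennreal t * indicator A z \<noteq> 0} \<le>
      emeasure \<mu> ({z \<in> space \<mu>. g z \<noteq> 0} \<union> A)"
    using assms(2) by (intro emeasure_mono) (auto simp: indicator_def)
  also have "\<dots> \<le> emeasure \<mu> {z \<in> space \<mu>. g z \<noteq> 0} + emeasure \<mu> A"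
    using assms(2) by (intro emeasure_subadditive) auto
  also have "\<dots> < \<infinity>"
    using assms by (simp add: test_function_def)
  finally show "emeasure \<mu> {z \<in> space \<mu>. g z + ennreal t * indicator A z \<noteq> 0} < \<infinity>" .
qed

lemma test_function_restrict:
  assumes "test_function \<mu> g" "B \<in> sets \<mu>"
  shows "test_function \<mu> (\<lambda>z. g z * indicator B z)"
  unfolding test_function_def
proof (intro conjI ballI)
  have g: "simple_function \<mu> g" using assms by (simp add: test_function_def)
  have [measurable]: "g \<in> borel_measurable \<mu>" by (rule borel_measurable_simple_function[OF g])
  show "simple_function \<mu> (\<lambda>z. g z * indicator B z)"
    using g assms(2) by (intro simple_function_mult simple_function_indicator)
  show "g z * indicator B z < \<infinity>" if "z \<in> space \<mu>" for z
    using assms(1) that by (auto simp: test_function_def indicator_def)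
  have "emeasure \<mu> {z \<in> space \<mu>. g z * indicator B z \<noteq> 0} \<le> emeasure \<mu> {z \<in> space \<mu>. g z \<noteq> 0}"
    by (intro emeasure_mono) auto
  also have "\<dots> < \<infinity>"
    using assms by (simp add: test_function_def)
  finally show "emeasure \<mu> {z \<in> space \<mu>. g z * indicator B z \<noteq> 0} < \<infinity>" .
qed

lemma integrable_one_minus_exp_neg:
  assumes "test_function \<mu> g"
  shows "integrable \<mu> (\<lambda>z. 1 - exp_neg (g z))"
proof (rule Bochner_Integration.integrable_bound)
  have [measurable]: "g \<in> borel_measurable \<mu>"
    using assms by (simp add: test_function_def borel_measurable_simple_function)
  show "integrable \<mu> (indicator {z \<in> space \<mu>. g z \<noteq> 0} :: _ \<Rightarrow> real)"
    using assms by (intro integrable_real_indicator) (auto simp: test_function_def)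
  show "(\<lambda>z. 1 - exp_neg (g z)) \<in> borel_measurable \<mu>" by measurable
  show "AE z in \<mu>. norm (1 - exp_neg (g z)) \<le> norm (indicator {z \<in> space \<mu>. g z \<noteq> 0} z :: real)"
    by (intro AE_I2) (auto simp: indicator_def)
qed

text \<open>At each point one of the two summands on the right vanishes. This additivity of the exponent
  expresses the independence of the parts of a Poisson process inside and outside \<open>B\<close>.\<close>

lemma laplace_exponent_split:
  assumes g: "test_function \<mu> g" and B: "B \<in> sets \<mu>"
  shows "laplace_exponent \<mu> g =
    laplace_exponent \<mu> (\<lambda>z. g z * indicator B z) + laplace_exponent \<mu> (\<lambda>z. g z * indicator (space \<mu> - B) z)"
proof -
  have "laplace_exponent \<mu> g =
      (\<integral>z. (1 - exp_neg (g z * indicator B z)) + (1 - exp_neg (g z * indicator (space \<mu> - B) z)) \<partial>\<mu>)"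
    unfolding laplace_exponent_def
    by (intro Bochner_Integration.integral_cong) (auto simp: indicator_def)
  also have "\<dots> = laplace_exponent \<mu> (\<lambda>z. g z * indicator B z) +
      laplace_exponent \<mu> (\<lambda>z. g z * indicator (space \<mu> - B) z)"
    unfolding laplace_exponent_def
    by (intro Bochner_Integration.integral_add integrable_one_minus_exp_neg test_function_restrict g)
      (use B in auto)
  finally show ?thesis .
qed

text \<open>Counts of sets of finite intensity generate the \<open>\<sigma>\<close>-field: by \<open>\<sigma>\<close>-finiteness of \<open>\<mu>\<close>, the count of
  an arbitrary set is a countable sum of such counts, and infinite values are recognised as the
  complement of all finite ones.\<close>

lemma sets_N_sigma_counts:
  assumes "sigma_finite_measure \<mu>"
  shows "sets (N_sigma \<mu>) = sigma_sets (space (N_sigma \<mu>))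
    {{\<nu> \<in> space (N_sigma \<mu>). emeasure \<nu> A = of_nat k} | A k. A \<in> sets \<mu> \<and> emeasure \<mu> A < \<infinity>}"
    (is "_ = sigma_sets ?\<Omega> ?G")
proof
  interpret sigma_finite_measure \<mu> by fact
  have G: "?G \<subseteq> sets (N_sigma \<mu>)"
  proof safe
    fix A and k :: nat assume A: "A \<in> sets \<mu>"
    note [measurable] = measurable_emeasure_N_sigma[OF A]
    show "{\<nu> \<in> ?\<Omega>. emeasure \<nu> A = of_nat k} \<in> sets (N_sigma \<mu>)" by measurable
  qed
  then show "sigma_sets ?\<Omega> ?G \<subseteq> sets (N_sigma \<mu>)"
    by (rule sets.sigma_sets_subset)
  define S where "S = sigma ?\<Omega> ?G"
  have GP: "?G \<subseteq> Pow ?\<Omega>" by auto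
  have sS: "space S = ?\<Omega>" "sets S = sigma_sets ?\<Omega> ?G"
    using GP by (simp_all add: S_def space_measure_of_conv sets_measure_of)
  have fin: "(\<lambda>\<nu>. emeasure \<nu> A) \<in> borel_measurable S" if A: "A \<in> sets \<mu>" "emeasure \<mu> A < \<infinity>" for A
  proof (rule measurableI)
    fix E :: "ennreal set" assume "E \<in> sets borel"
    define L where "L k = {\<nu> \<in> ?\<Omega>. emeasure \<nu> A = of_nat k}" for k :: nat
    have L [measurable]: "L k \<in> sets S" for k
      unfolding sS L_def using A by (intro sigma_sets.Basic) blast
    have "(\<lambda>\<nu>. emeasure \<nu> A) -` E \<inter> space S =
        (\<Union>k\<in>{k. of_nat k \<in> E}. L k) \<union> (if \<infinity> \<in> E then space S - (\<Union>k. L k) else {})"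
    proof -
      have "emeasure \<nu> A = \<infinity> \<or> (\<exists>k. emeasure \<nu> A = of_nat k)" if "\<nu> \<in> ?\<Omega>" for \<nu>
        using space_N_sigmaD(4)[OF that A(1)] by auto
      then show ?thesis unfolding sS(1) L_def by (auto split: if_splits) metis
    qed
    also have "\<dots> \<in> sets S"
      by (auto intro!: sets.Un sets.countable_UN'')
    finally show "(\<lambda>\<nu>. emeasure \<nu> A) -` E \<inter> space S \<in> sets S" .
  qed simp
  obtain C :: "nat \<Rightarrow> _" where C: "range C \<subseteq> sets \<mu>" "(\<Union>i. C i) = space \<mu>" "\<And>i. emeasure \<mu> (C i) \<noteq> \<infinity>"
    "disjoint_family C"
    using sigma_finite_disjoint by blast
  have "(\<lambda>\<nu>. \<nu>) \<in> S \<rightarrow>\<^sub>M N_sigma \<mu>"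
  proof (rule measurable_into_N_sigma)
    fix A assume A: "A \<in> sets \<mu>"
    have "(\<lambda>\<nu>. \<Sum>i. emeasure \<nu> (A \<inter> C i)) \<in> borel_measurable S"
    proof (intro borel_measurable_suminf_order fin)
      fix i
      show "A \<inter> C i \<in> sets \<mu>" using A C by auto
      have "emeasure \<mu> (A \<inter> C i) \<le> emeasure \<mu> (C i)" using A C by (intro emeasure_mono) auto
      also have "\<dots> < \<infinity>" using C(3) by (simp add: top.not_eq_extremum)
      finally show "emeasure \<mu> (A \<inter> C i) < \<infinity>" .
    qed
    moreover have "(\<Sum>i. emeasure \<nu> (A \<inter> C i)) = emeasure \<nu> A" if "\<nu> \<in> space S" for \<nu>
    proof -
      have \<nu>: "sets \<nu> = sets \<mu>" using that sS(1) space_N_sigmaD(1) by simp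
      have "(\<Sum>i. emeasure \<nu> (A \<inter> C i)) = emeasure \<nu> (\<Union>i. A \<inter> C i)"
        using A C(1) \<nu> disjoint_family_on_bisimulation[OF C(4), of "\<lambda>i. A \<inter> C i"]
        by (intro suminf_emeasure) auto
      also have "(\<Union>i. A \<inter> C i) = A"
        using C(2) sets.sets_into_space[OF A] by auto
      finally show ?thesis .
    qed
    ultimately show "(\<lambda>\<nu>. emeasure \<nu> A) \<in> borel_measurable S"
      by (rule measurable_cong[THEN iffD1, rotated])
  qed (use sS in auto)
  from measurable_sets[OF this] show "sets (N_sigma \<mu>) \<subseteq> sigma_sets ?\<Omega> ?G"
    unfolding sS using sets.sets_into_space by (auto simp: Int_absorb2)
qed

text \<open>Joint level sets of finitely many counts form an intersection-stable generator. Their probabilities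
  are extracted from the Laplace functional one count at a time: perturbing the test function by
  \<open>t\<close> times the indicator of \<open>A\<close> yields a power series in \<open>exp (- t)\<close> whose coefficients insert the
  events \<open>\<nu> A = k\<close> into the expectation. Overlapping sets \<open>A\<close> are covered because test
  functions are closed under addition.\<close>

lemma laplace_unique:
  assumes \<mu>: "sigma_finite_measure \<mu>"
    and P: "prob_space P" "sets P = sets (N_sigma \<mu>)" and Q: "prob_space Q" "sets Q = sets (N_sigma \<mu>)"
    and eq: "\<And>g. test_function \<mu> g \<Longrightarrow> (\<integral>\<nu>. laplace g \<nu> \<partial>P) = (\<integral>\<nu>. laplace g \<nu> \<partial>Q)"
  shows "P = Q"
proof -
  interpret P: prob_space P by fact
  interpret Q: prob_space Q by fact
  let ?\<Omega> = "space (N_sigma \<mu>)"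
  have sp: "space P = ?\<Omega>" "space Q = ?\<Omega>" using P Q by (auto dest: sets_eq_imp_space_eq)
  define lev where "lev L = {\<nu> \<in> ?\<Omega>. \<forall>(A, k)\<in>set L. emeasure \<nu> A = of_nat k}"
    for L :: "('a set \<times> nat) list"
  define adm where "adm L \<longleftrightarrow> (\<forall>(A, k)\<in>set L. A \<in> sets \<mu> \<and> emeasure \<mu> A < \<infinity>)"
    for L :: "('a set \<times> nat) list"
  have lev_Cons: "lev ((A, k) # L) = lev L \<inter> {\<nu> \<in> ?\<Omega>. emeasure \<nu> A = of_nat k}" for A k L
    by (auto simp: lev_def)
  have lev_sets: "lev L \<in> sets (N_sigma \<mu>)" if "adm L" for L
    using that
  proof (induction L)
    case Nil
    then show ?case by (simp add: lev_def)
  next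
    case (Cons Ak L)
    obtain A k where Ak: "Ak = (A, k)" by (cases Ak)
    with Cons have A: "A \<in> sets \<mu>" "lev L \<in> sets (N_sigma \<mu>)" by (auto simp: adm_def)
    note [measurable] = measurable_emeasure_N_sigma[OF A(1)]
    show ?case unfolding Ak lev_Cons using A(2) by measurable
  qed
  have main: "(\<integral>\<nu>. indicator (lev L) \<nu> * laplace g \<nu> \<partial>P) = (\<integral>\<nu>. indicator (lev L) \<nu> * laplace g \<nu> \<partial>Q)"
    if "adm L" "test_function \<mu> g" for L g
    using that
  proof (induction L arbitrary: g)
    case Nil
    have "(\<integral>\<nu>. indicator (lev []) \<nu> * laplace g \<nu> \<partial>R) = (\<integral>\<nu>. laplace g \<nu> \<partial>R)" if "space R = ?\<Omega>" for R
      by (intro Bochner_Integration.integral_cong) (auto simp: lev_def that)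
    then show ?case using eq Nil sp by simp
  next
    case (Cons Ak L)
    obtain A k where Ak: "Ak = (A, k)" by (cases Ak)
    with Cons.prems have A: "A \<in> sets \<mu>" "emeasure \<mu> A < \<infinity>" and L: "adm L" by (auto simp: adm_def)
    have g: "simple_function \<mu> g" using Cons.prems by (simp add: test_function_def)
    define W where "W \<nu> = indicator (lev L) \<nu> * laplace g \<nu>" for \<nu>
    have W01: "0 \<le> W \<nu>" "W \<nu> \<le> 1" for \<nu> by (auto simp: W_def indicator_def)
    have [measurable]: "W \<in> borel_measurable (N_sigma \<mu>)" "(\<lambda>\<nu>. emeasure \<nu> A) \<in> borel_measurable (N_sigma \<mu>)"
      using lev_sets[OF L] measurable_laplace[OF g] measurable_emeasure_N_sigma[OF A(1)] by (auto simp: W_def[abs_def])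
    define a where "a R j = (\<integral>\<nu>. W \<nu> * indicator {x. x = of_nat j} (emeasure \<nu> A) \<partial>R)" for R j
    have abs_a: "\<bar>a R j\<bar> \<le> 1" and ser: "0 < t \<Longrightarrow> (\<integral>\<nu>. indicator (lev L) \<nu> * laplace (\<lambda>z. g z + ennreal t * indicator A z) \<nu> \<partial>R) =
        (\<Sum>j. a R j * exp (- t) ^ j)" if R: "prob_space R" "sets R = sets (N_sigma \<mu>)" for R t j
    proof -
      interpret R: prob_space R by fact
      have spR: "space R = ?\<Omega>" using R(2) by (rule sets_eq_imp_space_eq)
      have mR [measurable]: "W \<in> borel_measurable R" "(\<lambda>\<nu>. emeasure \<nu> A) \<in> borel_measurable R"
        by (simp_all add: measurable_cong_sets[OF R(2) refl])
      show "\<bar>a R j\<bar> \<le> 1"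
        unfolding a_def by (intro R.bounded_integral bounded_measurableI[of _ _ 1])
          (use W01 in \<open>auto simp: indicator_def\<close>)
      assume t: "0 < t"
      have "(\<integral>\<nu>. indicator (lev L) \<nu> * laplace (\<lambda>z. g z + ennreal t * indicator A z) \<nu> \<partial>R) =
          (\<integral>\<nu>. W \<nu> * exp_neg (ennreal t * emeasure \<nu> A) \<partial>R)"
        by (intro Bochner_Integration.integral_cong)
          (auto simp: W_def laplace_add_indicator[OF g A(1)] spR)
      also have "\<dots> = (\<Sum>j. a R j * exp (- t) ^ j)"
        unfolding a_def using space_N_sigmaD(4)[OF _ A(1)]
        by (intro R.integral_exp_neg_count mR W01 t) (simp add: spR)
      finally show "(\<integral>\<nu>. indicator (lev L) \<nu> * laplace (\<lambda>z. g z + ennreal t * indicator A z) \<nu> \<partial>R) =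
        (\<Sum>j. a R j * exp (- t) ^ j)" .
    qed
    have "a P k = a Q k"
    proof (rule powser_unique)
      show "\<bar>a P j\<bar> \<le> 1" "\<bar>a Q j\<bar> \<le> 1" for j
        using abs_a P Q by auto
      fix x :: real assume x: "0 < x" "x < 1"
      \<comment> \<open>The perturbation of the test function that produces the power series at the point x.\<close>
      define t where "t = - ln x"
      have t: "0 < t" "exp (- t) = x" using x by (auto simp: t_def)
      have "(\<integral>\<nu>. indicator (lev L) \<nu> * laplace (\<lambda>z. g z + ennreal t * indicator A z) \<nu> \<partial>P) =
          (\<integral>\<nu>. indicator (lev L) \<nu> * laplace (\<lambda>z. g z + ennreal t * indicator A z) \<nu> \<partial>Q)"
        by (intro Cons.IH L test_function_add_indicator Cons.prems A)
      then show "(\<Sum>j. a P j * x ^ j) = (\<Sum>j. a Q j * x ^ j)"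
        using ser[OF P t(1)] ser[OF Q t(1)] t(2) by simp
    qed
    moreover have "a R k = (\<integral>\<nu>. indicator (lev ((A, k) # L)) \<nu> * laplace g \<nu> \<partial>R)" if "space R = ?\<Omega>" for R
      unfolding a_def lev_Cons W_def
      by (intro Bochner_Integration.integral_cong) (auto simp: indicator_def that)
    ultimately show ?case
      using sp by (simp add: Ak)
  qed
  define E where "E = {lev L | L. adm L}"
  have sE: "sets (N_sigma \<mu>) = sigma_sets ?\<Omega> E"
  proof
    have "sets (N_sigma \<mu>) = sigma_sets ?\<Omega>
        {{\<nu> \<in> ?\<Omega>. emeasure \<nu> A = of_nat k} | A k. A \<in> sets \<mu> \<and> emeasure \<mu> A < \<infinity>}"
      by (rule sets_N_sigma_counts[OF \<mu>])
    also have "\<dots> \<subseteq> sigma_sets ?\<Omega> E"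
    proof (rule sigma_sets_mono')
      have "{\<nu> \<in> ?\<Omega>. emeasure \<nu> A = of_nat k} = lev [(A, k)]" for A k by (auto simp: lev_def)
      then show "{{\<nu> \<in> ?\<Omega>. emeasure \<nu> A = of_nat k} | A k. A \<in> sets \<mu> \<and> emeasure \<mu> A < \<infinity>} \<subseteq> E"
        unfolding E_def adm_def by fastforce
    qed
    finally show "sets (N_sigma \<mu>) \<subseteq> sigma_sets ?\<Omega> E" .
    show "sigma_sets ?\<Omega> E \<subseteq> sets (N_sigma \<mu>)"
      by (rule sets.sigma_sets_subset) (use lev_sets in \<open>auto simp: E_def\<close>)
  qed
  show ?thesis
  proof (rule measure_eqI_generator_eq)
    show "Int_stable E"
    proof (rule Int_stableI)
      fix X Y assume "X \<in> E" "Y \<in> E"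
      then obtain L L' where "X = lev L" "adm L" "Y = lev L'" "adm L'" by (auto simp: E_def)
      then have "X \<inter> Y = lev (L @ L')" "adm (L @ L')" by (auto simp: lev_def adm_def)
      then show "X \<inter> Y \<in> E" by (auto simp: E_def)
    qed
    show "E \<subseteq> Pow ?\<Omega>" by (auto simp: E_def lev_def)
    show "emeasure P X = emeasure Q X" if X: "X \<in> E" for X
    proof -
      obtain L where L: "X = lev L" "adm L" using X by (auto simp: E_def)
      have "test_function \<mu> (\<lambda>_. 0)" by (simp add: test_function_def)
      from main[OF L(2) this] have "measure P X = measure Q X"
        using lev_sets[OF L(2)] P Q L(1) by (simp add: laplace_def)
      then show ?thesis by (simp add: P.emeasure_eq_measure Q.emeasure_eq_measure)
    qed
    show "sets P = sigma_sets ?\<Omega> E" "sets Q = sigma_sets ?\<Omega> E" using P Q sE by auto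
    show "range (\<lambda>_::nat. lev []) \<subseteq> E"
      unfolding E_def adm_def by (intro image_subsetI CollectI exI[of _ "[]"]) simp
    show "(\<Union>i::nat. lev []) = ?\<Omega>" by (simp add: lev_def)
    show "emeasure P (lev []) \<noteq> \<infinity>" by simp
  qed
qed

section \<open>Laws with the Laplace functional of a Poisson process\<close>

lemma (in prob_space) expectation_exp_neg_poisson:
  assumes X [measurable]: "X \<in> borel_measurable M"
    and val: "\<And>\<omega>. \<omega> \<in> space M \<Longrightarrow> X \<omega> \<in> insert \<infinity> (range of_nat)"
    and pois: "\<And>k::nat. prob {\<omega> \<in> space M. X \<omega> = of_nat k} = m ^ k / fact k * exp (- m)"
    and t: "0 < t"
  shows "(\<integral>\<omega>. exp_neg (ennreal t * X \<omega>) \<partial>M) = exp (- (m * (1 - exp (- t))))"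
proof -
  have "(\<integral>\<omega>. indicator {x. x = of_nat k} (X \<omega>) \<partial>M) = m ^ k / fact k * exp (- m)" for k
  proof -
    have "(\<integral>\<omega>. indicator {x. x = of_nat k} (X \<omega>) \<partial>M) =
        (\<integral>\<omega>. indicator {\<omega> \<in> space M. X \<omega> = of_nat k} \<omega> \<partial>M)"
      by (intro Bochner_Integration.integral_cong) (auto simp: indicator_def)
    also have "\<dots> = prob {\<omega> \<in> space M. X \<omega> = of_nat k}"
      by (simp add: Int_absorb2 subset_eq)
    finally show ?thesis by (simp only: pois)
  qed
  then have "(\<integral>\<omega>. exp_neg (ennreal t * X \<omega>) \<partial>M) = (\<Sum>k. m ^ k / fact k * exp (- m) * exp (- t) ^ k)"
    using integral_exp_neg_count[OF X val, of "\<lambda>_. 1" t] t by simp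
  also have "\<dots> = (\<Sum>k. exp (- m) * ((m * exp (- t)) ^ k /\<^sub>R fact k))"
    by (simp add: power_mult_distrib field_simps)
  also have "\<dots> = exp (- m) * exp (m * exp (- t))"
    using suminf_mult[OF summable_exp_generic[of "m * exp (- t)"], of "exp (- m)"] by (simp add: exp_def)
  finally show ?thesis by (simp add: mult_exp_exp algebra_simps)
qed

text \<open>The level sets of a simple function are disjoint, so the Laplace functional factorises into
  transforms of independent Poisson variables.\<close>

lemma poisson_law_random_measure:
  assumes M: "prob_space M" and prm: "poisson_random_measure M \<mu> \<eta>"
  shows "poisson_law \<mu> (distr M (N_sigma \<mu>) \<eta>)"
  unfolding poisson_law_def
proof (intro conjI allI impI)
  interpret prob_space M by fact
  have \<eta> [measurable]: "\<eta> \<in> M \<rightarrow>\<^sub>M N_sigma \<mu>"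
    using prm by (simp add: poisson_random_measure_def)
  show "prob_space (distr M (N_sigma \<mu>) \<eta>)" by (rule prob_space_distr[OF \<eta>])
  fix g assume tg: "test_function \<mu> g"
  then have g: "simple_function \<mu> g" by (simp add: test_function_def)
  have [measurable]: "g \<in> borel_measurable \<mu>" by (rule borel_measurable_simple_function[OF g])
  \<comment> \<open>The level set at 0 may have infinite intensity; it does not contribute and is left out.\<close>
  define S where "S = g ` space \<mu> - {0}"
  have finS: "finite S" using simple_functionD(1)[OF g] by (simp add: S_def)
  obtain h where h: "bij_betw h {..<card S} S"
    using ex_bij_betw_nat_finite[OF finS] by (auto simp: atLeast0LessThan)
  define n where "n = card S"
  define A where "A i = {z \<in> space \<mu>. g z = h i}" for i
  have hS: "h i \<in> S" if "i < n" for i using h that by (auto simp: n_def bij_betw_def)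
  have h_pos: "0 < enn2real (h i) \<and> ennreal (enn2real (h i)) = h i" if "i < n" for i
  proof -
    have "h i < \<infinity>" "h i \<noteq> 0" using hS[OF that] tg by (auto simp: S_def test_function_def)
    then show ?thesis by (auto simp: enn2real_positive_iff top.not_eq_extremum zero_less_iff_neq_zero)
  qed
  have h_inj: "i = j" if "i < n" "j < n" "h i = h j" for i j
    using h that by (auto simp: n_def bij_betw_def inj_on_def)
  have A [measurable]: "A i \<in> sets \<mu>" for i unfolding A_def by measurable
  have A_fin: "emeasure \<mu> (A i) < \<infinity>" if "i < n" for i
  proof -
    have "emeasure \<mu> (A i) \<le> emeasure \<mu> {z \<in> space \<mu>. g z \<noteq> 0}"
      using hS[OF that] by (intro emeasure_mono) (auto simp: A_def S_def)
    also have "\<dots> < \<infinity>" using tg by (simp add: test_function_def)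
    finally show ?thesis .
  qed
  have A_disj: "disjoint_family_on A {..<n}"
    using h_inj by (auto simp: disjoint_family_on_def A_def)
  have \<eta>_space: "\<eta> \<omega> \<in> space (N_sigma \<mu>)" if "\<omega> \<in> space M" for \<omega>
    using measurable_space[OF \<eta> that] .
  have count_meas [measurable]: "(\<lambda>\<omega>. emeasure (\<eta> \<omega>) (A i)) \<in> borel_measurable M" for i
    by (rule measurable_compose[OF \<eta> measurable_emeasure_N_sigma[OF A]])
  have lap: "laplace g (\<eta> \<omega>) = (\<Prod>i<n. exp_neg (h i * emeasure (\<eta> \<omega>) (A i)))" if \<omega>: "\<omega> \<in> space M" for \<omega>
  proof -
    note E = space_N_sigmaD[OF \<eta>_space[OF \<omega>]]
    have "(\<integral>\<^sup>+z. g z \<partial>\<eta> \<omega>) = (\<Sum>y\<in>g ` space \<mu>. y * emeasure (\<eta> \<omega>) (g -` {y} \<inter> space \<mu>))"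
      by (simp add: nn_integral_eq_simple_integral[OF simple_function_N_sigma[OF g \<eta>_space[OF \<omega>]]]
        simple_integral_def E)
    also have "\<dots> = (\<Sum>y\<in>S. y * emeasure (\<eta> \<omega>) (g -` {y} \<inter> space \<mu>))"
      using simple_functionD(1)[OF g] by (intro sum.mono_neutral_right) (auto simp: S_def)
    also have "\<dots> = (\<Sum>i<n. h i * emeasure (\<eta> \<omega>) (g -` {h i} \<inter> space \<mu>))"
      unfolding n_def by (rule sum.reindex_bij_betw[OF h, symmetric])
    also have "\<dots> = (\<Sum>i<n. h i * emeasure (\<eta> \<omega>) (A i))"
      by (intro sum.cong refl arg_cong2[where f = "(*)"] arg_cong2[where f = emeasure]) (auto simp: A_def)
    finally show ?thesis by (simp add: laplace_def exp_neg_sum)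
  qed
  have ind: "indep_vars (\<lambda>_. borel) (\<lambda>i \<omega>. emeasure (\<eta> \<omega>) (A i)) {..<n}"
    using prm A_disj A unfolding poisson_random_measure_def by blast
  have "(\<integral>\<nu>. laplace g \<nu> \<partial>distr M (N_sigma \<mu>) \<eta>) = (\<integral>\<omega>. laplace g (\<eta> \<omega>) \<partial>M)"
    by (rule integral_distr[OF \<eta> measurable_laplace[OF g]])
  also have "\<dots> = (\<integral>\<omega>. (\<Prod>i<n. exp_neg (h i * emeasure (\<eta> \<omega>) (A i))) \<partial>M)"
    using lap by (intro Bochner_Integration.integral_cong) auto
  also have "\<dots> = (\<Prod>i<n. \<integral>\<omega>. exp_neg (h i * emeasure (\<eta> \<omega>) (A i)) \<partial>M)"
  proof (rule indep_vars_lebesgue_integral)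
    show "indep_vars (\<lambda>_. borel) (\<lambda>i \<omega>. exp_neg (h i * emeasure (\<eta> \<omega>) (A i))) {..<n}"
      by (rule indep_vars_compose2[OF ind]) measurable
    show "integrable M (\<lambda>\<omega>. exp_neg (h i * emeasure (\<eta> \<omega>) (A i)))" for i
      by (rule integrable_const_bound[of _ 1]) auto
  qed simp
  also have "\<dots> = (\<Prod>i<n. exp (- (measure \<mu> (A i) * (1 - exp_neg (h i)))))"
  proof (intro prod.cong refl)
    fix i assume "i \<in> {..<n}"
    then have i: "i < n" by simp
    have "(\<integral>\<omega>. exp_neg (ennreal (enn2real (h i)) * emeasure (\<eta> \<omega>) (A i)) \<partial>M) =
        exp (- (measure \<mu> (A i) * (1 - exp (- enn2real (h i)))))"
    proof (rule expectation_exp_neg_poisson)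
      show "emeasure (\<eta> \<omega>) (A i) \<in> insert \<infinity> (range of_nat)" if "\<omega> \<in> space M" for \<omega>
        by (rule space_N_sigmaD(4)[OF \<eta>_space[OF that] A])
      show "prob {\<omega> \<in> space M. emeasure (\<eta> \<omega>) (A i) = of_nat k} =
          measure \<mu> (A i) ^ k / fact k * exp (- measure \<mu> (A i))" for k
        using prm A A_fin[OF i] unfolding poisson_random_measure_def by blast
    qed (use h_pos[OF i] in auto)
    moreover have "exp_neg (h i) = exp (- enn2real (h i))"
      using h_pos[OF i] by (auto simp: exp_neg_def)
    ultimately show "(\<integral>\<omega>. exp_neg (h i * emeasure (\<eta> \<omega>) (A i)) \<partial>M) = exp (- (measure \<mu> (A i) * (1 - exp_neg (h i))))"
      using h_pos[OF i] by simp
  qed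
  also have "\<dots> = exp (- (\<Sum>i<n. measure \<mu> (A i) * (1 - exp_neg (h i))))"
    by (simp add: exp_sum sum_negf[symmetric])
  also have "(\<Sum>i<n. measure \<mu> (A i) * (1 - exp_neg (h i))) = laplace_exponent \<mu> g"
  proof -
    have "laplace_exponent \<mu> g = (\<integral>z. (\<Sum>i<n. indicator (A i) z * (1 - exp_neg (h i))) \<partial>\<mu>)"
      unfolding laplace_exponent_def
    proof (intro Bochner_Integration.integral_cong refl)
      fix z assume z: "z \<in> space \<mu>"
      show "1 - exp_neg (g z) = (\<Sum>i<n. indicator (A i) z * (1 - exp_neg (h i)))"
      proof (cases "g z = 0")
        case True
        have "indicator (A i) z = (0::real)" if "i < n" for i
          using hS[OF that] True by (auto simp: A_def S_def indicator_def)
        then show ?thesis using True by simp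
      next
        case False
        then have "g z \<in> S" using z by (auto simp: S_def)
        then obtain j where j: "j < n" "g z = h j"
          using h by (auto simp: n_def bij_betw_def)
        have "(\<Sum>i<n. indicator (A i) z * (1 - exp_neg (h i))) = (\<Sum>i<n. if i = j then 1 - exp_neg (h i) else 0)"
          using j h_inj z by (intro sum.cong refl) (auto simp: A_def indicator_def)
        then show ?thesis using j by simp
      qed
    qed
    also have "\<dots> = (\<Sum>i<n. measure \<mu> (A i) * (1 - exp_neg (h i)))"
      using A A_fin by (subst Bochner_Integration.integral_sum) (auto simp: integrable_real_indicator)
    finally show ?thesis ..
  qed
  finally show "(\<integral>\<nu>. laplace g \<nu> \<partial>distr M (N_sigma \<mu>) \<eta>) = exp (- laplace_exponent \<mu> g)" .
qed simp

text \<open>Markov's inequality for \<open>1 - exp (- \<nu> A)\<close>, which is at least \<open>1 - exp (- 1)\<close> as soon as \<open>A\<close>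
  contains a point.\<close>

lemma poisson_law_hitting_le:
  assumes Q: "poisson_law \<mu> Q" and A: "A \<in> sets \<mu>" "emeasure \<mu> A < \<infinity>"
  shows "measure Q {\<nu> \<in> space Q. emeasure \<nu> A \<noteq> 0} \<le> measure \<mu> A"
proof -
  interpret prob_space Q using Q by (simp add: poisson_law_def)
  have sQ: "sets Q = sets (N_sigma \<mu>)" and spQ: "space Q = space (N_sigma \<mu>)"
    using Q sets_eq_imp_space_eq[of Q "N_sigma \<mu>"] by (auto simp: poisson_law_def)
  have [measurable]: "(\<lambda>\<nu>. emeasure \<nu> A) \<in> borel_measurable Q"
    using measurable_emeasure_N_sigma[OF A(1)] by (simp add: measurable_cong_sets[OF sQ refl])
  define c where "c = 1 - exp (- 1 :: real)"
  have c: "0 < c" by (simp add: c_def)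
  have lap: "laplace (indicator A) \<nu> = exp_neg (emeasure \<nu> A)" if "\<nu> \<in> space Q" for \<nu>
    using that A spQ by (simp add: laplace_def space_N_sigmaD)
  have test: "test_function \<mu> (indicator A)"
    using test_function_add_indicator[of \<mu> "\<lambda>_. 0" A 1] A by (simp add: test_function_def)
  have "laplace_exponent \<mu> (indicator A) = (\<integral>z. c * indicator A z \<partial>\<mu>)"
    unfolding laplace_exponent_def
    by (intro Bochner_Integration.integral_cong) (auto simp: indicator_def exp_neg_def c_def)
  also have "\<dots> = c * measure \<mu> A"
    using A by (simp add: sets.sets_into_space Int_absorb2)
  finally have expo: "laplace_exponent \<mu> (indicator A) = c * measure \<mu> A" .
  have int: "integrable Q (\<lambda>\<nu>. exp_neg (emeasure \<nu> A))"
    by (rule integrable_const_bound[of _ 1]) auto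
  have "c * measure Q {\<nu> \<in> space Q. emeasure \<nu> A \<noteq> 0} =
      (\<integral>\<nu>. c * indicator {\<nu> \<in> space Q. emeasure \<nu> A \<noteq> 0} \<nu> \<partial>Q)"
    by (simp add: Int_absorb2 subset_eq)
  also have "\<dots> \<le> (\<integral>\<nu>. 1 - exp_neg (emeasure \<nu> A) \<partial>Q)"
  proof (rule integral_mono)
    show "integrable Q (\<lambda>\<nu>. c * indicator {\<nu> \<in> space Q. emeasure \<nu> A \<noteq> 0} \<nu>)"
      by (rule integrable_const_bound[of _ c]) (use c in \<open>auto simp: indicator_def\<close>)
    fix \<nu> assume \<nu>: "\<nu> \<in> space Q"
    consider "emeasure \<nu> A = 0" | "emeasure \<nu> A = \<infinity>" | k :: nat where "emeasure \<nu> A = of_nat k" "k \<noteq> 0"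
      using space_N_sigmaD(4)[of \<nu> \<mu> A] \<nu> spQ A by fastforce
    then show "c * indicator {\<nu> \<in> space Q. emeasure \<nu> A \<noteq> 0} \<nu> \<le> 1 - exp_neg (emeasure \<nu> A)"
    proof cases
      case 3
      then show ?thesis
        using \<nu> exp_neg_mult_of_nat[of 1 k] power_decreasing[of 1 k "exp (- 1 :: real)"] by (simp add: c_def)
    qed (use \<nu> in \<open>auto simp: c_def exp_neg_def\<close>)
  qed (use int in simp)
  also have "\<dots> = 1 - (\<integral>\<nu>. laplace (indicator A) \<nu> \<partial>Q)"
    using int by (simp add: prob_space lap cong: Bochner_Integration.integral_cong)
  also have "\<dots> = 1 - exp (- (c * measure \<mu> A))"
    using Q test expo by (simp add: poisson_law_def)
  also have "\<dots> \<le> c * measure \<mu> A"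
    using exp_ge_add_one_self[of "- (c * measure \<mu> A)"] by simp
  finally show ?thesis using c by simp
qed

text \<open>The Laplace functional of a glued configuration is the product of the functionals of its inner and
  outer part. So the inner part of \<open>Q\<close> may be replaced by that of any \<open>P\<close> whose Laplace functional is
  the right one for test functions supported in \<open>B\<close>. It is used both for the explicitly constructed
  process and for \<open>P = Q\<close>.\<close>

lemma distr_glue:
  assumes \<mu>: "sigma_finite_measure \<mu>" and Q: "poisson_law \<mu> Q" and B: "B \<in> sets \<mu>"
    and P: "prob_space P" "sets P = sets (N_sigma \<mu>)"
    and lap: "\<And>g. test_function \<mu> g \<Longrightarrow> (\<integral>\<nu>. laplace (\<lambda>z. g z * indicator B z) \<nu> \<partial>P) =
      exp (- laplace_exponent \<mu> (\<lambda>z. g z * indicator B z))"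
  shows "distr (P \<Otimes>\<^sub>M Q) (N_sigma \<mu>) (\<lambda>(\<xi>, \<zeta>). glue B \<xi> \<zeta>) = Q"
proof -
  interpret L: prob_space P by fact
  have "prob_space Q" using Q by (simp add: poisson_law_def)
  then interpret Q: prob_space Q .
  interpret pair_prob_space P Q ..
  have sQ: "sets Q = sets (N_sigma \<mu>)" using Q by (simp add: poisson_law_def)
  have spP: "space P = space (N_sigma \<mu>)" and spQ: "space Q = space (N_sigma \<mu>)"
    by (rule sets_eq_imp_space_eq[OF P(2)], rule sets_eq_imp_space_eq[OF sQ])
  have sPQ: "sets (P \<Otimes>\<^sub>M Q) = sets (N_sigma \<mu> \<Otimes>\<^sub>M N_sigma \<mu>)"
    by (rule sets_pair_measure_cong[OF P(2) sQ])
  have mg: "(\<lambda>(\<xi>, \<zeta>). glue B \<xi> \<zeta>) \<in> P \<Otimes>\<^sub>M Q \<rightarrow>\<^sub>M N_sigma \<mu>"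
    using measurable_glue[OF B] by (simp add: measurable_cong_sets[OF sPQ refl])
  show ?thesis
  proof (rule laplace_unique[OF \<mu>])
    show "prob_space (distr (P \<Otimes>\<^sub>M Q) (N_sigma \<mu>) (\<lambda>(\<xi>, \<zeta>). glue B \<xi> \<zeta>))"
      by (rule prob_space_distr[OF mg])
    show "prob_space Q" by (rule Q.prob_space_axioms)
    fix g assume tg: "test_function \<mu> g"
    define g1 where "g1 z = g z * indicator B z" for z
    define g2 where "g2 z = g z * indicator (space \<mu> - B) z" for z
    have t: "test_function \<mu> g1" "test_function \<mu> g2"
      unfolding g1_def[abs_def] g2_def[abs_def] using B by (auto intro!: test_function_restrict[OF tg])
    then have sf: "simple_function \<mu> g" "simple_function \<mu> g1" "simple_function \<mu> g2"
      using tg by (auto simp: test_function_def)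
    have m1 [measurable]: "laplace g1 \<in> borel_measurable P"
      using measurable_laplace[OF sf(2)] by (simp add: measurable_cong_sets[OF P(2) refl])
    have m2 [measurable]: "laplace g2 \<in> borel_measurable Q"
      using measurable_laplace[OF sf(3)] by (simp add: measurable_cong_sets[OF sQ refl])
    have int: "integrable (P \<Otimes>\<^sub>M Q) (\<lambda>(\<xi>, \<zeta>). laplace g1 \<xi> * laplace g2 \<zeta>)"
      by (rule integrable_const_bound[of _ 1]) (auto simp: mult_le_one)
    have "(\<integral>\<nu>. laplace g \<nu> \<partial>distr (P \<Otimes>\<^sub>M Q) (N_sigma \<mu>) (\<lambda>(\<xi>, \<zeta>). glue B \<xi> \<zeta>)) =
        (\<integral>x. laplace g (case x of (\<xi>, \<zeta>) \<Rightarrow> glue B \<xi> \<zeta>) \<partial>(P \<Otimes>\<^sub>M Q))"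
      by (rule integral_distr[OF mg measurable_laplace[OF sf(1)]])
    also have "\<dots> = (\<integral>(\<xi>, \<zeta>). laplace g1 \<xi> * laplace g2 \<zeta> \<partial>(P \<Otimes>\<^sub>M Q))"
    proof (intro Bochner_Integration.integral_cong refl)
      fix x assume "x \<in> space (P \<Otimes>\<^sub>M Q)"
      then obtain \<xi> \<zeta> where x: "x = (\<xi>, \<zeta>)" "\<xi> \<in> space (N_sigma \<mu>)" "\<zeta> \<in> space (N_sigma \<mu>)"
        by (auto simp: space_pair_measure spP spQ)
      note z = space_N_sigmaD[OF x(3)] and xi = space_N_sigmaD[OF x(2)]
      show "laplace g (case x of (\<xi>, \<zeta>) \<Rightarrow> glue B \<xi> \<zeta>) = (case x of (\<xi>, \<zeta>) \<Rightarrow> laplace g1 \<xi> * laplace g2 \<zeta>)"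
        using nn_integral_glue[of \<xi> \<zeta> B g] simple_function_N_sigma[OF sf(1) x(3)] z xi B
        by (simp add: x laplace_def exp_neg_add g1_def g2_def)
    qed
    also have "\<dots> = (\<integral>\<xi>. (\<integral>\<zeta>. laplace g1 \<xi> * laplace g2 \<zeta> \<partial>Q) \<partial>P)"
      by (rule integral_fst[OF int, symmetric])
    also have "\<dots> = (\<integral>\<xi>. laplace g1 \<xi> \<partial>P) * (\<integral>\<zeta>. laplace g2 \<zeta> \<partial>Q)"
      by simp
    also have "\<dots> = exp (- laplace_exponent \<mu> g1) * exp (- laplace_exponent \<mu> g2)"
      using lap[OF tg] Q t(2) by (simp add: g1_def[abs_def] poisson_law_def)
    also have "\<dots> = (\<integral>\<nu>. laplace g \<nu> \<partial>Q)"
      using laplace_exponent_split[OF tg B] Q tg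
      by (simp add: poisson_law_def g1_def[abs_def] g2_def[abs_def] mult_exp_exp)
    finally show "(\<integral>\<nu>. laplace g \<nu> \<partial>distr (P \<Otimes>\<^sub>M Q) (N_sigma \<mu>) (\<lambda>(\<xi>, \<zeta>). glue B \<xi> \<zeta>)) =
      (\<integral>\<nu>. laplace g \<nu> \<partial>Q)" .
  qed (use sQ in simp_all)
qed

lemma commuting_moves_add_dirac:
  assumes "prob_space b" "sets b = sets \<mu>"
  shows "commuting_moves b (N_sigma \<mu>) add_dirac"
proof -
  interpret prob_space b by fact
  show ?thesis
    by unfold_locales (rule measurable_add_dirac[OF assms(2)], rule add_dirac_commute)
qed

lemma null_measure_in_N_sigma: "null_measure \<mu> \<in> space (N_sigma \<mu>)"
proof (rule space_N_sigmaI)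
  have "finite_measure (null_measure \<mu>)" by (rule finite_measureI) simp
  then show "sigma_finite_measure (null_measure \<mu>)" by (rule finite_measure.sigma_finite_measure)
  show "emeasure (null_measure \<mu>) B \<in> insert \<infinity> (range of_nat)" for B
  proof -
    have "emeasure (null_measure \<mu>) B = of_nat 0" by simp
    then show ?thesis by blast
  qed
qed simp

text \<open>A move multiplies \<open>laplace g\<close> by the constant \<open>c = \<integral> exp_neg (g z) b(dz)\<close>, so the expectation after
  a Poisson number of moves is the generating function of a Poisson variable at \<open>c\<close>.\<close>

lemma laplace_poisson_moved:
  assumes b: "prob_space b" "sets b = sets \<mu>" and l: "0 < l" and g: "simple_function \<mu> g"
  shows "(\<integral>\<nu>. laplace g \<nu> \<partial>commuting_moves.poisson_moved b (N_sigma \<mu>) add_dirac l (null_measure \<mu>)) =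
    exp (- (l * (\<integral>z. 1 - exp_neg (g z) \<partial>b)))"
proof -
  interpret commuting_moves b "N_sigma \<mu>" add_dirac
    by (rule commuting_moves_add_dirac[OF b])
  have spb: "space b = space \<mu>" using b(2) by (rule sets_eq_imp_space_eq)
  have [measurable]: "g \<in> borel_measurable b"
    using borel_measurable_simple_function[OF g] by (simp add: measurable_cong_sets[OF b(2) refl])
  define c where "c = (\<integral>z. exp_neg (g z) \<partial>b)"
  have int: "integrable b (\<lambda>z. exp_neg (g z))"
    by (rule integrable_const_bound[of _ 1]) auto
  have pow: "(move ^^ k) (laplace g) \<nu> = c ^ k * laplace g \<nu>" if "\<nu> \<in> space (N_sigma \<mu>)" for k \<nu>
    using that
  proof (induction k arbitrary: \<nu>)
    case (Suc k)
    have "(move ^^ Suc k) (laplace g) \<nu> = (\<integral>z. c ^ k * laplace g \<nu> * exp_neg (g z) \<partial>b)"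
      unfolding move_pow_Suc
    proof (intro Bochner_Integration.integral_cong refl)
      fix z assume z: "z \<in> space b"
      have "laplace g (add_dirac \<nu> z) = laplace g \<nu> * exp_neg (g z)"
        using nn_integral_add_dirac[OF simple_function_N_sigma[OF g Suc.prems], of z] z spb
          space_N_sigmaD(2)[OF Suc.prems] by (simp add: laplace_def exp_neg_add)
      then show "(move ^^ k) (laplace g) (add_dirac \<nu> z) = c ^ k * laplace g \<nu> * exp_neg (g z)"
        using Suc z by (simp add: act_space)
    qed
    then show ?case by (simp add: c_def ac_simps)
  qed simp
  have "(\<integral>\<nu>. laplace g \<nu> \<partial>poisson_moved l (null_measure \<mu>)) =
      (\<Sum>k. l ^ k / fact k * exp (- l) * (c ^ k * laplace g (null_measure \<mu>)))"
    using integral_poisson_moved[OF bounded_laplace[OF g] null_measure_in_N_sigma l]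
    by (simp add: pow null_measure_in_N_sigma)
  also have "\<dots> = (\<Sum>k. exp (- l) * ((l * c) ^ k /\<^sub>R fact k))"
    by (simp add: laplace_def power_mult_distrib divide_inverse mult_ac)
  also have "\<dots> = exp (- l) * exp (l * c)"
    using suminf_mult[OF summable_exp_generic[of "l * c"], of "exp (- l)"] by (simp add: exp_def)
  also have "\<dots> = exp (- (l * (\<integral>z. 1 - exp_neg (g z) \<partial>b)))"
    using int by (simp add: mult_exp_exp prob_space c_def right_diff_distrib)
  finally show ?thesis .
qed

lemma integral_uniform_measure:
  fixes h :: "'a \<Rightarrow> real"
  assumes B: "B \<in> sets \<mu>" "emeasure \<mu> B \<noteq> 0" "emeasure \<mu> B < \<infinity>" and h: "h \<in> borel_measurable \<mu>"
  shows "measure \<mu> B * (\<integral>z. h z \<partial>uniform_measure \<mu> B) = (\<integral>z. indicator B z * h z \<partial>\<mu>)"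
proof -
  have e: "emeasure \<mu> B = ennreal (measure \<mu> B)"
    using B by (intro emeasure_eq_ennreal_measure) auto
  then have pos: "0 < measure \<mu> B"
    using B(2) by (auto simp: less_le)
  have "uniform_measure \<mu> B = density \<mu> (\<lambda>z. ennreal (indicator B z / measure \<mu> B))"
    unfolding uniform_measure_def e
    by (intro arg_cong2[where f = density] refl ext)
      (use pos divide_ennreal[of 1 "measure \<mu> B"] in \<open>simp add: indicator_def\<close>)
  then have "(\<integral>z. h z \<partial>uniform_measure \<mu> B) = (\<integral>z. indicator B z / measure \<mu> B * h z \<partial>\<mu>)"
    using B h by (simp add: integral_density)
  also have "\<dots> = (\<integral>z. indicator B z * h z / measure \<mu> B \<partial>\<mu>)"
    by simp
  also have "\<dots> = (\<integral>z. indicator B z * h z \<partial>\<mu>) / measure \<mu> B"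
    by (rule integral_divide_zero)
  finally show ?thesis using pos by simp
qed

section \<open>Resampling inside a set of finite intensity\<close>

text \<open>Both \<open>\<nu>\<close> and \<open>\<nu>'\<close> are written as configurations glued from an inner part \<open>\<xi>\<close>, \<open>\<xi>'\<close> with the law
  \<open>P\<close> of a Poisson number of moves and an outer part \<open>\<zeta>\<close>, \<open>\<zeta>'\<close>. The outer part \<open>\<zeta>'\<close> disappears by
  \<open>glue_glue\<close>, and for fixed \<open>\<zeta>\<close> the claim is the finite case for \<open>\<xi> \<mapsto> f (glue B \<xi> \<zeta>)\<close>.\<close>

lemma resampling_inequality:
  assumes \<mu>: "sigma_finite_measure \<mu>" and Q: "poisson_law \<mu> Q"
    and B: "B \<in> sets \<mu>" "emeasure \<mu> B < \<infinity>"
    and f: "bounded_measurable (N_sigma \<mu>) f" and p: "1 \<le> p" "p \<le> 2"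
  shows "(\<integral>\<^sup>+\<nu>. (\<integral>\<^sup>+\<nu>'. ennreal (\<bar>f \<nu> - f (glue B \<nu>' \<nu>)\<bar> powr p) \<partial>Q) \<partial>Q) \<le>
    ennreal (2 powr (3 - p)) *
      (\<integral>\<^sup>+z. (\<integral>\<^sup>+\<nu>. ennreal (\<bar>f (add_dirac \<nu> z) - f \<nu>\<bar> powr p) \<partial>Q) \<partial>\<mu>)"
proof -
  let ?N = "N_sigma \<mu>"
  have "prob_space Q" and sQ [measurable_cong]: "sets Q = sets ?N"
    using Q by (auto simp: poisson_law_def)
  interpret \<mu>: sigma_finite_measure \<mu> by fact
  interpret Q: prob_space Q by fact
  interpret Q\<mu>: pair_sigma_finite Q \<mu> ..
  have spQ: "space Q = space ?N" by (rule sets_eq_imp_space_eq[OF sQ])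
  have f_meas [measurable]: "f \<in> borel_measurable ?N" using f by auto
  note B(1) [measurable]
  show ?thesis
  \<comment> \<open>A null set carries no points almost surely; it is treated separately since the uniform law on it is undefined.\<close>
  proof (cases "emeasure \<mu> B = 0")
    case True
    have empty: "AE \<nu> in Q. emeasure \<nu> B = 0"
    proof -
      have m [measurable]: "(\<lambda>\<nu>. emeasure \<nu> B) \<in> borel_measurable ?N"
        by (rule measurable_emeasure_N_sigma[OF B(1)])
      have "measure Q {\<nu> \<in> space Q. emeasure \<nu> B \<noteq> 0} \<le> 0"
        using poisson_law_hitting_le[OF Q B] True by (simp add: measure_def)
      then have "emeasure Q {\<nu> \<in> space Q. emeasure \<nu> B \<noteq> 0} = 0"
        using measure_nonneg[of Q] by (simp add: Q.emeasure_eq_measure order.antisym)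
      then show ?thesis by (intro AE_I[of _ _ "{\<nu> \<in> space Q. emeasure \<nu> B \<noteq> 0}"]) auto
    qed
    have "(\<integral>\<^sup>+\<nu>. (\<integral>\<^sup>+\<nu>'. ennreal (\<bar>f \<nu> - f (glue B \<nu>' \<nu>)\<bar> powr p) \<partial>Q) \<partial>Q) = (\<integral>\<^sup>+\<nu>. 0 \<partial>Q)"
    proof (rule nn_integral_cong_AE)
      show "AE \<nu> in Q. (\<integral>\<^sup>+\<nu>'. ennreal (\<bar>f \<nu> - f (glue B \<nu>' \<nu>)\<bar> powr p) \<partial>Q) = 0"
        using empty AE_space
      proof eventually_elim
        case (elim \<nu>)
        have "(\<integral>\<^sup>+\<nu>'. ennreal (\<bar>f \<nu> - f (glue B \<nu>' \<nu>)\<bar> powr p) \<partial>Q) = (\<integral>\<^sup>+\<nu>'. 0 \<partial>Q)"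
        proof (rule nn_integral_cong_AE)
          show "AE \<nu>' in Q. ennreal (\<bar>f \<nu> - f (glue B \<nu>' \<nu>)\<bar> powr p) = 0"
            using empty AE_space
          proof eventually_elim
            case (elim \<nu>')
            have "glue B \<nu>' \<nu> = \<nu>"
              using elim \<open>emeasure \<nu> B = 0\<close> \<open>\<nu> \<in> space Q\<close> B spQ
              by (intro glue_eq_right) (auto simp: space_N_sigmaD)
            then show ?case by simp
          qed
        qed
        then show ?case by simp
      qed
    qed
    then show ?thesis by simp
  next
    case False
    define b where "b = uniform_measure \<mu> B"
    define l where "l = measure \<mu> B"
    have el: "emeasure \<mu> B = ennreal l"
      unfolding l_def using B by (intro emeasure_eq_ennreal_measure) auto
    then have l: "0 < l" using False by (auto simp: l_def less_le)
    have b: "prob_space b" "sets b = sets \<mu>"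
      unfolding b_def using B False by (auto intro!: prob_space_uniform_measure)
    interpret commuting_moves b ?N add_dirac
      by (rule commuting_moves_add_dirac[OF b])
    define P where "P = poisson_moved l (null_measure \<mu>)"
    have P: "prob_space P" and sP [measurable_cong]: "sets P = sets ?N"
      unfolding P_def by (simp_all add: prob_space_poisson_moved null_measure_in_N_sigma)
    interpret L: prob_space P by fact
    interpret PQ: pair_prob_space P Q ..
    have spP: "space P = space ?N" by (rule sets_eq_imp_space_eq[OF sP])
    have glue_law: "distr (P \<Otimes>\<^sub>M Q) ?N (\<lambda>(\<xi>, \<zeta>). glue B \<xi> \<zeta>) = Q"
    proof (rule distr_glue[OF \<mu> Q B(1) P sP])
      fix g assume "test_function \<mu> g"
      then have t: "simple_function \<mu> (\<lambda>z. g z * indicator B z)"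
        using test_function_restrict[OF _ B(1)] by (auto simp: test_function_def)
      note [measurable] = borel_measurable_simple_function[OF t]
      have "(\<integral>\<nu>. laplace (\<lambda>z. g z * indicator B z) \<nu> \<partial>P) =
          exp (- (l * (\<integral>z. 1 - exp_neg (g z * indicator B z) \<partial>b)))"
        unfolding P_def by (rule laplace_poisson_moved[OF b l t])
      also have "l * (\<integral>z. 1 - exp_neg (g z * indicator B z) \<partial>b) =
          (\<integral>z. indicator B z * (1 - exp_neg (g z * indicator B z)) \<partial>\<mu>)"
        unfolding l_def b_def using B False by (intro integral_uniform_measure) auto
      also have "\<dots> = laplace_exponent \<mu> (\<lambda>z. g z * indicator B z)"
        unfolding laplace_exponent_def
        by (intro Bochner_Integration.integral_cong) (auto simp: indicator_def)
      finally show "(\<integral>\<nu>. laplace (\<lambda>z. g z * indicator B z) \<nu> \<partial>P) =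
        exp (- laplace_exponent \<mu> (\<lambda>z. g z * indicator B z))" .
    qed
    have split: "(\<integral>\<^sup>+\<nu>. H \<nu> \<partial>Q) = (\<integral>\<^sup>+\<zeta>. (\<integral>\<^sup>+\<xi>. H (glue B \<xi> \<zeta>) \<partial>P) \<partial>Q)"
      if [measurable]: "H \<in> borel_measurable ?N" for H
    proof -
      have "(\<integral>\<^sup>+\<nu>. H \<nu> \<partial>Q) = (\<integral>\<^sup>+\<nu>. H \<nu> \<partial>distr (P \<Otimes>\<^sub>M Q) ?N (\<lambda>(\<xi>, \<zeta>). glue B \<xi> \<zeta>))"
        by (simp only: glue_law)
      also have "\<dots> = (\<integral>\<^sup>+x. H (glue B (fst x) (snd x)) \<partial>(P \<Otimes>\<^sub>M Q))"
        by (subst nn_integral_distr) (auto simp: case_prod_beta')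
      also have "\<dots> = (\<integral>\<^sup>+\<zeta>. (\<integral>\<^sup>+\<xi>. H (glue B \<xi> \<zeta>) \<partial>P) \<partial>Q)"
        by (subst PQ.nn_integral_snd[symmetric]) auto
      finally show ?thesis .
    qed
    define D where "D \<nu> = (\<integral>\<^sup>+z. ennreal (\<bar>f (add_dirac \<nu> z) - f \<nu>\<bar> powr p) \<partial>\<mu>)" for \<nu>
    have D_meas [measurable]: "D \<in> borel_measurable ?N"
      unfolding D_def by measurable
    have "(\<integral>\<^sup>+\<nu>. (\<integral>\<^sup>+\<nu>'. ennreal (\<bar>f \<nu> - f (glue B \<nu>' \<nu>)\<bar> powr p) \<partial>Q) \<partial>Q) =
        (\<integral>\<^sup>+\<zeta>. (\<integral>\<^sup>+\<xi>. (\<integral>\<^sup>+\<nu>'. ennreal (\<bar>f (glue B \<xi> \<zeta>) - f (glue B \<nu>' (glue B \<xi> \<zeta>))\<bar> powr p) \<partial>Q) \<partial>P) \<partial>Q)"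
      by (rule split) measurable
    also have "\<dots> \<le> (\<integral>\<^sup>+\<zeta>. ennreal (2 powr (3 - p)) * (\<integral>\<^sup>+\<xi>. D (glue B \<xi> \<zeta>) \<partial>P) \<partial>Q)"
    proof (rule nn_integral_mono)
      fix \<zeta> assume "\<zeta> \<in> space Q"
      then have \<zeta>: "\<zeta> \<in> space ?N" by (simp add: spQ)
      note [measurable] = measurable_const[OF \<zeta>]
      define g where "g \<xi> = f (glue B \<xi> \<zeta>)" for \<xi>
      have g: "bounded_measurable ?N g"
        unfolding g_def by (rule bounded_measurable_compose[OF f]) (use \<zeta> in measurable)
      \<comment> \<open>The outer part of the second configuration is forgotten by the gluing.\<close>
      have inner: "(\<integral>\<^sup>+\<nu>'. ennreal (\<bar>f (glue B \<xi> \<zeta>) - f (glue B \<nu>' (glue B \<xi> \<zeta>))\<bar> powr p) \<partial>Q) =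
          (\<integral>\<^sup>+\<xi>'. ennreal (\<bar>g \<xi>' - g \<xi>\<bar> powr p) \<partial>P)" if \<xi>: "\<xi> \<in> space ?N" for \<xi>
      proof -
        have glue_sp: "glue B \<xi> \<zeta> \<in> space ?N" by (rule glue_in_N_sigma[OF \<xi> \<zeta> B(1)])
        have "(\<lambda>\<nu>'. ennreal (\<bar>f (glue B \<xi> \<zeta>) - f (glue B \<nu>' (glue B \<xi> \<zeta>))\<bar> powr p)) \<in> borel_measurable ?N"
          using glue_sp by measurable
        from split[OF this] have "(\<integral>\<^sup>+\<nu>'. ennreal (\<bar>f (glue B \<xi> \<zeta>) - f (glue B \<nu>' (glue B \<xi> \<zeta>))\<bar> powr p) \<partial>Q) =
            (\<integral>\<^sup>+\<zeta>'. (\<integral>\<^sup>+\<xi>'. ennreal (\<bar>f (glue B \<xi> \<zeta>) -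
              f (glue B (glue B \<xi>' \<zeta>') (glue B \<xi> \<zeta>))\<bar> powr p) \<partial>P) \<partial>Q)" .
        also have "\<dots> = (\<integral>\<^sup>+\<zeta>'. (\<integral>\<^sup>+\<xi>'. ennreal (\<bar>g \<xi>' - g \<xi>\<bar> powr p) \<partial>P) \<partial>Q)"
        proof (intro nn_integral_cong)
          fix \<zeta>' \<xi>' assume "\<zeta>' \<in> space Q" "\<xi>' \<in> space P"
          then have "glue B (glue B \<xi>' \<zeta>') (glue B \<xi> \<zeta>) = glue B \<xi>' \<zeta>"
            using \<xi> \<zeta> B spP spQ by (intro glue_glue[of _ \<mu>]) (auto simp: space_N_sigmaD)
          then show "ennreal (\<bar>f (glue B \<xi> \<zeta>) - f (glue B (glue B \<xi>' \<zeta>') (glue B \<xi> \<zeta>))\<bar> powr p) =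
              ennreal (\<bar>g \<xi>' - g \<xi>\<bar> powr p)"
            by (simp add: g_def abs_minus_commute)
        qed
        also have "\<dots> = (\<integral>\<^sup>+\<xi>'. ennreal (\<bar>g \<xi>' - g \<xi>\<bar> powr p) \<partial>P)"
          by (simp add: Q.emeasure_space_1)
        finally show ?thesis .
      qed
      have [measurable]: "g \<in> borel_measurable ?N" using g by auto
      \<comment> \<open>Points added outside B do not change the glued configuration, so only the integral over B appears.\<close>
      have outer: "ennreal l * (\<integral>\<^sup>+z. ennreal (\<bar>g (add_dirac \<xi> z) - g \<xi>\<bar> powr p) \<partial>b) \<le> D (glue B \<xi> \<zeta>)"
        if \<xi>: "\<xi> \<in> space ?N" for \<xi>
      proof -
        have "(\<lambda>z. ennreal (\<bar>g (add_dirac \<xi> z) - g \<xi>\<bar> powr p)) \<in> borel_measurable \<mu>"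
          using \<xi> by measurable
        then have "ennreal l * (\<integral>\<^sup>+z. ennreal (\<bar>g (add_dirac \<xi> z) - g \<xi>\<bar> powr p) \<partial>b) =
            ennreal l * ((\<integral>\<^sup>+z. ennreal (\<bar>g (add_dirac \<xi> z) - g \<xi>\<bar> powr p) * indicator B z \<partial>\<mu>) / ennreal l)"
          unfolding b_def el[symmetric] using B False by (subst nn_integral_uniform_measure) auto
        also have "\<dots> = (\<integral>\<^sup>+z. ennreal (\<bar>g (add_dirac \<xi> z) - g \<xi>\<bar> powr p) * indicator B z \<partial>\<mu>)"
          by (subst ennreal_times_divide, subst mult.commute, rule ennreal_mult_divide_eq) (use l in auto)
        also have "\<dots> \<le> D (glue B \<xi> \<zeta>)"
          unfolding D_def
        proof (intro nn_integral_mono)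
          fix z assume "z \<in> space \<mu>"
          show "ennreal (\<bar>g (add_dirac \<xi> z) - g \<xi>\<bar> powr p) * indicator B z \<le>
              ennreal (\<bar>f (add_dirac (glue B \<xi> \<zeta>) z) - f (glue B \<xi> \<zeta>)\<bar> powr p)"
            using glue_add_dirac[of \<xi> \<mu> \<zeta> B z] \<xi> \<zeta> B by (auto simp: g_def indicator_def space_N_sigmaD)
        qed
        finally show ?thesis .
      qed
      have "(\<integral>\<^sup>+\<xi>. (\<integral>\<^sup>+\<nu>'. ennreal (\<bar>f (glue B \<xi> \<zeta>) - f (glue B \<nu>' (glue B \<xi> \<zeta>))\<bar> powr p) \<partial>Q) \<partial>P) =
          (\<integral>\<^sup>+\<xi>. (\<integral>\<^sup>+\<xi>'. ennreal (\<bar>g \<xi>' - g \<xi>\<bar> powr p) \<partial>P) \<partial>P)"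
        by (intro nn_integral_cong inner) (simp add: spP)
      also have "\<dots> \<le> ennreal (2 powr (3 - p)) * (ennreal l *
          (\<integral>\<^sup>+\<xi>. (\<integral>\<^sup>+z. ennreal (\<bar>g (add_dirac \<xi> z) - g \<xi>\<bar> powr p) \<partial>b) \<partial>P))"
        unfolding P_def by (rule poisson_moved_difference_nn_le[OF g p l null_measure_in_N_sigma])
      also have "ennreal l * (\<integral>\<^sup>+\<xi>. (\<integral>\<^sup>+z. ennreal (\<bar>g (add_dirac \<xi> z) - g \<xi>\<bar> powr p) \<partial>b) \<partial>P) =
          (\<integral>\<^sup>+\<xi>. ennreal l * (\<integral>\<^sup>+z. ennreal (\<bar>g (add_dirac \<xi> z) - g \<xi>\<bar> powr p) \<partial>b) \<partial>P)"
      proof (rule nn_integral_cmult[symmetric])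
        note b(2) [measurable_cong]
        show "(\<lambda>\<xi>. \<integral>\<^sup>+z. ennreal (\<bar>g (add_dirac \<xi> z) - g \<xi>\<bar> powr p) \<partial>b) \<in> borel_measurable P"
          by measurable
      qed
      also have "\<dots> \<le> (\<integral>\<^sup>+\<xi>. D (glue B \<xi> \<zeta>) \<partial>P)"
        by (intro nn_integral_mono outer) (simp add: spP)
      finally show "(\<integral>\<^sup>+\<xi>. (\<integral>\<^sup>+\<nu>'. ennreal (\<bar>f (glue B \<xi> \<zeta>) - f (glue B \<nu>' (glue B \<xi> \<zeta>))\<bar> powr p) \<partial>Q) \<partial>P) \<le>
          ennreal (2 powr (3 - p)) * (\<integral>\<^sup>+\<xi>. D (glue B \<xi> \<zeta>) \<partial>P)"
        by (simp add: mult_left_mono)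
    qed
    also have "\<dots> = ennreal (2 powr (3 - p)) * (\<integral>\<^sup>+\<zeta>. (\<integral>\<^sup>+\<xi>. D (glue B \<xi> \<zeta>) \<partial>P) \<partial>Q)"
      by (rule nn_integral_cmult) measurable
    also have "(\<integral>\<^sup>+\<zeta>. (\<integral>\<^sup>+\<xi>. D (glue B \<xi> \<zeta>) \<partial>P) \<partial>Q) = (\<integral>\<^sup>+\<nu>. D \<nu> \<partial>Q)"
      by (rule split[OF D_meas, symmetric])
    also have "\<dots> = (\<integral>\<^sup>+z. (\<integral>\<^sup>+\<nu>. ennreal (\<bar>f (add_dirac \<nu> z) - f \<nu>\<bar> powr p) \<partial>Q) \<partial>\<mu>)"
      unfolding D_def by (rule Q\<mu>.Fubini'[symmetric]) measurable
    finally show ?thesis .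
  qed
qed

section \<open>Exhausting the space\<close>

lemma (in sigma_finite_measure) distr_pair_snd:
  assumes "prob_space N"
  shows "distr (N \<Otimes>\<^sub>M M) M snd = M"
proof (intro measure_eqI)
  interpret N: prob_space N by fact
  fix A assume A: "A \<in> sets (distr (N \<Otimes>\<^sub>M M) M snd)"
  then have "emeasure (distr (N \<Otimes>\<^sub>M M) M snd) A = emeasure (N \<Otimes>\<^sub>M M) (space N \<times> A)"
    by (auto simp add: emeasure_distr space_pair_measure dest: sets.sets_into_space
      intro!: arg_cong2[where f = emeasure])
  with A show "emeasure (distr (N \<Otimes>\<^sub>M M) M snd) A = emeasure M A"
    by (simp add: emeasure_pair_measure_Times N.emeasure_space_1)
qed simp

text \<open>Replacing an independent copy outside \<open>B n\<close> by the original has asymptotically no effect. For the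
  event that a set \<open>A\<close> of finite intensity has \<open>k\<close> points, this holds because neither configuration
  is likely to have points in \<open>A - B n\<close>. The functions with this property are closed under
  \<open>L1\<close>-limits, uniformly in \<open>n\<close>, because the glued configuration has the same law \<open>Q\<close> as its
  ingredients. Hence the property passes to all events and then to all integrable functions.\<close>

lemma glue_tendsto_L1:
  assumes \<mu>: "sigma_finite_measure \<mu>" and Q: "poisson_law \<mu> Q"
    and B: "range B \<subseteq> sets \<mu>" "incseq B" "(\<Union>n. B n) = space \<mu>"
    and h: "integrable Q h"
  shows "(\<lambda>n. \<integral>x. \<bar>h (glue (B n) (fst x) (snd x)) - h (fst x)\<bar> \<partial>(Q \<Otimes>\<^sub>M Q)) \<longlonglongrightarrow> (0::real)"
proof -
  let ?N = "N_sigma \<mu>" and ?R = "Q \<Otimes>\<^sub>M Q"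
  have "prob_space Q" and sQ [measurable_cong]: "sets Q = sets ?N"
    using Q by (auto simp: poisson_law_def)
  interpret Q: prob_space Q by fact
  interpret R: pair_prob_space Q Q ..
  have spQ: "space Q = space ?N" by (rule sets_eq_imp_space_eq[OF sQ])
  have B_meas [measurable]: "B n \<in> sets \<mu>" for n using B(1) by auto
  define Y where "Y n x = glue (B n) (fst x) (snd x)" for n and x :: "'a measure \<times> 'a measure"
  have Y_meas [measurable]: "Y n \<in> ?R \<rightarrow>\<^sub>M Q" for n
    unfolding Y_def measurable_cong_sets[OF refl sQ] by measurable
  have Y_law: "distr ?R Q (Y n) = Q" for n
  proof -
    have "distr ?R Q (Y n) = distr ?R ?N (\<lambda>(\<xi>, \<zeta>). glue (B n) \<xi> \<zeta>)"
      by (rule distr_cong) (auto simp: Y_def sQ)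
    also have "\<dots> = Q"
      using Q test_function_restrict[OF _ B_meas]
      by (intro distr_glue[OF \<mu> Q B_meas Q.prob_space_axioms sQ]) (auto simp: poisson_law_def)
    finally show ?thesis .
  qed
  have fst_law: "distr ?R Q fst = Q" by (rule Q.distr_pair_fst)
  have transfer: "integrable ?R (\<lambda>x. k (T x))" "(\<integral>x. k (T x) \<partial>?R) = (\<integral>\<nu>. k \<nu> \<partial>Q)"
    if "integrable Q k" "T \<in> ?R \<rightarrow>\<^sub>M Q" "distr ?R Q T = Q"
    for k :: "'a measure \<Rightarrow> real" and T
    using that integrable_distr_eq[of T ?R Q k] integral_distr[of T ?R Q k] by auto
  define I where "I k n = (\<integral>x. \<bar>k (Y n x) - k (fst x)\<bar> \<partial>?R)" for k :: "'a measure \<Rightarrow> real" and n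
  have I_int: "integrable ?R (\<lambda>x. \<bar>k (Y n x) - k (fst x)\<bar>)" if "integrable Q k"
    for k :: "'a measure \<Rightarrow> real" and n
    using transfer(1)[OF that Y_meas Y_law] transfer(1)[OF that measurable_fst fst_law] by simp
  have I_nonneg: "0 \<le> I k n" for k n by (simp add: I_def)
  \<comment> \<open>The bound does not depend on n because both arguments of k have the law Q.\<close>
  have I_approx: "I k n \<le> I k' n + 2 * (\<integral>\<nu>. \<bar>k \<nu> - k' \<nu>\<bar> \<partial>Q)"
    if k: "integrable Q k" and k': "integrable Q k'" for k k' :: "'a measure \<Rightarrow> real" and n
  proof -
    have d: "integrable Q (\<lambda>\<nu>. \<bar>k \<nu> - k' \<nu>\<bar>)" using k k' by simp
    note tY = transfer[OF d Y_meas Y_law] and tf = transfer[OF d measurable_fst fst_law]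
    have "I k n \<le> (\<integral>x. \<bar>k' (Y n x) - k' (fst x)\<bar> + \<bar>k (Y n x) - k' (Y n x)\<bar> + \<bar>k (fst x) - k' (fst x)\<bar> \<partial>?R)"
      unfolding I_def by (intro integral_mono I_int k Bochner_Integration.integrable_add k' tY tf) linarith
    also have "\<dots> = I k' n + (\<integral>x. \<bar>k (Y n x) - k' (Y n x)\<bar> \<partial>?R) + (\<integral>x. \<bar>k (fst x) - k' (fst x)\<bar> \<partial>?R)"
      using I_int[OF k'] tY(1) tf(1) by (simp add: I_def)
    also have "\<dots> = I k' n + 2 * (\<integral>\<nu>. \<bar>k \<nu> - k' \<nu>\<bar> \<partial>Q)"
      by (simp add: tY(2) tf(2))
    finally show ?thesis .
  qed
  have I_lim: "I k \<longlonglongrightarrow> 0"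
    if k: "integrable Q k" and s: "\<And>i. integrable Q (s i)" "\<And>i. I (s i) \<longlonglongrightarrow> 0"
      and lim: "(\<lambda>i. \<integral>\<nu>. \<bar>k \<nu> - s i \<nu>\<bar> \<partial>Q) \<longlonglongrightarrow> 0" for k and s :: "nat \<Rightarrow> _"
  proof (rule LIMSEQ_I)
    fix e :: real assume e: "0 < e"
    have "eventually (\<lambda>i. (\<integral>\<nu>. \<bar>k \<nu> - s i \<nu>\<bar> \<partial>Q) < e / 4) sequentially"
      using order_tendstoD(2)[OF lim, of "e / 4"] e by simp
    then obtain i where i: "(\<integral>\<nu>. \<bar>k \<nu> - s i \<nu>\<bar> \<partial>Q) < e / 4"
      by (auto simp: eventually_sequentially)
    have "eventually (\<lambda>n. I (s i) n < e / 2) sequentially"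
      using order_tendstoD(2)[OF s(2), of "e / 2"] e by simp
    then obtain n0 where n0: "\<And>n. n \<ge> n0 \<Longrightarrow> I (s i) n < e / 2"
      by (auto simp: eventually_sequentially)
    have "norm (I k n - 0) < e" if "n \<ge> n0" for n
      using I_approx[OF k s(1), of n i] n0[OF that] i I_nonneg[of k n] by simp
    then show "\<exists>n0. \<forall>n\<ge>n0. norm (I k n - 0) < e" by blast
  qed
  have I_le: "I k \<longlonglongrightarrow> 0" if "\<And>n. I k n \<le> u n" "u \<longlonglongrightarrow> 0" for k u
    by (rule tendsto_sandwich[OF _ _ tendsto_const that(2)]) (auto simp: I_nonneg that(1))
  have int_ind: "integrable Q (indicator C :: _ \<Rightarrow> real)" if "C \<in> sets Q" for C
    using that by (intro integrable_real_indicator) (auto simp: Q.emeasure_finite top.not_eq_extremum[symmetric])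
  \<comment> \<open>The counts of A agree unless one of the two configurations has points in \<open>A - B n\<close>.\<close>
  have count_set: "I (indicator {\<nu> \<in> space ?N. emeasure \<nu> A = of_nat k}) \<longlonglongrightarrow> 0"
    if A: "A \<in> sets \<mu>" "emeasure \<mu> A < \<infinity>" for A and k :: nat
  proof (rule I_le)
    define C where "C = {\<nu> \<in> space ?N. emeasure \<nu> A = of_nat k}"
    define E where "E n = {\<nu> \<in> space Q. emeasure \<nu> (A - B n) \<noteq> 0}" for n
    have m [measurable]: "(\<lambda>\<nu>. emeasure \<nu> A) \<in> borel_measurable ?N" "(\<lambda>\<nu>. emeasure \<nu> (A - B n)) \<in> borel_measurable ?N" for n
      using A by (auto intro!: measurable_emeasure_N_sigma)
    have fin: "emeasure \<mu> (A - B n) < \<infinity>" for n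
      using A(2) emeasure_mono[of "A - B n" A \<mu>] A(1) by (auto simp: le_less_trans)
    have E: "E n \<in> sets Q" for n unfolding E_def by measurable
    have C: "C \<in> sets Q" unfolding C_def sQ by measurable
    have "(\<lambda>n. measure \<mu> (A - B n)) \<longlonglongrightarrow> measure \<mu> (\<Inter>n. A - B n)"
    proof (rule Lim_measure_decseq)
      show "range (\<lambda>n. A - B n) \<subseteq> sets \<mu>" using A by auto
      show "decseq (\<lambda>n. A - B n)" using B(2) by (auto simp: decseq_def incseq_def)
      show "emeasure \<mu> (A - B n) \<noteq> \<infinity>" for n using fin[of n] by auto
    qed
    also have "(\<Inter>n. A - B n) = {}"
      using sets.sets_into_space[OF A(1)] B(3) by auto
    finally have "(\<lambda>n. 2 * measure \<mu> (A - B n)) \<longlonglongrightarrow> 2 * 0"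
      by (intro tendsto_intros) simp
    then show "(\<lambda>n. 2 * measure \<mu> (A - B n)) \<longlonglongrightarrow> 0" by simp
    fix n
    have snd_law: "distr ?R Q snd = Q"
      by (rule Q.distr_pair_snd) (rule Q.prob_space_axioms)
    note tf = transfer[OF int_ind[OF E] measurable_fst fst_law]
      and ts = transfer[OF int_ind[OF E] measurable_snd snd_law]
    have "I (indicator C) n \<le> (\<integral>x. indicator (E n) (fst x) + indicator (E n) (snd x) \<partial>?R)"
      unfolding I_def
    proof (intro integral_mono I_int int_ind C Bochner_Integration.integrable_add tf ts)
      fix x assume "x \<in> space ?R"
      then obtain \<xi> \<zeta> where x: "x = (\<xi>, \<zeta>)" "\<xi> \<in> space ?N" "\<zeta> \<in> space ?N"
        by (auto simp: space_pair_measure spQ)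
      show "\<bar>indicator C (Y n x) - indicator C (fst x)\<bar> \<le> (indicator (E n) (fst x) + indicator (E n) (snd x) :: real)"
      proof (cases "\<xi> \<in> E n \<or> \<zeta> \<in> E n")
        case True
        then show ?thesis by (auto simp: x indicator_def)
      next
        case False
        then have 0: "emeasure \<xi> (A - B n) = 0" "emeasure \<zeta> (A - B n) = 0"
          using x by (auto simp: E_def spQ)
        have "emeasure \<xi> A = emeasure \<xi> (A \<inter> B n) + emeasure \<xi> (A - B n)"
          using A B_meas[of n] space_N_sigmaD(1)[OF x(2)]
          by (subst plus_emeasure) (auto intro!: arg_cong2[where f = emeasure])
        moreover have "emeasure (Y n x) A = emeasure \<xi> (A \<inter> B n) + emeasure \<zeta> (A - B n)"
          using A B_meas[of n] space_N_sigmaD(1)[OF x(2)] space_N_sigmaD(1)[OF x(3)]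
          by (simp add: Y_def x emeasure_glue)
        ultimately have "emeasure (Y n x) A = emeasure \<xi> A" using 0 by simp
        moreover have "Y n x \<in> space ?N"
          using x B_meas by (simp add: Y_def glue_in_N_sigma)
        ultimately show ?thesis using x by (simp add: C_def indicator_def)
      qed
    qed
    also have "\<dots> = 2 * measure Q (E n)"
      using tf ts E[of n] by simp
    also have "\<dots> \<le> 2 * measure \<mu> (A - B n)"
      using poisson_law_hitting_le[OF Q _ fin, of n] A by (simp add: E_def)
    finally show "I (indicator {\<nu> \<in> space ?N. emeasure \<nu> A = of_nat k}) n \<le> 2 * measure \<mu> (A - B n)"
      unfolding C_def .
  qed
  \<comment> \<open>Finite unions come first; countable ones are their limits in L1.\<close>
  have ind_Un: "I (indicator (C \<union> D)) \<longlonglongrightarrow> 0"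
    if "C \<in> sets Q" "D \<in> sets Q" "I (indicator C) \<longlonglongrightarrow> 0" "I (indicator D) \<longlonglongrightarrow> 0" for C D
  proof (rule I_le)
    show "(\<lambda>n. I (indicator C) n + I (indicator D) n) \<longlonglongrightarrow> 0"
      using tendsto_add[OF that(3,4)] by simp
    fix n
    have "I (indicator (C \<union> D)) n \<le>
        (\<integral>x. \<bar>indicator C (Y n x) - indicator C (fst x)\<bar> + \<bar>indicator D (Y n x) - indicator D (fst x)\<bar> \<partial>?R)"
      unfolding I_def
      by (intro integral_mono I_int int_ind sets.Un that Bochner_Integration.integrable_add)
        (auto simp: indicator_def)
    also have "\<dots> = I (indicator C) n + I (indicator D) n"
      using I_int[OF int_ind] that by (simp add: I_def)
    finally show "I (indicator (C \<union> D)) n \<le> I (indicator C) n + I (indicator D) n" .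
  qed
  have ind: "I (indicator C) \<longlonglongrightarrow> 0" if "C \<in> sets Q" for C
  proof -
    have "C \<in> sigma_sets (space ?N) {{\<nu> \<in> space ?N. emeasure \<nu> A = of_nat k} | A k. A \<in> sets \<mu> \<and> emeasure \<mu> A < \<infinity>}"
      using that sets_N_sigma_counts[OF \<mu>] sQ by simp
    then show ?thesis
    proof (induction rule: sigma_sets.induct)
      case (Basic C)
      then show ?case using count_set by blast
    next
      case Empty
      then show ?case by (simp add: I_def)
    next
      case (Compl C)
      have "I (indicator (space ?N - C)) n = I (indicator C) n" for n
        unfolding I_def
      proof (intro Bochner_Integration.integral_cong refl)
        fix x assume x: "x \<in> space ?R"
        have "Y n x \<in> space ?N" "fst x \<in> space ?N"
          using measurable_space[OF Y_meas x] x by (auto simp: space_pair_measure spQ)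
        then show "\<bar>indicator (space ?N - C) (Y n x) - indicator (space ?N - C) (fst x)\<bar> =
            (\<bar>indicator C (Y n x) - indicator C (fst x)\<bar> :: real)"
          by (auto simp: indicator_def)
      qed
      then show ?case using Compl by simp
    next
      case (Union C)
      have C: "C i \<in> sets Q" for i
        using Union(1) sets_N_sigma_counts[OF \<mu>] sQ by simp
      have fin: "I (indicator (\<Union>i<m. C i)) \<longlonglongrightarrow> 0" for m
      proof (induction m)
        case 0
        then show ?case by (simp add: I_def)
      next
        case (Suc m)
        then show ?case
          using ind_Un[of "\<Union>i<m. C i" "C m"] C Union by (simp add: lessThan_Suc Un_commute)
      qed
      show ?case
      proof (rule I_lim)
        show "integrable Q (indicator (\<Union>i. C i) :: _ \<Rightarrow> real)" using C by (intro int_ind) auto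
        show "integrable Q (indicator (\<Union>i<m. C i) :: _ \<Rightarrow> real)" for m using C by (intro int_ind) auto
        have "(\<lambda>m. \<integral>\<nu>. \<bar>indicator (\<Union>i. C i) \<nu> - indicator (\<Union>i<m. C i) \<nu>\<bar> \<partial>Q) \<longlonglongrightarrow> (\<integral>\<nu>. (0::real) \<partial>Q)"
        proof (rule integral_dominated_convergence[where w = "\<lambda>_. 1"])
          show "AE \<nu> in Q. (\<lambda>m. \<bar>indicator (\<Union>i. C i) \<nu> - indicator (\<Union>i<m. C i) \<nu>\<bar>) \<longlonglongrightarrow> (0::real)"
          proof (intro AE_I2)
            fix \<nu>
            have "(\<lambda>m. indicator (\<Union>i<m. C i) \<nu> :: real) \<longlonglongrightarrow> indicator (\<Union>i. C i) \<nu>"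
              by (rule LIMSEQ_indicator_UN)
            from tendsto_rabs[OF tendsto_diff[OF tendsto_const[of "indicator (\<Union>i. C i) \<nu>"] this]]
            show "(\<lambda>m. \<bar>indicator (\<Union>i. C i) \<nu> - indicator (\<Union>i<m. C i) \<nu>\<bar>) \<longlonglongrightarrow> (0::real)"
              by simp
          qed
          show "(\<lambda>\<nu>. \<bar>indicator (\<Union>i. C i) \<nu> - indicator (\<Union>i<m. C i) \<nu>\<bar> :: real) \<in> borel_measurable Q" for m
            using C by measurable
        qed (auto simp: indicator_def)
        then show "(\<lambda>m. \<integral>\<nu>. \<bar>indicator (\<Union>i. C i) \<nu> - indicator (\<Union>i<m. C i) \<nu>\<bar> \<partial>Q) \<longlonglongrightarrow> (0::real)"
          by simp
      qed (rule fin)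
    qed
  qed
  have "I h \<longlonglongrightarrow> 0"
    using h
  proof (induction rule: integrable_induct)
    case (base A c)
    have "I (\<lambda>x. indicator A x *\<^sub>R c) n = I (indicator A) n * \<bar>c\<bar>" for n
      by (simp add: I_def left_diff_distrib[symmetric] abs_mult)
    moreover have "(\<lambda>n. I (indicator A) n * \<bar>c\<bar>) \<longlonglongrightarrow> 0 * \<bar>c\<bar>"
      by (intro tendsto_intros ind base)
    ultimately show ?case by simp
  next
    case (add f g)
    show ?case
    proof (rule I_le)
      show "(\<lambda>n. I f n + I g n) \<longlonglongrightarrow> 0"
        using tendsto_add[OF add.IH] by simp
      fix n
      have "I (\<lambda>x. f x + g x) n \<le> (\<integral>x. \<bar>f (Y n x) - f (fst x)\<bar> + \<bar>g (Y n x) - g (fst x)\<bar> \<partial>?R)"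
        unfolding I_def
        by (intro integral_mono I_int Bochner_Integration.integrable_add add) linarith
      also have "\<dots> = I f n + I g n"
        using I_int add by (simp add: I_def)
      finally show "I (\<lambda>x. f x + g x) n \<le> I f n + I g n" .
    qed
  next
    case (lim f s)
    show ?case
    proof (rule I_lim)
      have "(\<lambda>i. \<integral>\<nu>. \<bar>f \<nu> - s i \<nu>\<bar> \<partial>Q) \<longlonglongrightarrow> (\<integral>\<nu>. (0::real) \<partial>Q)"
      proof (rule integral_dominated_convergence[where w = "\<lambda>\<nu>. 3 * \<bar>f \<nu>\<bar>"])
        show "AE \<nu> in Q. (\<lambda>i. \<bar>f \<nu> - s i \<nu>\<bar>) \<longlonglongrightarrow> 0"
        proof (intro AE_I2)
          fix \<nu> assume "\<nu> \<in> space Q"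
          from tendsto_rabs[OF tendsto_diff[OF tendsto_const[of "f \<nu>"] lim(2)[OF this]]]
          show "(\<lambda>i. \<bar>f \<nu> - s i \<nu>\<bar>) \<longlonglongrightarrow> 0" by simp
        qed
        show "AE \<nu> in Q. norm \<bar>f \<nu> - s i \<nu>\<bar> \<le> 3 * \<bar>f \<nu>\<bar>" for i
        proof (intro AE_I2)
          fix \<nu> assume "\<nu> \<in> space Q"
          from lim(3)[OF this, of i] show "norm \<bar>f \<nu> - s i \<nu>\<bar> \<le> 3 * \<bar>f \<nu>\<bar>" by simp
        qed
      qed (use lim in \<open>auto intro!: borel_measurable_integrable\<close>)
      then show "(\<lambda>i. \<integral>\<nu>. \<bar>f \<nu> - s i \<nu>\<bar> \<partial>Q) \<longlonglongrightarrow> 0" by simp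
    qed (use lim in auto)
  qed
  then show ?thesis unfolding I_def Y_def .
qed

section \<open>The inequality on the whole space\<close>

text \<open>Along a subsequence of an exhaustion, the resampled configurations converge almost surely under
  \<open>f\<close>, so Fatou's lemma applies to the resampling inequalities.\<close>

lemma poisson_law_difference_le_bounded:
  assumes \<mu>: "sigma_finite_measure \<mu>" and Q: "poisson_law \<mu> Q"
    and f: "bounded_measurable (N_sigma \<mu>) f" and p: "1 \<le> p" "p \<le> 2"
  shows "(\<integral>\<^sup>+x. ennreal (\<bar>f (snd x) - f (fst x)\<bar> powr p) \<partial>(Q \<Otimes>\<^sub>M Q)) \<le>
    ennreal (2 powr (3 - p)) *
      (\<integral>\<^sup>+z. (\<integral>\<^sup>+\<nu>. ennreal (\<bar>f (add_dirac \<nu> z) - f \<nu>\<bar> powr p) \<partial>Q) \<partial>\<mu>)" (is "_ \<le> ?C")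
proof -
  let ?N = "N_sigma \<mu>" and ?R = "Q \<Otimes>\<^sub>M Q"
  have "prob_space Q" and sQ [measurable_cong]: "sets Q = sets ?N"
    using Q by (auto simp: poisson_law_def)
  interpret \<mu>: sigma_finite_measure \<mu> by fact
  interpret Q: prob_space Q by fact
  interpret R: pair_prob_space Q Q ..
  have spQ: "space Q = space ?N" by (rule sets_eq_imp_space_eq[OF sQ])
  have fm [measurable]: "f \<in> borel_measurable ?N" using f by auto
  have fQ: "bounded_measurable Q f"
    using f by (simp add: bounded_measurable_def spQ cong: measurable_cong_sets)
  obtain B :: "nat \<Rightarrow> _" where B: "range B \<subseteq> sets \<mu>" "(\<Union>n. B n) = space \<mu>"
    "\<And>n. emeasure \<mu> (B n) \<noteq> \<infinity>" "incseq B"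
    using \<mu>.sigma_finite_incseq by blast
  have Bm [measurable]: "B n \<in> sets \<mu>" for n using B(1) by auto
  define Y where "Y n x = glue (B n) (fst x) (snd x)" for n and x :: "'a measure \<times> 'a measure"
  have Ym [measurable]: "Y n \<in> ?R \<rightarrow>\<^sub>M Q" for n
    unfolding Y_def measurable_cong_sets[OF refl sQ] by measurable
  have fY [measurable]: "(\<lambda>x. f (Y n x)) \<in> borel_measurable ?R" for n
    by (rule measurable_compose[OF Ym bounded_measurableD[OF fQ]])
  have L1: "(\<lambda>n. \<integral>x. norm (f (Y n x) - f (fst x)) \<partial>?R) \<longlonglongrightarrow> 0"
    using glue_tendsto_L1[OF \<mu> Q B(1,4,2) Q.integrable_bounded_measurable[OF fQ]]
    by (simp add: Y_def)
  have int: "integrable ?R (\<lambda>x. f (Y n x) - f (fst x))" for n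
    by (intro R.integrable_bounded_measurable bounded_measurable_diff bounded_measurable_compose[OF fQ]) simp_all
  obtain r :: "nat \<Rightarrow> nat" where r: "AE x in ?R. (\<lambda>n. f (Y (r n) x) - f (fst x)) \<longlonglongrightarrow> 0"
    using tendsto_L1_AE_subseq[OF int L1] by blast
  have bound: "(\<integral>\<^sup>+x. ennreal (\<bar>f (snd x) - f (Y n x)\<bar> powr p) \<partial>?R) \<le> ?C" for n
  proof -
    have "(\<integral>\<^sup>+x. ennreal (\<bar>f (snd x) - f (Y n x)\<bar> powr p) \<partial>?R) =
        (\<integral>\<^sup>+\<nu>. (\<integral>\<^sup>+\<nu>'. ennreal (\<bar>f \<nu> - f (glue (B n) \<nu>' \<nu>)\<bar> powr p) \<partial>Q) \<partial>Q)"
      unfolding Y_def by (subst R.nn_integral_snd[symmetric]) auto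
    also have "\<dots> \<le> ?C"
      by (rule resampling_inequality[OF \<mu> Q Bm _ f p]) (use B(3)[of n] in \<open>auto simp: less_top\<close>)
    finally show ?thesis .
  qed
  have "(\<integral>\<^sup>+x. ennreal (\<bar>f (snd x) - f (fst x)\<bar> powr p) \<partial>?R) =
      (\<integral>\<^sup>+x. liminf (\<lambda>n. ennreal (\<bar>f (snd x) - f (Y (r n) x)\<bar> powr p)) \<partial>?R)"
  proof (rule nn_integral_cong_AE)
    show "AE x in ?R. ennreal (\<bar>f (snd x) - f (fst x)\<bar> powr p) =
        liminf (\<lambda>n. ennreal (\<bar>f (snd x) - f (Y (r n) x)\<bar> powr p))"
      using r
    proof eventually_elim
      case (elim x)
      from tendsto_diff[OF tendsto_const[of "f (snd x) - f (fst x)"] elim]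
      have "(\<lambda>n. f (snd x) - f (Y (r n) x)) \<longlonglongrightarrow> f (snd x) - f (fst x)" by simp
      then have "(\<lambda>n. \<bar>f (snd x) - f (Y (r n) x)\<bar> powr p) \<longlonglongrightarrow> \<bar>f (snd x) - f (fst x)\<bar> powr p"
        by (intro tendsto_powr2 tendsto_rabs tendsto_const) (use p in auto)
      then have "(\<lambda>n. ennreal (\<bar>f (snd x) - f (Y (r n) x)\<bar> powr p)) \<longlonglongrightarrow>
          ennreal (\<bar>f (snd x) - f (fst x)\<bar> powr p)"
        by (rule tendsto_ennrealI)
      from lim_imp_Liminf[OF _ this] show ?case by simp
    qed
  qed
  also have "\<dots> \<le> liminf (\<lambda>n. \<integral>\<^sup>+x. ennreal (\<bar>f (snd x) - f (Y (r n) x)\<bar> powr p) \<partial>?R)"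
    by (rule nn_integral_liminf) measurable
  also have "\<dots> \<le> liminf (\<lambda>n::nat. ?C)"
    by (intro Liminf_mono always_eventually allI bound)
  also have "\<dots> = ?C" by (simp add: Liminf_const)
  finally show ?thesis .
qed

lemma clamp_difference_le: "\<bar>max (- K) (min K a) - max (- K) (min K b)\<bar> \<le> \<bar>a - b\<bar>" for a b K :: real
  by (auto simp: max_def min_def)

lemma poisson_law_difference_le:
  assumes \<mu>: "sigma_finite_measure \<mu>" and Q: "poisson_law \<mu> Q"
    and f [measurable]: "f \<in> borel_measurable (N_sigma \<mu>)" and p: "1 \<le> p" "p \<le> 2"
  shows "(\<integral>\<^sup>+x. ennreal (\<bar>f (snd x) - f (fst x)\<bar> powr p) \<partial>(Q \<Otimes>\<^sub>M Q)) \<le>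
    ennreal (2 powr (3 - p)) *
      (\<integral>\<^sup>+z. (\<integral>\<^sup>+\<nu>. ennreal (\<bar>f (add_dirac \<nu> z) - f \<nu>\<bar> powr p) \<partial>Q) \<partial>\<mu>)" (is "_ \<le> ?C")
proof -
  let ?R = "Q \<Otimes>\<^sub>M Q"
  have sQ [measurable_cong]: "sets Q = sets (N_sigma \<mu>)"
    using Q by (auto simp: poisson_law_def)
  define c where "c K \<nu> = max (- real K) (min (real K) (f \<nu>))" for K \<nu>
  have c [measurable]: "c K \<in> borel_measurable (N_sigma \<mu>)" for K unfolding c_def by measurable
  have c_bdd: "bounded_measurable (N_sigma \<mu>) (c K)" for K
    by (rule bounded_measurableI[OF c, of _ "real K"]) (auto simp: c_def)
  have c_le: "ennreal (\<bar>c K \<nu> - c K \<nu>'\<bar> powr p) \<le> ennreal (\<bar>f \<nu> - f \<nu>'\<bar> powr p)" for K \<nu> \<nu>'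
    unfolding c_def using p by (intro ennreal_leI powr_mono2 clamp_difference_le) auto
  have bound: "(\<integral>\<^sup>+x. ennreal (\<bar>c K (snd x) - c K (fst x)\<bar> powr p) \<partial>?R) \<le> ?C" for K
    by (rule order_trans[OF poisson_law_difference_le_bounded[OF \<mu> Q c_bdd p]])
      (intro mult_left_mono nn_integral_mono c_le, simp)
  have "(\<integral>\<^sup>+x. ennreal (\<bar>f (snd x) - f (fst x)\<bar> powr p) \<partial>?R) =
      (\<integral>\<^sup>+x. liminf (\<lambda>K. ennreal (\<bar>c K (snd x) - c K (fst x)\<bar> powr p)) \<partial>?R)"
  proof (rule nn_integral_cong)
    fix x
    obtain k where k: "\<bar>f (snd x)\<bar> + \<bar>f (fst x)\<bar> \<le> real k"
      using real_arch_simple by blast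
    have "eventually (\<lambda>K. ennreal (\<bar>c K (snd x) - c K (fst x)\<bar> powr p) =
        ennreal (\<bar>f (snd x) - f (fst x)\<bar> powr p)) sequentially"
      using eventually_ge_at_top[of k]
    proof eventually_elim
      case (elim K)
      then have "real k \<le> real K" by simp
      then have "c K (snd x) = f (snd x)" "c K (fst x) = f (fst x)"
        using k by (auto simp: c_def max_def min_def)
      then show ?case by simp
    qed
    from lim_imp_Liminf[OF _ tendsto_eventually[OF this]]
    show "ennreal (\<bar>f (snd x) - f (fst x)\<bar> powr p) =
        liminf (\<lambda>K. ennreal (\<bar>c K (snd x) - c K (fst x)\<bar> powr p))" by simp
  qed
  also have "\<dots> \<le> liminf (\<lambda>K. \<integral>\<^sup>+x. ennreal (\<bar>c K (snd x) - c K (fst x)\<bar> powr p) \<partial>?R)"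
    by (rule nn_integral_liminf) measurable
  also have "\<dots> \<le> liminf (\<lambda>K::nat. ?C)"
    by (intro Liminf_mono always_eventually allI bound)
  also have "\<dots> = ?C" by (simp add: Liminf_const)
  finally show ?thesis .
qed

text \<open>The joint law of \<open>F\<close> and its copy is the product of the law of \<open>F\<close> with itself, whatever the
  enlarged space is; so the product of \<open>M\<close> with itself may be used instead.\<close>

lemma (in prob_space) independent_copy_nn_integral:
  assumes copy: "independent_copy M F M' \<pi> F'" and F [measurable]: "F \<in> borel_measurable M"
    and k [measurable]: "(\<lambda>(x, y). k x y) \<in> borel_measurable (borel \<Otimes>\<^sub>M borel)"
  shows "(\<integral>\<^sup>+\<omega>. k (F (\<pi> \<omega>)) (F' \<omega>) \<partial>M') = (\<integral>\<^sup>+x. k (F (fst x)) (F (snd x)) \<partial>(M \<Otimes>\<^sub>M M))"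
proof -
  interpret M': prob_space M' using copy by (simp add: independent_copy_def)
  interpret MM: pair_prob_space M M ..
  have \<pi> [measurable]: "\<pi> \<in> M' \<rightarrow>\<^sub>M M" and d\<pi>: "distr M' M \<pi> = M" and F' [measurable]: "F' \<in> borel_measurable M'"
    and ind: "M'.indep_var borel (F \<circ> \<pi>) borel F'" and dF': "distr M' borel F' = distr M borel F"
    using copy by (auto simp: independent_copy_def)
  have "distr M' borel (F \<circ> \<pi>) = distr M borel F"
    using distr_distr[OF F \<pi>] by (simp only: d\<pi>)
  then have joint: "distr M borel F \<Otimes>\<^sub>M distr M borel F =
      distr M' (borel \<Otimes>\<^sub>M borel) (\<lambda>\<omega>. ((F \<circ> \<pi>) \<omega>, F' \<omega>))"
    using ind dF' by (simp add: M'.indep_var_distribution_eq)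
  interpret D: prob_space "distr M borel F" by (rule prob_space_distr) simp
  interpret DM: pair_prob_space "distr M borel F" "distr M borel F" ..
  have "(\<integral>\<^sup>+\<omega>. k (F (\<pi> \<omega>)) (F' \<omega>) \<partial>M') =
      (\<integral>\<^sup>+x. (case x of (x, y) \<Rightarrow> k x y) \<partial>distr M' (borel \<Otimes>\<^sub>M borel) (\<lambda>\<omega>. ((F \<circ> \<pi>) \<omega>, F' \<omega>)))"
    by (subst nn_integral_distr) (auto simp: comp_def)
  also have "\<dots> = (\<integral>\<^sup>+x. (case x of (x, y) \<Rightarrow> k x y) \<partial>(distr M borel F \<Otimes>\<^sub>M distr M borel F))"
    by (simp only: joint)
  also have "distr M borel F \<Otimes>\<^sub>M distr M borel F =
      distr (M \<Otimes>\<^sub>M M) (borel \<Otimes>\<^sub>M borel) (\<lambda>(x, y). (F x, F y))"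
    by (rule pair_measure_distr[OF F F D.sigma_finite_measure_axioms])
  also have "(\<integral>\<^sup>+x. (case x of (x, y) \<Rightarrow> k x y) \<partial>distr (M \<Otimes>\<^sub>M M) (borel \<Otimes>\<^sub>M borel) (\<lambda>(x, y). (F x, F y))) =
      (\<integral>\<^sup>+x. k (F (fst x)) (F (snd x)) \<partial>(M \<Otimes>\<^sub>M M))"
    by (subst nn_integral_distr) (auto simp: case_prod_beta')
  finally show ?thesis .
qed

text \<open>By Fubini's theorem the difference to some fixed value \<open>F c\<close> has a finite moment of order \<open>p\<close>.\<close>

lemma (in prob_space) integrable_abs_powr_of_difference:
  assumes F [measurable]: "F \<in> borel_measurable M" and p: "0 \<le> p"
    and fin: "(\<integral>\<^sup>+x. ennreal (\<bar>F (snd x) - F (fst x)\<bar> powr p) \<partial>(M \<Otimes>\<^sub>M M)) < \<infinity>"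
  shows "integrable M (\<lambda>\<omega>. \<bar>F \<omega>\<bar> powr p)"
proof -
  interpret MM: pair_prob_space M M ..
  define I where "I c = (\<integral>\<^sup>+\<omega>. ennreal (\<bar>F \<omega> - F c\<bar> powr p) \<partial>M)" for c
  have I [measurable]: "I \<in> borel_measurable M" unfolding I_def by measurable
  have "(\<integral>\<^sup>+c. I c \<partial>M) = (\<integral>\<^sup>+x. ennreal (\<bar>F (snd x) - F (fst x)\<bar> powr p) \<partial>(M \<Otimes>\<^sub>M M))"
    unfolding I_def by (subst nn_integral_fst[symmetric]) auto
  with fin have "AE c in M. I c \<noteq> \<infinity>"
    by (intro nn_integral_PInf_AE I) simp
  then obtain c where c: "I c \<noteq> \<infinity>"
    using eventually_happens'[OF ae_filter_bot] by blast
  have le: "\<bar>F \<omega>\<bar> powr p \<le> 2 powr p * (\<bar>F \<omega> - F c\<bar> powr p + \<bar>F c\<bar> powr p)" for \<omega>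
  proof -
    define m where "m = max \<bar>F \<omega> - F c\<bar> \<bar>F c\<bar>"
    have "\<bar>F \<omega> - F c\<bar> \<le> m" "\<bar>F c\<bar> \<le> m" by (simp_all add: m_def)
    then have "\<bar>F \<omega>\<bar> powr p \<le> (2 * m) powr p"
      using p by (intro powr_mono2) linarith+
    also have "\<dots> = 2 powr p * m powr p"
      by (simp add: powr_mult m_def)
    also have "m powr p \<le> \<bar>F \<omega> - F c\<bar> powr p + \<bar>F c\<bar> powr p"
      by (simp add: m_def max_def)
    finally show ?thesis by simp
  qed
  have "integrable M (\<lambda>\<omega>. \<bar>F \<omega> - F c\<bar> powr p)"
    using c by (intro integrableI_bounded) (auto simp: I_def less_top)
  then have "integrable M (\<lambda>\<omega>. 2 powr p * (\<bar>F \<omega> - F c\<bar> powr p + \<bar>F c\<bar> powr p))"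
    by simp
  then show ?thesis
    by (rule Bochner_Integration.integrable_bound) (use le in auto)
qed

theorem theorem3p2:
  fixes M :: "'w measure" and \<mu> :: "'z measure" and \<eta> :: "'w \<Rightarrow> 'z measure"
    and F :: "'w \<Rightarrow> real" and f :: "'z measure \<Rightarrow> real"
  assumes "prob_space M"
    and "sigma_finite_measure \<mu>"
    and "poisson_random_measure M \<mu> \<eta>"
    and "F \<in> borel_measurable (vimage_algebra (space M) \<eta> (N_sigma \<mu>))"
    and "f \<in> borel_measurable (N_sigma \<mu>)"
    and "\<And>\<omega>. \<omega> \<in> space M \<Longrightarrow> F \<omega> = f (\<eta> \<omega>)"
  shows "(\<forall>p\<in>{1..2}. \<forall>(M' :: 'v measure) \<pi> F'. independent_copy M F M' \<pi> F' \<longrightarrow>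
            (\<integral>\<^sup>+ \<omega>. ennreal (\<bar>F (\<pi> \<omega>) - F' \<omega>\<bar> powr p) \<partial>M')
              \<le> ennreal (2 powr (3 - p)) *
                 (\<integral>\<^sup>+ z. (\<integral>\<^sup>+ \<omega>. ennreal (\<bar>add_one_cost f \<eta> z \<omega>\<bar> powr p) \<partial>M) \<partial>\<mu>)) \<and>
         (\<forall>p\<in>{1..2}.
            ennreal (2 powr (3 - p)) *
              (\<integral>\<^sup>+ z. (\<integral>\<^sup>+ \<omega>. ennreal (\<bar>add_one_cost f \<eta> z \<omega>\<bar> powr p) \<partial>M) \<partial>\<mu>) < \<infinity> \<longrightarrow>
            F \<in> borel_measurable M \<and> integrable M (\<lambda>\<omega>. \<bar>F \<omega>\<bar> powr p))"
proof -
  interpret prob_space M by fact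
  let ?N = "N_sigma \<mu>"
  define Q where "Q = distr M ?N \<eta>"
  have \<eta> [measurable]: "\<eta> \<in> M \<rightarrow>\<^sub>M ?N"
    using assms(3) by (simp add: poisson_random_measure_def)
  note f [measurable] = assms(5)
  have F [measurable]: "F \<in> borel_measurable M"
    using measurable_compose[OF \<eta> f] by (rule measurable_cong[THEN iffD1, rotated]) (simp add: assms(6))
  have Q: "poisson_law \<mu> Q"
    unfolding Q_def by (rule poisson_law_random_measure[OF assms(1,3)])
  interpret Q: prob_space Q using Q by (simp add: poisson_law_def)
  have sQ [measurable_cong]: "sets Q = sets ?N" by (simp add: Q_def)
  have \<eta>Q [measurable]: "\<eta> \<in> M \<rightarrow>\<^sub>M Q"
    using \<eta> by (simp add: measurable_cong_sets[OF refl sQ])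
  have dQ: "distr M Q \<eta> = Q"
    unfolding Q_def by (rule distr_cong) simp_all
  have QQ: "Q \<Otimes>\<^sub>M Q = distr (M \<Otimes>\<^sub>M M) (Q \<Otimes>\<^sub>M Q) (\<lambda>(x, y). (\<eta> x, \<eta> y))"
    using pair_measure_distr[OF \<eta>Q \<eta>Q] Q.sigma_finite_measure_axioms by (simp add: dQ)
  define C where "C p = ennreal (2 powr (3 - p)) *
    (\<integral>\<^sup>+z. (\<integral>\<^sup>+\<omega>. ennreal (\<bar>add_one_cost f \<eta> z \<omega>\<bar> powr p) \<partial>M) \<partial>\<mu>)" for p
  have main: "(\<integral>\<^sup>+x. ennreal (\<bar>F (snd x) - F (fst x)\<bar> powr p) \<partial>(M \<Otimes>\<^sub>M M)) \<le> C p"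
    if p: "1 \<le> p" "p \<le> 2" for p
  proof -
    have "(\<integral>\<^sup>+x. ennreal (\<bar>F (snd x) - F (fst x)\<bar> powr p) \<partial>(M \<Otimes>\<^sub>M M)) =
        (\<integral>\<^sup>+x. ennreal (\<bar>f (\<eta> (snd x)) - f (\<eta> (fst x))\<bar> powr p) \<partial>(M \<Otimes>\<^sub>M M))"
      by (intro nn_integral_cong) (auto simp: space_pair_measure assms(6))
    also have "\<dots> = (\<integral>\<^sup>+x. ennreal (\<bar>f (snd x) - f (fst x)\<bar> powr p) \<partial>distr (M \<Otimes>\<^sub>M M) (Q \<Otimes>\<^sub>M Q) (\<lambda>(x, y). (\<eta> x, \<eta> y)))"
      by (subst nn_integral_distr) (auto simp: case_prod_beta')
    also have "\<dots> = (\<integral>\<^sup>+x. ennreal (\<bar>f (snd x) - f (fst x)\<bar> powr p) \<partial>(Q \<Otimes>\<^sub>M Q))"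
      by (simp only: QQ[symmetric])
    also have "\<dots> \<le> ennreal (2 powr (3 - p)) *
        (\<integral>\<^sup>+z. (\<integral>\<^sup>+\<nu>. ennreal (\<bar>f (add_dirac \<nu> z) - f \<nu>\<bar> powr p) \<partial>Q) \<partial>\<mu>)"
      by (rule poisson_law_difference_le[OF assms(2) Q f p])
    also have "\<dots> = C p"
      unfolding C_def
    proof (intro arg_cong2[where f = "(*)"] nn_integral_cong refl)
      fix z assume z: "z \<in> space \<mu>"
      have "(\<lambda>\<nu>. ennreal (\<bar>f (add_dirac \<nu> z) - f \<nu>\<bar> powr p)) \<in> borel_measurable Q"
        using z by measurable
      from nn_integral_distr[OF \<eta> this[unfolded Q_def]]
      show "(\<integral>\<^sup>+\<nu>. ennreal (\<bar>f (add_dirac \<nu> z) - f \<nu>\<bar> powr p) \<partial>Q) =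
          (\<integral>\<^sup>+\<omega>. ennreal (\<bar>add_one_cost f \<eta> z \<omega>\<bar> powr p) \<partial>M)"
        by (simp add: Q_def add_one_cost_def)
    qed
    finally show ?thesis .
  qed
  show ?thesis
    unfolding C_def[symmetric]
  proof (intro conjI ballI allI impI)
    fix p :: real and M' :: "'v measure" and \<pi> F'
    assume p: "p \<in> {1..2}" and copy: "independent_copy M F M' \<pi> F'"
    have "(\<integral>\<^sup>+\<omega>. ennreal (\<bar>F (\<pi> \<omega>) - F' \<omega>\<bar> powr p) \<partial>M') =
        (\<integral>\<^sup>+x. ennreal (\<bar>F (fst x) - F (snd x)\<bar> powr p) \<partial>(M \<Otimes>\<^sub>M M))"
      by (rule independent_copy_nn_integral[OF copy F]) measurable
    also have "\<dots> \<le> C p"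
      using main[of p] p by (simp add: abs_minus_commute)
    finally show "(\<integral>\<^sup>+\<omega>. ennreal (\<bar>F (\<pi> \<omega>) - F' \<omega>\<bar> powr p) \<partial>M') \<le> C p" .
  next
    fix p :: real assume p: "p \<in> {1..2}" and fin: "C p < \<infinity>"
    show "F \<in> borel_measurable M" by (rule F)
    show "integrable M (\<lambda>\<omega>. \<bar>F \<omega>\<bar> powr p)"
      using p main[of p] fin by (intro integrable_abs_powr_of_difference F) (auto intro: le_less_trans)
  qed
qed

end
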